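(* Let $\alpha$ be a shape. There exist constants $c_\alpha,C_\alpha>0$ and an integer $n_\alpha\ge 2$, depending only on $\alpha$, such that for every integer $n\ge n_\alpha$ the graph matrix $M_\alpha$ satisfies $$c_\alpha\,n^{\frac12(|V(\alpha)|-|S_{\min}|+|W_{\mathrm{iso}}|)}\;\le\;\mathbb E\|M_\alpha\|\;\le\;C_\alpha\,n^{\frac12(|V(\alpha)|-|S_{\min}|+|W_{\mathrm{iso}}|)}\,(\log n)^{\frac12 f(\alpha)},$$ where $f(\alpha)=|S_{\min}|-|U_\alpha\cap V_\alpha|+|W_\alpha|-|W_{\mathrm{iso}}|$, $|S_{\min}|$ is the minimal size of a $U_\alpha$--$V_\alpha$ vertex separator in $\alpha$, and $W_{\mathrm{iso}}$ is the set of all isolated middle vertices.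
   Context: A shape $\alpha$ is a finite (simple, undirected) graph with vertex set $V(\alpha)$, edge set $E(\alpha)$, and two distinguished subsets $U_\alpha,V_\alpha\subseteq V(\alpha)$ (left and right vertices), which may intersect, need not cover $V(\alpha)$, and need not have equal size. The middle vertices are $W_\alpha=V(\alpha)\setminus(U_\alpha\cup V_\alpha)$; $W_{\mathrm{iso}}\subseteq W_\alpha$ is the set of middle vertices with no incident edge in $\alpha$. Let $(\varepsilon_e)_{e\in E(K_n)}$ be i.i.d. Rademacher (uniform $\pm1$) variables indexed by the edges of the complete graph on $[n]=\{1,\dots,n\}$, i.e. by unordered pairs, so $\varepsilon_{a,b}=\varepsilon_{b,a}$. A realization is an injective map $\varphi:V(\alpha)\to[n]$. The graph matrix is the $n^{|U_\alpha|}\times n^{|V_\alpha|}$ random matrix $$M_\alpha=\sum_{\varphi\text{ realization}}\Big(\prod_{(i,j)\in E(\alpha)}\varepsilon_{\varphi(i),\varphi(j)}\Big)\,e_{\varphi(U_\alpha)}\otimes e_{\varphi(V_\alpha)}^\top,$$ where, after fixing orderings of $U_\alpha$ and $V_\alpha$, $e_{\varphi(U_\alpha)}=\bigotimes_{u\in U_\alpha}e_{\varphi(u)}$ and $e_{\varphi(V_\alpha)}=\bigotimes_{v\in V_\alpha}e_{\varphi(v)}$, with $e_1,\dots,e_n$ the standard basis of $\mathbb R^n$. A set $S\subseteq V(\alpha)$ is a $U_\alpha$--$V_\alpha$ vertex separator if every path in $\alpha$ from $U_\alpha$ to $V_\alpha$ (including single-vertex paths given by vertices of $U_\alpha\cap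 V_\alpha$) contains a vertex of $S$; $S$ may contain vertices of $U_\alpha\cup V_\alpha$. $\|\cdot\|$ is the operator (spectral) norm. *)

theory Defs
  imports "HOL-Probability.Probability" "HOL-Library.Ramsey"
begin

record 'a shape =
  verts :: "'a set"
  edges :: "'a set set"
  left_verts :: "'a set"
  right_verts :: "'a set"

text \<open>Edges are two-element vertex sets; \<^term>\<open>nsets A 2\<close> is the edge set of the complete graph on
  \<^term>\<open>A\<close>.\<close>

definition is_shape :: "'a shape \<Rightarrow> bool" where
  "is_shape \<alpha> \<longleftrightarrow> finite (verts \<alpha>) \<and> edges \<alpha> \<subseteq> nsets (verts \<alpha>) 2 \<and>
     left_verts \<alpha> \<subseteq> verts \<alpha> \<and> right_verts \<alpha> \<subseteq> verts \<alpha>"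

definition middle_verts :: "'a shape \<Rightarrow> 'a set" where
  "middle_verts \<alpha> = verts \<alpha> - (left_verts \<alpha> \<union> right_verts \<alpha>)"

definition isolated_middle_verts :: "'a shape \<Rightarrow> 'a set" where
  "isolated_middle_verts \<alpha> = {w \<in> middle_verts \<alpha>. \<forall>e\<in>edges \<alpha>. w \<notin> e}"

definition is_path :: "'a shape \<Rightarrow> 'a list \<Rightarrow> bool" where
  "is_path \<alpha> p \<longleftrightarrow> p \<noteq> [] \<and> set p \<subseteq> verts \<alpha> \<and> distinct p \<and>
     successively (\<lambda>u v. {u, v} \<in> edges \<alpha>) p"

definition is_separator :: "'a shape \<Rightarrow> 'a set \<Rightarrow> bool" where
  "is_separator \<alpha> S \<longleftrightarrow> S \<subseteq> verts \<alpha> \<and>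
     (\<forall>p. is_path \<alpha> p \<and> hd p \<in> left_verts \<alpha> \<and> last p \<in> right_verts \<alpha> \<longrightarrow> set p \<inter> S \<noteq> {})"

definition min_separator_size :: "'a shape \<Rightarrow> nat" where
  "min_separator_size \<alpha> = (LEAST k. \<exists>S. is_separator \<alpha> S \<and> card S = k)"

definition is_ordering :: "'a list \<Rightarrow> 'a set \<Rightarrow> bool" where
  "is_ordering xs A \<longleftrightarrow> distinct xs \<and> set xs = A"

text \<open>Vectors and matrices are real functions on finite index sets. The tensor power
  $(\mathbb{R}^n)^{\otimes k}$ is the space of functions on the $n^k$ tuples
  \<^term>\<open>multi_index n k\<close>; values outside the index set are irrelevant.\<close>

definition multi_index :: "nat \<Rightarrow> nat \<Rightarrow> nat list set" where
  "multi_index n k = {is. length is = k \<and> set is \<subseteq> {1..n}}"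

definition std_basis :: "nat \<Rightarrow> nat \<Rightarrow> real" where
  "std_basis a i = (if i = a then 1 else 0)"

definition tensor :: "(nat \<Rightarrow> real) list \<Rightarrow> nat list \<Rightarrow> real" where
  "tensor xs is = (\<Prod>k<length xs. (xs ! k) (is ! k))"

definition op_norm :: "'i set \<Rightarrow> 'j set \<Rightarrow> ('i \<Rightarrow> 'j \<Rightarrow> real) \<Rightarrow> real" where
  "op_norm I J A = (SUP x\<in>{x. L2_set x J \<le> 1}. L2_set (\<lambda>i. \<Sum>j\<in>J. A i j * x j) I)"

text \<open>Realizations are taken as extensional functions, so that each injective map from the vertex
  set to $\{1,\dots,n\}$ is counted exactly once.\<close>

definition realizations :: "nat \<Rightarrow> 'a shape \<Rightarrow> ('a \<Rightarrow> nat) set" where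
  "realizations n \<alpha> = {\<phi> \<in> verts \<alpha> \<rightarrow>\<^sub>E {1..n}. inj_on \<phi> (verts \<alpha>)}"

text \<open>An edge $e = \{i,j\}$ is sent by a realization to the edge $\{\varphi(i),\varphi(j)\}$, the image
  of $e$. The lists \<^term>\<open>us\<close> and \<^term>\<open>vs\<close> are the chosen orderings of the left and right
  vertices.\<close>

definition graph_matrix ::
  "nat \<Rightarrow> 'a shape \<Rightarrow> 'a list \<Rightarrow> 'a list \<Rightarrow> (nat set \<Rightarrow> real) \<Rightarrow> nat list \<Rightarrow> nat list \<Rightarrow> real" where
  "graph_matrix n \<alpha> us vs \<epsilon> is js =
     (\<Sum>\<phi>\<in>realizations n \<alpha>. (\<Prod>e\<in>edges \<alpha>. \<epsilon> (\<phi> ` e)) *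
        (tensor (map (\<lambda>u. std_basis (\<phi> u)) us) is * tensor (map (\<lambda>v. std_basis (\<phi> v)) vs) js))"

definition graph_matrix_norm ::
  "nat \<Rightarrow> 'a shape \<Rightarrow> 'a list \<Rightarrow> 'a list \<Rightarrow> (nat set \<Rightarrow> real) \<Rightarrow> real" where
  "graph_matrix_norm n \<alpha> us vs \<epsilon> =
     op_norm (multi_index n (length us)) (multi_index n (length vs)) (graph_matrix n \<alpha> us vs \<epsilon>)"

text \<open>The joint law of i.i.d. uniform signs on the edges of $K_n$; the value 0 off the edges of $K_n$
  is a convention of \<^const>\<open>Pi_pmf\<close> and is never used.\<close>

definition rademacher_edges :: "nat \<Rightarrow> (nat set \<Rightarrow> real) pmf" where
  "rademacher_edges n = Pi_pmf (nsets {1..n} 2) 0 (\<lambda>_. pmf_of_set {-1, 1})"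

definition norm_exponent :: "'a shape \<Rightarrow> real" where
  "norm_exponent \<alpha> = (real (card (verts \<alpha>)) - real (min_separator_size \<alpha>)
     + real (card (isolated_middle_verts \<alpha>))) / 2"

definition log_exponent :: "'a shape \<Rightarrow> real" where
  "log_exponent \<alpha> = real (min_separator_size \<alpha>) - real (card (left_verts \<alpha> \<inter> right_verts \<alpha>))
     + real (card (middle_verts \<alpha>)) - real (card (isolated_middle_verts \<alpha>))"

end

(* Upper bound: bound E||M||^(2q) with q of order log n by the trace of the q-th power of M^T M, a sum over
   cyclic chains of 2q realizations in which every edge label must occur at least twice.  In an interior copy of
   the shape, no edge joins a vertex whose label is new to a vertex whose label never returns; so the vertices of
   neither kind form a separator, and counting each label at its first and at its last occurrence gives at most
   q(|V| - |S_min| + |W_iso|) + O(1) distinct labels.  The number of chains with so few labels then produces both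
   the power of n and the power of log n.

   Lower bound: fix the labels of a minimum separator S and let A and B be the graph vectors of the two sides.
   The expectation of A^T M B is at least the number of realizations extending the fixed labels, while |A| and |B|
   have second moments of order n^|L| and n^|R|.  A fourth moment (Bonami) bound for polynomials in the signs turns
   this into a lower bound for E||M||. *)

theory Submission
  imports Defs
begin

text \<open>The moments are taken at exponents 2q with \<open>q\<close> a power of two, so that
  repeated Cauchy-Schwarz can replace the spectral theorem. The two bounds on \<open>q\<close> serve
  different ends: ln n \<le> q keeps the 2q-th root of n^O(1) bounded, so the O(1) surplus labels
  cost only a constant, and q \<le> 2 ln n turns the remaining powers of \<open>q\<close> into
  powers of log n. Counting label sets by a binomial coefficient matters: its factorial cancels most
  of the powers of \<open>q\<close> that a naive count would leave.

  The obstacle in the lower bound is dependence: |A|, |B| and the norm are functions of the same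
  signs, and separating them in E(||M|| |A| |B|) by Cauchy-Schwarz would involve the second moment
  of the norm. With a square root inside the expectation the product separates into E||M|| and E(|A|
  |B|). What remains is that E sqrt|Z| is at least a constant times sqrt(E Z), and this is what the
  fourth moment is for.

  An isolated middle vertex placed on one side would be labelled independently in the two factors of
  |A|^2. Such vertices are therefore kept out of both sides and contribute n instead of sqrt
  n.\<close>

section \<open>Operator norm and powers of the Gram matrix\<close>

text \<open>The Frobenius bound. It makes the set under the supremum in \<open>op_norm\<close>
  bounded, without which a real \<open>SUP\<close> says nothing, and for a symmetric matrix it leads
  to the trace of the square.\<close>

lemma L2_set_matrix_le:
  fixes A :: "'i \<Rightarrow> 'j \<Rightarrow> real"
  shows "L2_set (\<lambda>i. \<Sum>j\<in>J. A i j * x j) I \<le> L2_set (\<lambda>i. L2_set (A i) J) I * L2_set x J"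
proof -
  have "L2_set (\<lambda>i. \<Sum>j\<in>J. A i j * x j) I \<le> L2_set (\<lambda>i. L2_set (A i) J * L2_set x J) I"
    unfolding L2_set_def[of _ I]
  proof (intro real_sqrt_le_mono sum_mono)
    fix i
    have "\<bar>\<Sum>j\<in>J. A i j * x j\<bar> \<le> L2_set (A i) J * L2_set x J"
      by (rule order_trans[OF sum_abs]) (use L2_set_mult_ineq[of "A i" x J] in \<open>simp add: abs_mult\<close>)
    then show "(\<Sum>j\<in>J. A i j * x j)\<^sup>2 \<le> (L2_set (A i) J * L2_set x J)\<^sup>2"
      by (metis abs_ge_zero power2_abs power_mono)
  qed
  also have "\<dots> = L2_set (\<lambda>i. L2_set (A i) J) I * L2_set x J"
    by (simp add: L2_set_left_distrib)
  finally show ?thesis .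
qed

lemma bdd_above_op_norm:
  fixes A :: "'i \<Rightarrow> 'j \<Rightarrow> real"
  shows "bdd_above ((\<lambda>x. L2_set (\<lambda>i. \<Sum>j\<in>J. A i j * x j) I) ` {x. L2_set x J \<le> 1})"
proof (rule bdd_aboveI2)
  fix x :: "'j \<Rightarrow> real" assume "x \<in> {x. L2_set x J \<le> 1}"
  then have "L2_set (\<lambda>i. L2_set (A i) J) I * L2_set x J \<le> L2_set (\<lambda>i. L2_set (A i) J) I"
    by (simp add: mult_left_le)
  then show "L2_set (\<lambda>i. \<Sum>j\<in>J. A i j * x j) I \<le> L2_set (\<lambda>i. L2_set (A i) J) I"
    using L2_set_matrix_le[where A=A and J=J and x=x and I=I] by linarith
qed

lemma op_norm_nonneg: "0 \<le> op_norm I J A"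
proof -
  have "L2_set (\<lambda>i. \<Sum>j\<in>J. A i j * 0) I \<le> op_norm I J A"
    unfolding op_norm_def by (rule cSUP_upper[OF _ bdd_above_op_norm]) (simp add: L2_set_def)
  then show ?thesis by (simp add: L2_set_def)
qed

lemma L2_set_le_op_norm:
  assumes "finite J"
  shows "L2_set (\<lambda>i. \<Sum>j\<in>J. A i j * y j) I \<le> op_norm I J A * L2_set y J"
proof (cases "L2_set y J = 0")
  case True
  then have "y j = 0" if "j \<in> J" for j
    using that assms by (simp add: L2_set_eq_0_iff)
  then show ?thesis using True by (simp add: L2_set_def)
next
  case False
  define c where "c = L2_set y J"
  have c: "c > 0" using False by (simp add: c_def order_less_le)
  have "L2_set (\<lambda>j. inverse c * y j) J \<le> 1"
    using c by (subst L2_set_right_distrib[symmetric]) (auto simp: c_def)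
  then have "L2_set (\<lambda>i. \<Sum>j\<in>J. A i j * (inverse c * y j)) I \<le> op_norm I J A"
    unfolding op_norm_def by (intro cSUP_upper[OF _ bdd_above_op_norm]) simp
  moreover have "L2_set (\<lambda>i. \<Sum>j\<in>J. A i j * (inverse c * y j)) I
      = inverse c * L2_set (\<lambda>i. \<Sum>j\<in>J. A i j * y j) I"
    using c by (subst L2_set_right_distrib) (auto simp: sum_distrib_left mult_ac)
  ultimately have "inverse c * L2_set (\<lambda>i. \<Sum>j\<in>J. A i j * y j) I \<le> op_norm I J A"
    by metis
  then show ?thesis using c unfolding c_def[symmetric] by (simp add: field_simps)
qed

lemma bilinear_le_op_norm:
  assumes "finite J"
  shows "\<bar>\<Sum>i\<in>I. \<Sum>j\<in>J. x i * A i j * y j\<bar> \<le> op_norm I J A * (L2_set x I * L2_set y J)"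
proof -
  have "\<bar>\<Sum>i\<in>I. \<Sum>j\<in>J. x i * A i j * y j\<bar> = \<bar>\<Sum>i\<in>I. x i * (\<Sum>j\<in>J. A i j * y j)\<bar>"
    by (simp add: sum_distrib_left mult.assoc)
  also have "\<dots> \<le> L2_set x I * L2_set (\<lambda>i. \<Sum>j\<in>J. A i j * y j) I"
    by (rule order_trans[OF sum_abs])
      (use L2_set_mult_ineq[of x "\<lambda>i. \<Sum>j\<in>J. A i j * y j" I] in \<open>simp add: abs_mult\<close>)
  also have "\<dots> \<le> L2_set x I * (op_norm I J A * L2_set y J)"
    by (intro mult_left_mono L2_set_le_op_norm assms) simp
  finally show ?thesis by (simp add: mult_ac)
qed

section \<open>Trace bounds through repeated squaring, and their expansion into chains\<close>

definition mat_prod :: "'j set \<Rightarrow> ('i \<Rightarrow> 'j \<Rightarrow> real) \<Rightarrow> ('j \<Rightarrow> 'k \<Rightarrow> real) \<Rightarrow> 'i \<Rightarrow> 'k \<Rightarrow> real" where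
  "mat_prod J A B i k = (\<Sum>j\<in>J. A i j * B j k)"

text \<open>This is the matrix power with exponent 2^k. Only these exponents occur, since each
  squaring of the matrix is matched by one use of Cauchy-Schwarz.\<close>

primrec dyadic_pow :: "'j set \<Rightarrow> ('j \<Rightarrow> 'j \<Rightarrow> real) \<Rightarrow> nat \<Rightarrow> 'j \<Rightarrow> 'j \<Rightarrow> real" where
  "dyadic_pow J A 0 = A"
| "dyadic_pow J A (Suc k) = mat_prod J (dyadic_pow J A k) (dyadic_pow J A k)"

lemma dyadic_pow_sym:
  assumes "\<And>i j. A i j = A j i"
  shows "dyadic_pow J A k i j = dyadic_pow J A k j i"
proof (induction k arbitrary: i j)
  case (Suc k)
  have "dyadic_pow J A k i l * dyadic_pow J A k l j = dyadic_pow J A k j l * dyadic_pow J A k l i" for l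
    by (metis Suc mult.commute)
  then show ?case by (simp add: mat_prod_def)
qed (simp add: assms)

text \<open>With y = A x, symmetry turns the quadratic form of the squared matrix into |y|^2.
  Cauchy-Schwarz for the inner product of x and y gives the first bound. The Frobenius bound for |y|
  gives the second, because the squared Frobenius norm of a symmetric matrix is the trace of its
  square.\<close>

lemma quadratic_form_square_le:
  assumes "finite J" and sym: "\<And>i j. A i j = A j i" and x: "L2_set x J \<le> 1"
  shows "(\<Sum>i\<in>J. \<Sum>j\<in>J. x i * A i j * x j)\<^sup>2 \<le> (\<Sum>i\<in>J. \<Sum>j\<in>J. x i * mat_prod J A A i j * x j)"
    and "(\<Sum>i\<in>J. \<Sum>j\<in>J. x i * mat_prod J A A i j * x j) \<le> (\<Sum>j\<in>J. mat_prod J A A j j)"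
proof -
  define y where "y i = (\<Sum>j\<in>J. A i j * x j)" for i
  have eq: "(\<Sum>i\<in>J. \<Sum>j\<in>J. x i * mat_prod J A A i j * x j) = (L2_set y J)\<^sup>2"
  proof -
    have "(\<Sum>i\<in>J. \<Sum>j\<in>J. x i * mat_prod J A A i j * x j)
        = (\<Sum>i\<in>J. \<Sum>j\<in>J. \<Sum>l\<in>J. (A l i * x i) * (A l j * x j))"
      unfolding mat_prod_def sum_distrib_left sum_distrib_right
      by (intro sum.cong refl) (metis (no_types, opaque_lifting) mult.assoc mult.commute sym)
    also have "\<dots> = (\<Sum>l\<in>J. \<Sum>i\<in>J. \<Sum>j\<in>J. (A l i * x i) * (A l j * x j))"
      by (subst sum.swap[of _ J J], subst sum.swap) (meson sum.swap sum.cong)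
    also have "\<dots> = (\<Sum>l\<in>J. (y l)\<^sup>2)"
      by (simp add: y_def power2_eq_square sum_product)
    also have "\<dots> = (L2_set y J)\<^sup>2"
      by (simp add: L2_set_def sum_nonneg)
    finally show ?thesis .
  qed
  have "\<bar>\<Sum>i\<in>J. \<Sum>j\<in>J. x i * A i j * x j\<bar> = \<bar>\<Sum>i\<in>J. x i * y i\<bar>"
    by (simp add: y_def sum_distrib_left mult.assoc)
  also have "\<dots> \<le> L2_set x J * L2_set y J"
    by (rule order_trans[OF sum_abs]) (use L2_set_mult_ineq[of x y J] in \<open>simp add: abs_mult\<close>)
  also have "\<dots> \<le> L2_set y J" using x by (simp add: mult_left_le_one_le)
  finally have "\<bar>\<Sum>i\<in>J. \<Sum>j\<in>J. x i * A i j * x j\<bar>\<^sup>2 \<le> (L2_set y J)\<^sup>2"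
    by (intro power_mono) auto
  then show "(\<Sum>i\<in>J. \<Sum>j\<in>J. x i * A i j * x j)\<^sup>2 \<le> (\<Sum>i\<in>J. \<Sum>j\<in>J. x i * mat_prod J A A i j * x j)"
    by (simp add: eq)
  have "L2_set y J \<le> L2_set (\<lambda>i. L2_set (A i) J) J * L2_set x J"
    unfolding y_def by (rule L2_set_matrix_le)
  also have "\<dots> \<le> L2_set (\<lambda>i. L2_set (A i) J) J"
    using x by (simp add: mult_left_le)
  finally have "(L2_set y J)\<^sup>2 \<le> (L2_set (\<lambda>i. L2_set (A i) J) J)\<^sup>2"
    by (intro power_mono) auto
  also have "\<dots> = (\<Sum>j\<in>J. mat_prod J A A j j)"
    unfolding L2_set_def mat_prod_def by (simp add: sum_nonneg power2_eq_square sym)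
  finally show "(\<Sum>i\<in>J. \<Sum>j\<in>J. x i * mat_prod J A A i j * x j) \<le> (\<Sum>j\<in>J. mat_prod J A A j j)"
    by (simp add: eq)
qed

lemma quadratic_form_dyadic_pow_le:
  assumes "finite J" and sym: "\<And>i j. A i j = A j i" and x: "L2_set x J \<le> 1"
    and pos: "0 \<le> (\<Sum>i\<in>J. \<Sum>j\<in>J. x i * A i j * x j)"
  shows "(\<Sum>i\<in>J. \<Sum>j\<in>J. x i * A i j * x j) ^ 2 ^ k
    \<le> (\<Sum>i\<in>J. \<Sum>j\<in>J. x i * dyadic_pow J A k i j * x j)"
proof (induction k)
  case (Suc k)
  have "(\<Sum>i\<in>J. \<Sum>j\<in>J. x i * A i j * x j) ^ 2 ^ Suc k
      = ((\<Sum>i\<in>J. \<Sum>j\<in>J. x i * A i j * x j) ^ 2 ^ k)\<^sup>2"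
    by (simp add: power_mult[symmetric] mult.commute)
  also have "\<dots> \<le> (\<Sum>i\<in>J. \<Sum>j\<in>J. x i * dyadic_pow J A k i j * x j)\<^sup>2"
    by (intro power_mono Suc.IH zero_le_power pos)
  also have "\<dots> \<le> (\<Sum>i\<in>J. \<Sum>j\<in>J. x i * dyadic_pow J A (Suc k) i j * x j)"
    using quadratic_form_square_le(1)[OF assms(1) dyadic_pow_sym[OF sym] x] by simp
  finally show ?case .
qed simp

definition gram :: "'i set \<Rightarrow> ('i \<Rightarrow> 'j \<Rightarrow> real) \<Rightarrow> 'j \<Rightarrow> 'j \<Rightarrow> real" where
  "gram I A j j' = (\<Sum>i\<in>I. A i j * A i j')"

text \<open>The Gram form at x is |A x|^2, whence the outer factor 2 in the exponent. The dyadic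
  index is a successor so that the last matrix is itself a square, to which the trace bound
  applies.\<close>

lemma op_norm_power_le_trace:
  fixes A :: "'i \<Rightarrow> 'j \<Rightarrow> real"
  assumes "finite J"
  shows "op_norm I J A ^ (2 * 2 ^ Suc k) \<le> (\<Sum>j\<in>J. dyadic_pow J (gram I A) (Suc k) j j)"
    (is "_ \<le> ?T")
proof -
  have sym: "gram I A i j = gram I A j i" for i j
    by (simp add: gram_def mult.commute)
  have *: "L2_set (\<lambda>i. \<Sum>j\<in>J. A i j * x j) I ^ (2 * 2 ^ Suc k) \<le> ?T" if x: "L2_set x J \<le> 1" for x
  proof -
    have eq: "(\<Sum>i\<in>J. \<Sum>j\<in>J. x i * gram I A i j * x j) = (L2_set (\<lambda>i. \<Sum>j\<in>J. A i j * x j) I)\<^sup>2"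
    proof -
      have "(\<Sum>i\<in>J. \<Sum>j\<in>J. x i * gram I A i j * x j)
          = (\<Sum>i\<in>J. \<Sum>j\<in>J. \<Sum>l\<in>I. (A l i * x i) * (A l j * x j))"
        by (simp add: gram_def sum_distrib_left sum_distrib_right mult_ac)
      also have "\<dots> = (\<Sum>i\<in>J. \<Sum>l\<in>I. \<Sum>j\<in>J. (A l i * x i) * (A l j * x j))"
        by (intro sum.cong refl sum.swap)
      also have "\<dots> = (\<Sum>l\<in>I. \<Sum>i\<in>J. \<Sum>j\<in>J. (A l i * x i) * (A l j * x j))"
        by (rule sum.swap)
      also have "\<dots> = (\<Sum>l\<in>I. (\<Sum>j\<in>J. A l j * x j)\<^sup>2)"
        by (simp add: power2_eq_square sum_product)
      also have "\<dots> = (L2_set (\<lambda>i. \<Sum>j\<in>J. A i j * x j) I)\<^sup>2"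
        by (simp add: L2_set_def sum_nonneg)
      finally show ?thesis .
    qed
    have "L2_set (\<lambda>i. \<Sum>j\<in>J. A i j * x j) I ^ (2 * 2 ^ Suc k)
        = (\<Sum>i\<in>J. \<Sum>j\<in>J. x i * gram I A i j * x j) ^ 2 ^ Suc k"
      unfolding eq by (simp only: power_mult)
    also have "\<dots> \<le> (\<Sum>i\<in>J. \<Sum>j\<in>J. x i * dyadic_pow J (gram I A) (Suc k) i j * x j)"
      by (intro quadratic_form_dyadic_pow_le assms sym x) (simp add: eq)
    also have "\<dots> \<le> ?T"
      using quadratic_form_square_le(2)[OF assms dyadic_pow_sym[OF sym] x] by simp
    finally show ?thesis .
  qed
  have T0: "0 \<le> ?T"
    by (rule order_trans[OF zero_le_power *[of "\<lambda>_. 0"]]) (simp_all add: L2_set_def)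
  \<comment> \<open>The root lets the bound for single vectors pass to the supremum before it is
    raised to the power again.\<close>
  have "op_norm I J A \<le> root (2 * 2 ^ Suc k) ?T"
    unfolding op_norm_def
  proof (rule cSUP_least)
    show "{x. L2_set x J \<le> 1} \<noteq> {}" by (auto intro: exI[of _ "\<lambda>_. 0"] simp: L2_set_def)
    fix x assume "x \<in> {x. L2_set x J \<le> 1}"
    then have "root (2 * 2 ^ Suc k) (L2_set (\<lambda>i. \<Sum>j\<in>J. A i j * x j) I ^ (2 * 2 ^ Suc k))
        \<le> root (2 * 2 ^ Suc k) ?T"
      by (intro real_root_le_mono *) auto
    then show "L2_set (\<lambda>i. \<Sum>j\<in>J. A i j * x j) I \<le> root (2 * 2 ^ Suc k) ?T"
      by (subst (asm) real_root_power_cancel) auto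
  qed
  then have "op_norm I J A ^ (2 * 2 ^ Suc k) \<le> root (2 * 2 ^ Suc k) ?T ^ (2 * 2 ^ Suc k)"
    by (intro power_mono op_norm_nonneg)
  then show ?thesis
    by (subst (asm) real_root_pow_pos2) (use T0 in auto)
qed

text \<open>A matrix given as a sum of weighted elementary matrices: the term \<open>\<phi> \<in> R\<close> sits in row \<open>l \<phi>\<close> and
  column \<open>r \<phi>\<close>. Powers of its Gram matrix are sums over chains of pairs of terms.\<close>

definition linked :: "('r \<Rightarrow> 'j) \<Rightarrow> 'r \<times> 'r \<Rightarrow> 'r \<times> 'r \<Rightarrow> bool" where
  "linked r x y \<longleftrightarrow> r (snd x) = r (fst y)"

text \<open>Within a pair the two terms share a row, the index summed in \<open>gram\<close>;
  consecutive pairs share a column, the index summed in \<open>mat_prod\<close>. Chains are left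
  open so that they compose by concatenation; the trace closes them only at the end.\<close>

definition gram_chains :: "'r set \<Rightarrow> ('r \<Rightarrow> 'i) \<Rightarrow> ('r \<Rightarrow> 'j) \<Rightarrow> nat \<Rightarrow> ('r \<times> 'r) list set" where
  "gram_chains R l r m = {p. length p = m \<and> set p \<subseteq> {x \<in> R \<times> R. l (fst x) = l (snd x)} \<and> successively (linked r) p}"

definition chain_weight :: "('r \<Rightarrow> real) \<Rightarrow> ('r \<times> 'r) list \<Rightarrow> real" where
  "chain_weight w p = (\<Prod>x\<leftarrow>p. w (fst x) * w (snd x))"

lemma finite_gram_chains:
  assumes "finite R"
  shows "finite (gram_chains R l r m)"
proof -
  have "gram_chains R l r m \<subseteq> {p. set p \<subseteq> R \<times> R \<and> length p = m}"
    by (auto simp: gram_chains_def)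
  then show ?thesis by (rule finite_subset) (simp add: assms finite_lists_length_eq)
qed

lemma gram_chains_append:
  assumes "p \<in> gram_chains R l r m" "p' \<in> gram_chains R l r m'" "m > 0" "m' > 0"
  shows "p @ p' \<in> gram_chains R l r (m + m') \<longleftrightarrow> r (snd (last p)) = r (fst (hd p'))"
  using assms by (auto simp: gram_chains_def successively_append_iff linked_def)

lemma gram_eq_sum_chains:
  assumes R: "finite R" and I: "finite I" "l ` R \<subseteq> I"
  shows "gram I (\<lambda>i j. \<Sum>\<phi>\<in>R. w \<phi> * (if l \<phi> = i \<and> r \<phi> = j then 1 else 0)) j j'
    = (\<Sum>p\<in>{p \<in> gram_chains R l r 1. r (fst (hd p)) = j \<and> r (snd (last p)) = j'}. chain_weight w p)"
proof -
  let ?M = "\<lambda>i j. \<Sum>\<phi>\<in>R. w \<phi> * (if l \<phi> = i \<and> r \<phi> = j then 1 else 0)"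
  let ?d = "\<lambda>x. r (fst x) = j \<and> r (snd x) = j'"
  have "gram I ?M j j' = (\<Sum>i\<in>I. \<Sum>\<phi>\<in>R. \<Sum>\<psi>\<in>R.
      (if l \<phi> = i then w \<phi> * w \<psi> * (if l \<phi> = l \<psi> \<and> r \<phi> = j \<and> r \<psi> = j' then 1 else 0) else 0))"
    unfolding gram_def sum_product by (intro sum.cong refl) auto
  also have "\<dots> = (\<Sum>\<phi>\<in>R. \<Sum>i\<in>I. \<Sum>\<psi>\<in>R.
      (if l \<phi> = i then w \<phi> * w \<psi> * (if l \<phi> = l \<psi> \<and> r \<phi> = j \<and> r \<psi> = j' then 1 else 0) else 0))"
    by (rule sum.swap)
  also have "\<dots> = (\<Sum>\<phi>\<in>R. \<Sum>\<psi>\<in>R. \<Sum>i\<in>I.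
      (if l \<phi> = i then w \<phi> * w \<psi> * (if l \<phi> = l \<psi> \<and> r \<phi> = j \<and> r \<psi> = j' then 1 else 0) else 0))"
    by (intro sum.cong refl sum.swap)
  also have "\<dots> = (\<Sum>\<phi>\<in>R. \<Sum>\<psi>\<in>R. w \<phi> * w \<psi> * (if l \<phi> = l \<psi> \<and> r \<phi> = j \<and> r \<psi> = j' then 1 else 0))"
    using I by (intro sum.cong refl) (auto simp: sum.delta)
  also have "\<dots> = (\<Sum>x\<in>R \<times> R. w (fst x) * w (snd x) * (if l (fst x) = l (snd x) \<and> ?d x then 1 else 0))"
    by (simp add: sum.cartesian_product case_prod_beta)
  also have "\<dots> = (\<Sum>x\<in>{x \<in> R \<times> R. l (fst x) = l (snd x) \<and> ?d x}. w (fst x) * w (snd x))"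
    by (rule sum.mono_neutral_cong_right) (use R in auto)
  also have "\<dots> = (\<Sum>p\<in>{p \<in> gram_chains R l r 1. ?d (hd p)}. chain_weight w p)"
    by (rule sum.reindex_bij_witness[of _ hd "\<lambda>x. [x]"])
      (auto simp: gram_chains_def length_Suc_conv chain_weight_def)
  also have "{p \<in> gram_chains R l r 1. ?d (hd p)} = {p \<in> gram_chains R l r 1. r (fst (hd p)) = j \<and> r (snd (last p)) = j'}"
    by (auto simp: gram_chains_def length_Suc_conv)
  finally show ?thesis .
qed

text \<open>A chain of m + m' pairs is cut after m pairs, and the summation index of the product is
  the column shared at the cut. Both lengths are positive, so the halves are nonempty and their
  outer ends are the ends of the whole chain.\<close>

lemma mat_prod_sum_chains:
  assumes R: "finite R" and J: "finite J" "r ` R \<subseteq> J" and m: "m > 0" "m' > 0"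
  shows "mat_prod J
      (\<lambda>j j'. \<Sum>p\<in>{p \<in> gram_chains R l r m. r (fst (hd p)) = j \<and> r (snd (last p)) = j'}. chain_weight w p)
      (\<lambda>j j'. \<Sum>p\<in>{p \<in> gram_chains R l r m'. r (fst (hd p)) = j \<and> r (snd (last p)) = j'}. chain_weight w p) j j'
    = (\<Sum>p\<in>{p \<in> gram_chains R l r (m + m'). r (fst (hd p)) = j \<and> r (snd (last p)) = j'}. chain_weight w p)"
    (is "?lhs = sum _ ?S")
proof -
  let ?A = "\<lambda>i. {p \<in> gram_chains R l r m. r (fst (hd p)) = j \<and> r (snd (last p)) = i}"
  let ?B = "\<lambda>i. {p \<in> gram_chains R l r m'. r (fst (hd p)) = i \<and> r (snd (last p)) = j'}"
  have last: "r (snd (last p)) \<in> J" if "p \<in> gram_chains R l r m" for p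
  proof -
    have "last p \<in> set p" using that m by (auto simp: gram_chains_def)
    then have "snd (last p) \<in> R" using that by (auto simp: gram_chains_def)
    then show ?thesis using J by blast
  qed
  have "?lhs = (\<Sum>i\<in>J. \<Sum>x\<in>?A i \<times> ?B i. chain_weight w (fst x @ snd x))"
    unfolding mat_prod_def sum_product sum.cartesian_product
    by (simp add: chain_weight_def case_prod_beta)
  also have "\<dots> = (\<Sum>x\<in>(\<Union>i\<in>J. ?A i \<times> ?B i). chain_weight w (fst x @ snd x))"
    by (rule sum.UNION_disjoint[symmetric]) (use J R in \<open>auto intro!: finite_subset[OF _ finite_gram_chains[OF R]]\<close>)
  also have "\<dots> = sum (chain_weight w) ?S"
  proof (rule sum.reindex_bij_witness[of _ "\<lambda>p. (take m p, drop m p)" "\<lambda>x. fst x @ snd x"])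
    fix x assume x: "x \<in> (\<Union>i\<in>J. ?A i \<times> ?B i)"
    then have len: "length (fst x) = m" "length (snd x) = m'" by (auto simp: gram_chains_def)
    then show "(take m (fst x @ snd x), drop m (fst x @ snd x)) = x" by simp
    have "fst x \<noteq> []" "snd x \<noteq> []" using len m by auto
    then show "fst x @ snd x \<in> ?S" using x m by (auto simp: gram_chains_append)
  next
    fix p assume p: "p \<in> ?S"
    let ?q = "take m p" and ?q' = "drop m p"
    have p_eq: "p = ?q @ ?q'" by simp
    have len: "length p = m + m'" using p by (auto simp: gram_chains_def)
    then have ne: "?q \<noteq> []" "?q' \<noteq> []" using m by auto
    have "successively (linked r) (?q @ ?q')" using p by (auto simp: gram_chains_def)
    then have s: "successively (linked r) ?q" "successively (linked r) ?q'" "linked r (last ?q) (hd ?q')"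
      using ne by (auto simp only: successively_append_iff)
    have "set p \<subseteq> {x \<in> R \<times> R. l (fst x) = l (snd x)}" using p by (auto simp: gram_chains_def)
    then have q: "?q \<in> gram_chains R l r m" "?q' \<in> gram_chains R l r m'"
      using s len by (auto simp: gram_chains_def dest: in_set_takeD in_set_dropD)
    have "hd ?q = hd p" "last ?q' = last p" using ne len m by (simp_all add: hd_take last_drop)
    then show "(?q, ?q') \<in> (\<Union>i\<in>J. ?A i \<times> ?B i)"
      using p q s(3) last[OF q(1)] by (auto simp: linked_def)
    show "fst (?q, ?q') @ snd (?q, ?q') = p" by simp
  next
    fix x assume "x \<in> (\<Union>i\<in>J. ?A i \<times> ?B i)"
    show "chain_weight w (fst x @ snd x) = chain_weight w (fst x @ snd x)" ..
  qed
  finally show ?thesis .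
qed

lemma dyadic_pow_gram_eq_sum_chains:
  assumes R: "finite R" and I: "finite I" "l ` R \<subseteq> I" and J: "finite J" "r ` R \<subseteq> J"
  shows "dyadic_pow J (gram I (\<lambda>i j. \<Sum>\<phi>\<in>R. w \<phi> * (if l \<phi> = i \<and> r \<phi> = j then 1 else 0))) k
    = (\<lambda>j j'. \<Sum>p\<in>{p \<in> gram_chains R l r (2 ^ k). r (fst (hd p)) = j \<and> r (snd (last p)) = j'}. chain_weight w p)"
proof (induction k)
  case 0
  show ?case by (intro ext) (simp add: gram_eq_sum_chains[OF R I])
next
  case (Suc k)
  show ?case
    by (intro ext) (simp add: Suc mat_prod_sum_chains[OF R J] mult_2)
qed

lemma op_norm_power_le_sum_chains:
  fixes R :: "'r set" and l :: "'r \<Rightarrow> 'i" and r :: "'r \<Rightarrow> 'j" and w :: "'r \<Rightarrow> real"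
  assumes R: "finite R" and I: "finite I" "l ` R \<subseteq> I" and J: "finite J" "r ` R \<subseteq> J"
  shows "op_norm I J (\<lambda>i j. \<Sum>\<phi>\<in>R. w \<phi> * (if l \<phi> = i \<and> r \<phi> = j then 1 else 0)) ^ (2 * 2 ^ Suc k)
    \<le> (\<Sum>p\<in>{p \<in> gram_chains R l r (2 ^ Suc k). r (fst (hd p)) = r (snd (last p))}. chain_weight w p)"
proof -
  let ?S = "\<lambda>j. {p \<in> gram_chains R l r (2 ^ Suc k). r (fst (hd p)) = j \<and> r (snd (last p)) = j}"
  have hd: "r (fst (hd p)) \<in> J" if "p \<in> gram_chains R l r (2 ^ Suc k)" for p
  proof -
    have "p \<noteq> []" using that by (auto simp: gram_chains_def)
    then have "hd p \<in> set p" by simp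
    then have "fst (hd p) \<in> R" using that by (auto simp: gram_chains_def)
    then show ?thesis using J by blast
  qed
  have "op_norm I J (\<lambda>i j. \<Sum>\<phi>\<in>R. w \<phi> * (if l \<phi> = i \<and> r \<phi> = j then 1 else 0)) ^ (2 * 2 ^ Suc k)
      \<le> (\<Sum>j\<in>J. sum (chain_weight w) (?S j))"
    using op_norm_power_le_trace[OF J(1), of I "\<lambda>i j. \<Sum>\<phi>\<in>R. w \<phi> * (if l \<phi> = i \<and> r \<phi> = j then 1 else 0)" k]
    unfolding dyadic_pow_gram_eq_sum_chains[OF assms] .
  also have "\<dots> = (\<Sum>p\<in>(\<Union>j\<in>J. ?S j). chain_weight w p)"
    by (rule sum.UNION_disjoint[symmetric]) (use J R in \<open>auto intro!: finite_subset[OF _ finite_gram_chains[OF R]]\<close>)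
  also have "(\<Union>j\<in>J. ?S j) = {p \<in> gram_chains R l r (2 ^ Suc k). r (fst (hd p)) = r (snd (last p))}"
    using hd by (auto simp del: power_Suc) metis
  finally show ?thesis .
qed

section \<open>Polynomials in independent signs\<close>

text \<open>The same law as \<open>rademacher_edges\<close>, but over an arbitrary index set, so
  that expectations can be computed by induction on the set of signs.\<close>

definition signs :: "'e set \<Rightarrow> ('e \<Rightarrow> real) pmf" where
  "signs A = Pi_pmf A 0 (\<lambda>_. pmf_of_set {-1, 1})"

lemma finite_set_pmf_signs: "finite A \<Longrightarrow> finite (set_pmf (signs A))"
  unfolding signs_def by (subst set_Pi_pmf) (auto intro!: finite_PiE_dflt)

lemma signs_value:
  assumes "finite A" "\<epsilon> \<in> set_pmf (signs A)" "e \<in> A"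
  shows "\<epsilon> e = -1 \<or> \<epsilon> e = 1"
  using assms unfolding signs_def by (auto simp: set_Pi_pmf PiE_dflt_def)

lemma integrable_signs:
  fixes f :: "('e \<Rightarrow> real) \<Rightarrow> real"
  shows "finite A \<Longrightarrow> integrable (signs A) f"
  by (intro integrable_measure_pmf_finite finite_set_pmf_signs)

lemma expectation_signs_mono:
  fixes f g :: "('e \<Rightarrow> real) \<Rightarrow> real"
  assumes "finite A" "\<And>\<epsilon>. \<epsilon> \<in> set_pmf (signs A) \<Longrightarrow> f \<epsilon> \<le> g \<epsilon>"
  shows "measure_pmf.expectation (signs A) f \<le> measure_pmf.expectation (signs A) g"
  using assms by (intro integral_mono_AE integrable_signs) (auto simp: AE_measure_pmf_iff)

lemma expectation_signs_cong:
  fixes f g :: "('e \<Rightarrow> real) \<Rightarrow> real"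
  assumes "\<And>\<epsilon>. \<epsilon> \<in> set_pmf (signs A) \<Longrightarrow> f \<epsilon> = g \<epsilon>"
  shows "measure_pmf.expectation (signs A) f = measure_pmf.expectation (signs A) g"
  using assms by (intro integral_cong_AE) (auto simp: AE_measure_pmf_iff)

lemma expectation_signs_sum:
  fixes f :: "'i \<Rightarrow> ('e \<Rightarrow> real) \<Rightarrow> real"
  assumes "finite A"
  shows "measure_pmf.expectation (signs A) (\<lambda>\<epsilon>. \<Sum>i\<in>I. f i \<epsilon>)
    = (\<Sum>i\<in>I. measure_pmf.expectation (signs A) (f i))"
  by (intro Bochner_Integration.integral_sum integrable_signs assms)

text \<open>Averaging over one sign while the others stay fixed. This is the induction step both for
  the moments of monomials and for the fourth moment inequality.\<close>

lemma expectation_signs_insert: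
  fixes f :: "('e \<Rightarrow> real) \<Rightarrow> real"
  assumes "finite A" "a \<notin> A"
  shows "measure_pmf.expectation (signs (insert a A)) f
    = measure_pmf.expectation (signs A) (\<lambda>\<epsilon>. (f (\<epsilon>(a := 1)) + f (\<epsilon>(a := -1))) / 2)"
proof -
  have "signs (insert a A) = bind_pmf (pmf_of_set {-1,1}) (\<lambda>s. map_pmf (\<lambda>\<epsilon>. \<epsilon>(a := s)) (signs A))"
    unfolding signs_def
    by (subst Pi_pmf_insert'[OF assms]) (simp add: map_pmf_def)
  then have "measure_pmf.expectation (signs (insert a A)) f
      = measure_pmf.expectation (pmf_of_set {-1,1::real})
          (\<lambda>s. measure_pmf.expectation (map_pmf (\<lambda>\<epsilon>. \<epsilon>(a := s)) (signs A)) f)"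
    using assms(1) by (simp add: pmf_expectation_bind[where A = "{-1, 1}"] finite_set_pmf_signs integral_pmf_of_set)
  also have "\<dots> = (measure_pmf.expectation (signs A) (\<lambda>\<epsilon>. f (\<epsilon>(a := 1)))
      + measure_pmf.expectation (signs A) (\<lambda>\<epsilon>. f (\<epsilon>(a := -1)))) / 2"
    by (subst integral_pmf_of_set) auto
  finally show ?thesis
    using assms by (simp add: integrable_signs)
qed

lemma expectation_signs_prod_power:
  assumes "finite A"
  shows "measure_pmf.expectation (signs A) (\<lambda>\<epsilon>. \<Prod>e\<in>A. \<epsilon> e ^ k e) = (\<Prod>e\<in>A. if even (k e) then 1 else 0)"
  using assms
proof (induction A rule: finite_induct)
  case (insert a A)
  have "(\<Prod>e\<in>insert a A. (\<epsilon>(a := s)) e ^ k e) = s ^ k a * (\<Prod>e\<in>A. \<epsilon> e ^ k e)" for \<epsilon> and s :: real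
  proof -
    have "(\<Prod>e\<in>A. (\<epsilon>(a := s)) e ^ k e) = (\<Prod>e\<in>A. \<epsilon> e ^ k e)"
      using insert.hyps by (intro prod.cong) auto
    then show ?thesis using insert.hyps by (simp del: fun_upd_apply) simp
  qed
  then have "measure_pmf.expectation (signs (insert a A)) (\<lambda>\<epsilon>. \<Prod>e\<in>insert a A. \<epsilon> e ^ k e)
      = measure_pmf.expectation (signs A) (\<lambda>\<epsilon>. (1 + (-1) ^ k a) / 2 * (\<Prod>e\<in>A. \<epsilon> e ^ k e))"
    by (simp only: expectation_signs_insert[OF insert.hyps]) (simp add: algebra_simps add_divide_distrib)
  also have "\<dots> = (if even (k a) then 1 else 0) * (\<Prod>e\<in>A. if even (k e) then 1 else 0)"
    using insert.IH by (subst integral_mult_right_zero) (cases "even (k a)"; simp)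
  finally show ?case using insert.hyps by simp
qed simp

text \<open>The factors are grouped by the sign that they use, and a group of odd size has mean
  zero. Fibres outside \<open>A\<close> are empty, so quantifying over all \<open>e\<close> changes
  nothing. The upper bound uses that a value 1 forces repeated signs; the lower bound uses that the
  value is never negative.\<close>

lemma expectation_signs_prod:
  assumes A: "finite A" and I: "finite I" "g ` I \<subseteq> A"
  shows "measure_pmf.expectation (signs A) (\<lambda>\<epsilon>. \<Prod>i\<in>I. \<epsilon> (g i))
    = (if \<forall>e. even (card {i\<in>I. g i = e}) then 1 else 0)"
proof -
  have "measure_pmf.expectation (signs A) (\<lambda>\<epsilon>. \<Prod>i\<in>I. \<epsilon> (g i))
      = measure_pmf.expectation (signs A) (\<lambda>\<epsilon>. \<Prod>e\<in>A. \<epsilon> e ^ card {i\<in>I. g i = e})"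
  proof (rule expectation_signs_cong)
    fix \<epsilon> :: "'a \<Rightarrow> real"
    have "(\<Prod>i\<in>I. \<epsilon> (g i)) = (\<Prod>e\<in>A. \<Prod>i\<in>{i\<in>I. g i = e}. \<epsilon> (g i))"
      using prod.group[OF I(1) A I(2), of "\<lambda>i. \<epsilon> (g i)"] by simp
    then show "(\<Prod>i\<in>I. \<epsilon> (g i)) = (\<Prod>e\<in>A. \<epsilon> e ^ card {i\<in>I. g i = e})" by simp
  qed
  also have "\<dots> = (\<Prod>e\<in>A. if even (card {i\<in>I. g i = e}) then 1 else 0)"
    by (rule expectation_signs_prod_power[OF A])
  also have "\<dots> = (if \<forall>e. even (card {i\<in>I. g i = e}) then 1 else 0)"
  proof -
    have "card {i\<in>I. g i = e} = 0" if "e \<notin> A" for e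
    proof -
      have "{i\<in>I. g i = e} = {}" using I(2) that by auto
      then show ?thesis by (simp only: card.empty)
    qed
    then have *: "(\<forall>e. even (card {i\<in>I. g i = e})) \<longleftrightarrow> (\<forall>e\<in>A. even (card {i\<in>I. g i = e}))"
      by (metis even_zero)
    show ?thesis unfolding * using A by (auto intro!: prod_zero)
  qed
  finally show ?thesis .
qed

lemma expectation_cauchy_schwarz_signs:
  fixes f g :: "('e \<Rightarrow> real) \<Rightarrow> real"
  assumes "finite A"
  shows "(measure_pmf.expectation (signs A) (\<lambda>\<epsilon>. f \<epsilon> * g \<epsilon>))\<^sup>2
    \<le> measure_pmf.expectation (signs A) (\<lambda>\<epsilon>. (f \<epsilon>)\<^sup>2) * measure_pmf.expectation (signs A) (\<lambda>\<epsilon>. (g \<epsilon>)\<^sup>2)"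
proof -
  let ?p = "pmf (signs A)"
  have E: "measure_pmf.expectation (signs A) h = (\<Sum>\<epsilon>\<in>set_pmf (signs A). ?p \<epsilon> * h \<epsilon>)" for h :: "_ \<Rightarrow> real"
    by (subst integral_measure_pmf[OF finite_set_pmf_signs[OF assms]]) (auto simp: set_pmf_iff)
  have "(\<Sum>\<epsilon>\<in>set_pmf (signs A). (sqrt (?p \<epsilon>) * f \<epsilon>) * (sqrt (?p \<epsilon>) * g \<epsilon>))\<^sup>2
      \<le> (\<Sum>\<epsilon>\<in>set_pmf (signs A). (sqrt (?p \<epsilon>) * f \<epsilon>)\<^sup>2) * (\<Sum>\<epsilon>\<in>set_pmf (signs A). (sqrt (?p \<epsilon>) * g \<epsilon>)\<^sup>2)"
    by (rule Cauchy_Schwarz_ineq_sum)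
  moreover have "(sqrt (?p \<epsilon>) * f \<epsilon>) * (sqrt (?p \<epsilon>) * g \<epsilon>) = ?p \<epsilon> * (f \<epsilon> * g \<epsilon>)" for \<epsilon>
    using real_sqrt_mult_self[of "?p \<epsilon>"] by (simp add: algebra_simps)
  ultimately show ?thesis by (simp add: E power_mult_distrib)
qed

text \<open>A multilinear polynomial of degree at most \<open>d\<close> in the signs is written as
  \<open>\<Sum>j\<in>J. a j * (\<Prod>e\<in>T j. \<epsilon> e)\<close>; the induction singles out one sign and splits off the part divisible by it.\<close>

theorem bonami_fourth_moment:
  fixes a :: "'j \<Rightarrow> real" and T :: "'j \<Rightarrow> 'e set"
  assumes "finite A" "finite J" "\<And>j. j \<in> J \<Longrightarrow> T j \<subseteq> A \<and> card (T j) \<le> d"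
  shows "measure_pmf.expectation (signs A) (\<lambda>\<epsilon>. (\<Sum>j\<in>J. a j * (\<Prod>e\<in>T j. \<epsilon> e)) ^ 4)
    \<le> 9 ^ d * (measure_pmf.expectation (signs A) (\<lambda>\<epsilon>. (\<Sum>j\<in>J. a j * (\<Prod>e\<in>T j. \<epsilon> e))\<^sup>2))\<^sup>2"
  using assms
proof (induction A arbitrary: J T d rule: finite_induct)
  case empty
  then have "T j = {}" if "j \<in> J" for j using that by auto
  then have eq: "(\<Sum>j\<in>J. a j * (\<Prod>e\<in>T j. \<epsilon> e)) = sum a J" for \<epsilon> :: "'e \<Rightarrow> real"
    by (intro sum.cong) auto
  have "(sum a J) ^ 4 * 1 \<le> (sum a J) ^ 4 * 9 ^ d" by (intro mult_left_mono) auto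
  then show ?case by (simp add: eq mult.commute flip: power_mult)
next
  case (insert x A)
  let ?E = "measure_pmf.expectation (signs A)"
  define J0 where "J0 = {j\<in>J. x \<notin> T j}"
  define J1 where "J1 = {j\<in>J. x \<in> T j}"
  define g where "g \<epsilon> = (\<Sum>j\<in>J0. a j * (\<Prod>e\<in>T j. \<epsilon> e))" for \<epsilon> :: "'e \<Rightarrow> real"
  define h where "h \<epsilon> = (\<Sum>j\<in>J1. a j * (\<Prod>e\<in>T j - {x}. \<epsilon> e))" for \<epsilon> :: "'e \<Rightarrow> real"
  have fin: "finite (T j)" if "j \<in> J" for j
    using insert.prems(2)[OF that] insert.hyps(1) by (auto intro: finite_subset)
  have split: "(\<Sum>j\<in>J. a j * (\<Prod>e\<in>T j. (\<epsilon>(x := s)) e)) = g \<epsilon> + s * h \<epsilon>" for \<epsilon> :: "'e \<Rightarrow> real" and s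
  proof -
    have "(\<Sum>j\<in>J. a j * (\<Prod>e\<in>T j. (\<epsilon>(x := s)) e))
        = (\<Sum>j\<in>J0. a j * (\<Prod>e\<in>T j. (\<epsilon>(x := s)) e)) + (\<Sum>j\<in>J1. a j * (\<Prod>e\<in>T j. (\<epsilon>(x := s)) e))"
      using insert.prems(1) by (subst sum.union_disjoint[symmetric]) (auto simp: J0_def J1_def intro!: sum.cong)
    also have "(\<Sum>j\<in>J0. a j * (\<Prod>e\<in>T j. (\<epsilon>(x := s)) e)) = g \<epsilon>"
      unfolding g_def by (intro sum.cong refl arg_cong2[of _ _ _ _ "(*)"] prod.cong) (auto simp: J0_def)
    also have "(\<Sum>j\<in>J1. a j * (\<Prod>e\<in>T j. (\<epsilon>(x := s)) e)) = s * h \<epsilon>"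
      unfolding h_def sum_distrib_left
    proof (intro sum.cong refl)
      fix j assume j: "j \<in> J1"
      have "(\<Prod>e\<in>T j. (\<epsilon>(x := s)) e) = s * (\<Prod>e\<in>T j - {x}. (\<epsilon>(x := s)) e)"
        using j fin by (subst prod.remove[of _ x]) (auto simp: J1_def)
      also have "(\<Prod>e\<in>T j - {x}. (\<epsilon>(x := s)) e) = (\<Prod>e\<in>T j - {x}. \<epsilon> e)"
        by (intro prod.cong) auto
      finally show "a j * (\<Prod>e\<in>T j. (\<epsilon>(x := s)) e) = s * (a j * (\<Prod>e\<in>T j - {x}. \<epsilon> e))" by simp
    qed
    finally show ?thesis .
  qed
  have fA: "finite A" by fact
  have g4: "?E (\<lambda>\<epsilon>. g \<epsilon> ^ 4) \<le> 9 ^ d * (?E (\<lambda>\<epsilon>. (g \<epsilon>)\<^sup>2))\<^sup>2"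
    unfolding g_def using insert.prems by (intro insert.IH) (auto simp: J0_def)
  \<comment> \<open>If some monomial contains \<open>x\<close>, then \<open>h\<close> has degree at
    most d - 1, and the induction hypothesis saves a factor 9. Otherwise \<open>h\<close>
    vanishes.\<close>
  have h4: "9 * ?E (\<lambda>\<epsilon>. h \<epsilon> ^ 4) \<le> 9 ^ d * (?E (\<lambda>\<epsilon>. (h \<epsilon>)\<^sup>2))\<^sup>2"
  proof (cases "J1 = {}")
    case True
    then show ?thesis by (simp add: h_def)
  next
    case False
    have card: "card (T j - {x}) \<le> d - 1 \<and> d > 0" if "j \<in> J1" for j
      using that insert.prems(2)[of j] fin[of j] card_gt_0_iff[of "T j"]
      by (auto simp: J1_def card_Diff_singleton)
    with False obtain d' where d': "d = Suc d'" by (metis all_not_in_conv gr0_implies_Suc)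
    have "?E (\<lambda>\<epsilon>. h \<epsilon> ^ 4) \<le> 9 ^ d' * (?E (\<lambda>\<epsilon>. (h \<epsilon>)\<^sup>2))\<^sup>2"
      unfolding h_def using insert.prems card d'
      by (intro insert.IH) (fastforce simp: J1_def)+
    then show ?thesis by (simp add: d')
  qed
  define G where "G = ?E (\<lambda>\<epsilon>. (g \<epsilon>)\<^sup>2)"
  define H where "H = ?E (\<lambda>\<epsilon>. (h \<epsilon>)\<^sup>2)"
  have GH: "G \<ge> 0" "H \<ge> 0" by (simp_all add: G_def H_def)
  \<comment> \<open>The 3 is the square root of the 9 saved for \<open>h\<close>. Doubled, this
    bounds the cross term 6 g^2 h^2 by exactly the term 2 G H that completes the square of G +
    H.\<close>
  have gh: "3 * ?E (\<lambda>\<epsilon>. (g \<epsilon>)\<^sup>2 * (h \<epsilon>)\<^sup>2) \<le> 9 ^ d * (G * H)"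
  proof (rule power2_le_imp_le)
    have "(?E (\<lambda>\<epsilon>. (g \<epsilon>)\<^sup>2 * (h \<epsilon>)\<^sup>2))\<^sup>2 \<le> ?E (\<lambda>\<epsilon>. ((g \<epsilon>)\<^sup>2)\<^sup>2) * ?E (\<lambda>\<epsilon>. ((h \<epsilon>)\<^sup>2)\<^sup>2)"
      by (rule expectation_cauchy_schwarz_signs[OF fA])
    then have "(3 * ?E (\<lambda>\<epsilon>. (g \<epsilon>)\<^sup>2 * (h \<epsilon>)\<^sup>2))\<^sup>2 \<le> ?E (\<lambda>\<epsilon>. g \<epsilon> ^ 4) * (9 * ?E (\<lambda>\<epsilon>. h \<epsilon> ^ 4))"
      by (simp add: power_mult_distrib flip: power_mult)
    also have "\<dots> \<le> (9 ^ d * G\<^sup>2) * (9 ^ d * H\<^sup>2)"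
      using g4 h4 unfolding G_def H_def by (rule mult_mono) simp_all
    also have "\<dots> = (9 ^ d * (G * H))\<^sup>2"
      by (simp add: power_mult_distrib power2_eq_square mult_ac)
    finally show "(3 * ?E (\<lambda>\<epsilon>. (g \<epsilon>)\<^sup>2 * (h \<epsilon>)\<^sup>2))\<^sup>2 \<le> (9 ^ d * (G * H))\<^sup>2" .
  qed (use GH in simp)
  have measure_h4: "0 \<le> ?E (\<lambda>\<epsilon>. h \<epsilon> ^ 4)" by simp
  have p4: "((g \<epsilon> + 1 * h \<epsilon>) ^ 4 + (g \<epsilon> + (-1) * h \<epsilon>) ^ 4) / 2
      = g \<epsilon> ^ 4 + 6 * ((g \<epsilon>)\<^sup>2 * (h \<epsilon>)\<^sup>2) + h \<epsilon> ^ 4" for \<epsilon> :: "'e \<Rightarrow> real"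
    by (simp add: power2_eq_square power4_eq_xxxx) (simp add: algebra_simps)
  have p2: "((g \<epsilon> + 1 * h \<epsilon>)\<^sup>2 + (g \<epsilon> + (-1) * h \<epsilon>)\<^sup>2) / 2 = (g \<epsilon>)\<^sup>2 + (h \<epsilon>)\<^sup>2" for \<epsilon> :: "'e \<Rightarrow> real"
    by (simp add: power2_eq_square algebra_simps)
  have "measure_pmf.expectation (signs (insert x A)) (\<lambda>\<epsilon>. (\<Sum>j\<in>J. a j * (\<Prod>e\<in>T j. \<epsilon> e)) ^ 4)
      = ?E (\<lambda>\<epsilon>. g \<epsilon> ^ 4 + 6 * ((g \<epsilon>)\<^sup>2 * (h \<epsilon>)\<^sup>2) + h \<epsilon> ^ 4)"
    by (simp only: expectation_signs_insert[OF insert.hyps] split p4)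
  also have "\<dots> = ?E (\<lambda>\<epsilon>. g \<epsilon> ^ 4) + 6 * ?E (\<lambda>\<epsilon>. (g \<epsilon>)\<^sup>2 * (h \<epsilon>)\<^sup>2) + ?E (\<lambda>\<epsilon>. h \<epsilon> ^ 4)"
    by (simp add: integrable_signs fA)
  also have "\<dots> \<le> 9 ^ d * G\<^sup>2 + 2 * (9 ^ d * (G * H)) + 9 ^ d * H\<^sup>2"
    using g4 gh h4 measure_h4 unfolding G_def[symmetric] H_def[symmetric] by linarith
  also have "\<dots> = 9 ^ d * (G + H)\<^sup>2"
    by (simp add: power2_eq_square algebra_simps)
  also have "G + H = measure_pmf.expectation (signs (insert x A)) (\<lambda>\<epsilon>. (\<Sum>j\<in>J. a j * (\<Prod>e\<in>T j. \<epsilon> e))\<^sup>2)"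
    by (simp only: expectation_signs_insert[OF insert.hyps] split p2)
      (simp add: G_def H_def integrable_signs fA)
  finally show ?case .
qed

section \<open>Half moments bounded below by second and fourth moments\<close>

lemma sqrt_ge_square_minus_fourth:
  fixes t l :: real
  assumes "0 \<le> t" "0 < l"
  shows "sqrt l * ((t / l)\<^sup>2 - (t / l) ^ 4) \<le> sqrt t"
proof -
  define u where "u = t / l"
  have u: "u \<ge> 0" using assms by (simp add: u_def)
  have "u\<^sup>2 - u ^ 4 \<le> sqrt u"
  proof (cases "u \<le> 1")
    case True
    have "(u\<^sup>2)\<^sup>2 \<le> u"
      using u True power_decreasing[of 1 4 u] by (simp flip: power_mult)
    then have "u\<^sup>2 \<le> sqrt u" by (rule real_le_rsqrt)
    then show ?thesis using zero_le_power[OF u, of 4] by linarith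
  next
    case False
    then have "u\<^sup>2 \<le> u ^ 4" by (intro power_increasing) auto
    then show ?thesis using u by (smt (verit) real_sqrt_ge_zero)
  qed
  then have "sqrt l * (u\<^sup>2 - u ^ 4) \<le> sqrt l * sqrt u" using assms by (intro mult_left_mono) auto
  also have "\<dots> = sqrt t" using assms by (simp add: u_def flip: real_sqrt_mult)
  finally show ?thesis by (simp add: u_def)
qed

text \<open>The polynomial u^2 - u^4 lies below sqrt u for u \<ge> 0. Its expectation at u = |Z| / l
  involves only the second and fourth moments, and the scale l can be chosen to make it
  positive.\<close>

lemma expectation_sqrt_ge_of_fourth_moment:
  fixes Z :: "('e \<Rightarrow> real) \<Rightarrow> real"
  assumes A: "finite A" and K: "K \<ge> 1"
    and mom: "measure_pmf.expectation (signs A) (\<lambda>\<epsilon>. Z \<epsilon> ^ 4) \<le> K * (measure_pmf.expectation (signs A) (\<lambda>\<epsilon>. (Z \<epsilon>)\<^sup>2))\<^sup>2"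
    and pos: "measure_pmf.expectation (signs A) Z > 0"
  shows "sqrt (measure_pmf.expectation (signs A) Z) / (4 * K)
    \<le> measure_pmf.expectation (signs A) (\<lambda>\<epsilon>. sqrt \<bar>Z \<epsilon>\<bar>)"
proof -
  let ?E = "measure_pmf.expectation (signs A)"
  define V where "V = ?E (\<lambda>\<epsilon>. (Z \<epsilon>)\<^sup>2)"
  have EZ: "(?E Z)\<^sup>2 \<le> V"
    using expectation_cauchy_schwarz_signs[OF A, of Z "\<lambda>_. 1"] by (simp add: V_def)
  then have V: "V > 0" using pos by (smt (verit) zero_less_power)
  \<comment> \<open>This scale gives V / l^2 - K V^2 / l^4 = 1 / (2 K) - 1 / (4 K) = 1 / (4 K), and
    since K \<ge> 1 it still dominates E Z.\<close>
  define l where "l = sqrt (2 * K * V)"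
  have l: "l > 0" "l\<^sup>2 = 2 * K * V" using V K by (simp_all add: l_def)
  have l4: "l ^ 4 = 4 * K\<^sup>2 * V\<^sup>2"
    using l(2) by (metis (mono_tags) mult_2 numeral_Bit0 power_add power2_eq_square power_mult_distrib mult.assoc mult_2_right numeral_times_numeral semiring_norm(13) four_x_squared)
  have EZl: "?E Z \<le> l"
  proof (rule power2_le_imp_le)
    have "V * 1 \<le> V * (2 * K)" using V K by (intro mult_left_mono) auto
    then show "(?E Z)\<^sup>2 \<le> l\<^sup>2" using EZ l(2) by (simp add: mult_ac)
  qed (use l in simp)
  have "sqrt (?E Z) / (4 * K) \<le> sqrt l / (4 * K)"
    using EZl K by (intro divide_right_mono) auto
  also have "\<dots> = sqrt l * (V / l\<^sup>2 - K * V\<^sup>2 / l ^ 4)"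
    unfolding l4 l(2) using V K by (simp add: field_simps power2_eq_square)
  also have "\<dots> \<le> sqrt l * (V / l\<^sup>2 - ?E (\<lambda>\<epsilon>. Z \<epsilon> ^ 4) / l ^ 4)"
    using mom l by (intro mult_left_mono diff_left_mono divide_right_mono) (auto simp: V_def)
  also have "\<dots> = ?E (\<lambda>\<epsilon>. sqrt l * ((\<bar>Z \<epsilon>\<bar> / l)\<^sup>2 - (\<bar>Z \<epsilon>\<bar> / l) ^ 4))"
    using A by (simp add: integrable_signs V_def power_divide)
  also have "\<dots> \<le> ?E (\<lambda>\<epsilon>. sqrt \<bar>Z \<epsilon>\<bar>)"
    using l by (intro expectation_signs_mono A sqrt_ge_square_minus_fourth) auto
  finally show ?thesis .
qed

section \<open>Labels and separators\<close>

lemma min_separator_size_le: "is_separator \<alpha> S \<Longrightarrow> min_separator_size \<alpha> \<le> card S"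
  unfolding min_separator_size_def by (rule Least_le) blast

lemma verts_is_separator: "is_separator \<alpha> (verts \<alpha>)"
proof -
  have "set p \<inter> verts \<alpha> \<noteq> {}" if "is_path \<alpha> p" for p
    using that by (cases p) (auto simp: is_path_def)
  then show ?thesis by (simp add: is_separator_def)
qed

lemma ex_min_separator: "\<exists>S. is_separator \<alpha> S \<and> card S = min_separator_size \<alpha>"
  unfolding min_separator_size_def
  by (rule LeastI_ex[where P = "\<lambda>k. \<exists>S. is_separator \<alpha> S \<and> card S = k"]) (use verts_is_separator in blast)

lemma separator_contains_intersection:
  assumes "is_shape \<alpha>" "is_separator \<alpha> S"
  shows "left_verts \<alpha> \<inter> right_verts \<alpha> \<subseteq> S"
proof
  fix x assume x: "x \<in> left_verts \<alpha> \<inter> right_verts \<alpha>"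
  then have "is_path \<alpha> [x]" using assms(1) by (auto simp: is_path_def is_shape_def)
  then show "x \<in> S" using x assms(2) by (force simp: is_separator_def)
qed

lemma successively_closed:
  assumes "successively P p" "p \<noteq> []" "hd p \<in> Q"
    and "\<And>x y. x \<in> set p \<Longrightarrow> y \<in> set p \<Longrightarrow> P x y \<Longrightarrow> x \<in> Q \<Longrightarrow> y \<in> Q"
  shows "set p \<subseteq> Q"
  using assms by (induction p rule: induct_list012) auto

section \<open>First and last occurrences of labels in a sequence of copies\<close>

definition first_occ :: "'a set \<Rightarrow> (nat \<Rightarrow> 'a \<Rightarrow> 'b) \<Rightarrow> nat \<Rightarrow> 'a set" where
  "first_occ X \<Phi> t = {x \<in> X. \<forall>t'<t. \<Phi> t x \<notin> \<Phi> t' ` X}"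

definition last_occ :: "'a set \<Rightarrow> (nat \<Rightarrow> 'a \<Rightarrow> 'b) \<Rightarrow> nat \<Rightarrow> nat \<Rightarrow> 'a set" where
  "last_occ X \<Phi> T t = {x \<in> X. \<forall>t'<T. t < t' \<longrightarrow> \<Phi> t x \<notin> \<Phi> t' ` X}"

text \<open>Each label is charged to the earliest copy in which it appears; the companion lemma
  charges it to the latest. Adding the two counts every label twice, which is the origin of the
  factor 1/2 in \<open>norm_exponent\<close>. Vertices are counted rather than labels, so that the
  sets can be compared with separators of the shape.\<close>

lemma card_labels_le_first_occ:
  assumes "finite X"
  shows "card (\<Union>t<T. \<Phi> t ` X) \<le> (\<Sum>t<T. card (first_occ X \<Phi> t))"
proof -
  have "(\<Union>t<T. \<Phi> t ` X) \<subseteq> (\<Union>t<T. \<Phi> t ` first_occ X \<Phi> t)"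
  proof
    fix a assume "a \<in> (\<Union>t<T. \<Phi> t ` X)"
    then obtain t where t: "t < T" "a \<in> \<Phi> t ` X" by auto
    define t0 where "t0 = (LEAST t. a \<in> \<Phi> t ` X)"
    have "a \<in> \<Phi> t0 ` X" "t0 \<le> t" using t(2) unfolding t0_def by (auto intro: LeastI Least_le)
    moreover have "a \<notin> \<Phi> t' ` X" if "t' < t0" for t' using that unfolding t0_def by (rule not_less_Least)
    ultimately have "a \<in> \<Phi> t0 ` first_occ X \<Phi> t0" unfolding first_occ_def by blast
    then show "a \<in> (\<Union>t<T. \<Phi> t ` first_occ X \<Phi> t)" using t \<open>t0 \<le> t\<close> by auto
  qed
  then have "card (\<Union>t<T. \<Phi> t ` X) \<le> card (\<Union>t<T. \<Phi> t ` first_occ X \<Phi> t)"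
    using assms by (intro card_mono) (auto simp: first_occ_def)
  also have "\<dots> \<le> (\<Sum>t<T. card (\<Phi> t ` first_occ X \<Phi> t))" by (rule card_UN_le) simp
  also have "\<dots> \<le> (\<Sum>t<T. card (first_occ X \<Phi> t))"
    using assms by (intro sum_mono card_image_le) (auto simp: first_occ_def)
  finally show ?thesis .
qed

lemma card_labels_le_last_occ:
  assumes "finite X"
  shows "card (\<Union>t<T. \<Phi> t ` X) \<le> (\<Sum>t<T. card (last_occ X \<Phi> T t))"
proof -
  have "(\<Union>t<T. \<Phi> t ` X) \<subseteq> (\<Union>t<T. \<Phi> t ` last_occ X \<Phi> T t)"
  proof
    fix a assume "a \<in> (\<Union>t<T. \<Phi> t ` X)"
    then obtain t where t: "t < T" "a \<in> \<Phi> t ` X" by auto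
    define t0 where "t0 = (GREATEST t. t < T \<and> a \<in> \<Phi> t ` X)"
    have "t0 < T \<and> a \<in> \<Phi> t0 ` X"
      unfolding t0_def by (rule GreatestI_nat[where b = T and k = t]) (use t in auto)
    moreover have "a \<notin> \<Phi> t' ` X" if "t' < T" "t0 < t'" for t'
    proof
      assume "a \<in> \<Phi> t' ` X"
      then have "t' \<le> t0" unfolding t0_def by (intro Greatest_le_nat[where b = T]) (use that in auto)
      then show False using that by simp
    qed
    ultimately have "a \<in> \<Phi> t0 ` last_occ X \<Phi> T t0" "t0 < T" unfolding last_occ_def by blast+
    then show "a \<in> (\<Union>t<T. \<Phi> t ` last_occ X \<Phi> T t)" by auto
  qed
  then have "card (\<Union>t<T. \<Phi> t ` X) \<le> card (\<Union>t<T. \<Phi> t ` last_occ X \<Phi> T t)"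
    using assms by (intro card_mono) (auto simp: last_occ_def)
  also have "\<dots> \<le> (\<Sum>t<T. card (\<Phi> t ` last_occ X \<Phi> T t))" by (rule card_UN_le) simp
  also have "\<dots> \<le> (\<Sum>t<T. card (last_occ X \<Phi> T t))"
    using assms by (intro sum_mono card_image_le) (auto simp: last_occ_def)
  finally show ?thesis .
qed

text \<open>The heart of the upper bound: in an interior copy of the shape no edge joins a vertex whose label is
  new to a vertex whose label never returns, so the remaining vertices form a separator.\<close>

lemma card_first_last_occ_le:
  fixes \<alpha> :: "'a shape" and \<Phi> :: "nat \<Rightarrow> 'a \<Rightarrow> nat"
  assumes shape: "is_shape \<alpha>"
    and inj: "\<And>t. t < T \<Longrightarrow> inj_on (\<Phi> t) (verts \<alpha>)"
    and twice: "\<And>t e. t < T \<Longrightarrow> e \<in> edges \<alpha> \<Longrightarrow>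
      \<exists>t'<T. \<exists>e'\<in>edges \<alpha>. (t', e') \<noteq> (t, e) \<and> \<Phi> t' ` e' = \<Phi> t ` e"
    and t: "Suc t < T" "0 < t"
    and sides: "X = left_verts \<alpha> \<and> Y = right_verts \<alpha> \<or> X = right_verts \<alpha> \<and> Y = left_verts \<alpha>"
    and X: "\<And>x. x \<in> X \<Longrightarrow> \<Phi> t x = \<Phi> (t - 1) x"
    and Y: "\<And>y. y \<in> Y \<Longrightarrow> \<Phi> t y = \<Phi> (Suc t) y"
  shows "card (first_occ (verts \<alpha>) \<Phi> t) + card (last_occ (verts \<alpha>) \<Phi> T t)
    \<le> card (verts \<alpha>) - min_separator_size \<alpha> + card (isolated_middle_verts \<alpha>)"
proof -
  define A where "A = first_occ (verts \<alpha>) \<Phi> t"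
  define B where "B = last_occ (verts \<alpha>) \<Phi> T t"
  define S where "S = verts \<alpha> - (A \<union> B)"
  have fin: "finite (verts \<alpha>)" using shape by (simp add: is_shape_def)
  have AB: "A \<subseteq> verts \<alpha>" "B \<subseteq> verts \<alpha>" by (auto simp: A_def B_def first_occ_def last_occ_def)
  have edge_sub: "e \<subseteq> verts \<alpha>" if "e \<in> edges \<alpha>" for e
    using shape that by (auto simp: is_shape_def nsets_def)
  have XY: "X \<subseteq> verts \<alpha>" "Y \<subseteq> verts \<alpha>" using sides shape by (auto simp: is_shape_def)
  \<comment> \<open>The vertices of \<open>X\<close> carry the labels that they had in the preceding
    copy, so these labels are not new. Likewise the labels on \<open>Y\<close> return in the next
    copy.\<close>
  have XA: "x \<notin> A" if "x \<in> X" for x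
  proof
    assume "x \<in> A"
    moreover have "\<Phi> t x \<in> \<Phi> (t - 1) ` verts \<alpha>" using X[OF that] XY that by auto
    ultimately show False using t by (auto simp: A_def first_occ_def)
  qed
  have YB: "y \<notin> B" if "y \<in> Y" for y
  proof
    assume "y \<in> B"
    moreover have "\<Phi> t y \<in> \<Phi> (Suc t) ` verts \<alpha>" using Y[OF that] XY that by auto
    ultimately show False using t by (auto simp: B_def last_occ_def)
  qed
  \<comment> \<open>The second occurrence of the edge carries the labels of both \<open>a\<close>
    and \<open>b\<close>. An earlier copy contradicts the newness of \<open>a\<close>, a later one
    contradicts that \<open>b\<close> never returns, and the same copy contradicts
    injectivity.\<close>
  have no_edge: False if e: "e \<in> edges \<alpha>" and a: "a \<in> e" "a \<in> A" and b: "b \<in> e" "b \<in> B" for e a b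
  proof -
    obtain t' e' where t': "t' < T" "e' \<in> edges \<alpha>" "(t', e') \<noteq> (t, e)" "\<Phi> t' ` e' = \<Phi> t ` e"
      using twice[of t e] e t by auto
    have "\<Phi> t a \<in> \<Phi> t' ` verts \<alpha>" "\<Phi> t b \<in> \<Phi> t' ` verts \<alpha>"
      using imageI[OF a(1), of "\<Phi> t"] imageI[OF b(1), of "\<Phi> t"] image_mono[OF edge_sub[OF t'(2)], of "\<Phi> t'"]
      unfolding t'(4)[symmetric] by blast+
    then have "\<not> t' < t" "\<not> t < t'"
      using a(2) b(2) t'(1) by (auto simp: A_def B_def first_occ_def last_occ_def)
    then have "t' = t" by simp
    have "\<Phi> t ` e' = \<Phi> t ` e" using t'(4) \<open>t' = t\<close> by simp
    then have "e' = e"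
      using inj_on_image_eq_iff[OF inj[of t] edge_sub[OF t'(2)] edge_sub[OF e]] t(1) by simp
    with \<open>t' = t\<close> t'(3) show False by simp
  qed
  \<comment> \<open>Taking both ends in \<open>no_edge\<close> to be the same vertex shows that a
    vertex which is new and never returns has no edge. This is how isolated middle vertices enter
    the exponent.\<close>
  have "A \<inter> B \<subseteq> isolated_middle_verts \<alpha>"
  proof
    fix x assume x: "x \<in> A \<inter> B"
    then have "x \<notin> X" "x \<notin> Y" using XA YB by auto
    then have "x \<in> middle_verts \<alpha>" using sides x AB by (auto simp: middle_verts_def)
    then show "x \<in> isolated_middle_verts \<alpha>"
      using x no_edge[of _ x x] by (auto simp: isolated_middle_verts_def)
  qed
  then have cap: "card (A \<inter> B) \<le> card (isolated_middle_verts \<alpha>)"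
    using fin by (intro card_mono) (auto simp: isolated_middle_verts_def middle_verts_def)
  have "is_separator \<alpha> S"
    unfolding is_separator_def
  proof (intro conjI allI impI)
    show "S \<subseteq> verts \<alpha>" by (simp add: S_def)
    fix p assume p: "is_path \<alpha> p \<and> hd p \<in> left_verts \<alpha> \<and> last p \<in> right_verts \<alpha>"
    show "set p \<inter> S \<noteq> {}"
    proof
      assume "set p \<inter> S = {}"
      \<comment> \<open>A path avoiding \<open>S\<close> stays in \<open>A\<close> or stays in
        \<open>B\<close>, since no edge joins the two. Its end in \<open>X\<close> must lie in
        \<open>B\<close> and its end in \<open>Y\<close> must lie in \<open>A\<close>, which is
        contradictory.\<close>
      then have sub: "set p \<subseteq> A \<union> B" using p by (auto simp: S_def is_path_def)
      have ne: "p \<noteq> []" and succ: "successively (\<lambda>u v. {u, v} \<in> edges \<alpha>) p" using p by (auto simp: is_path_def)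
      have ends: "hd p \<in> set p" "last p \<in> set p" using ne by auto
      show False
      proof (cases "hd p \<in> X \<and> last p \<in> Y")
        case True
        then have "hd p \<in> B" using XA sub ends by auto
        then have "set p \<subseteq> B"
        proof (rule successively_closed[OF succ ne])
          fix x y assume xy: "x \<in> set p" "y \<in> set p" "{x, y} \<in> edges \<alpha>" "x \<in> B"
          have "y \<notin> A" using no_edge[OF xy(3), of y x] xy by auto
          then show "y \<in> B" using sub xy by auto
        qed
        then show False using True YB ends by auto
      next
        case False
        then have *: "hd p \<in> Y" "last p \<in> X" using sides p by auto
        then have "hd p \<in> A" using YB sub ends by auto
        then have "set p \<subseteq> A"
        proof (rule successively_closed[OF succ ne])
          fix x y assume xy: "x \<in> set p" "y \<in> set p" "{x, y} \<in> edges \<alpha>" "x \<in> A"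
          have "y \<notin> B" using no_edge[OF xy(3), of x y] xy by auto
          then show "y \<in> A" using sub xy by auto
        qed
        then show False using * XA ends by auto
      qed
    qed
  qed
  then have "min_separator_size \<alpha> \<le> card S" by (rule min_separator_size_le)
  moreover have "card S = card (verts \<alpha>) - card (A \<union> B)"
    unfolding S_def using fin AB by (intro card_Diff_subset) (auto intro: finite_subset)
  moreover have "card (A \<union> B) \<le> card (verts \<alpha>)" using fin AB by (intro card_mono) auto
  moreover have "card A + card B = card (A \<union> B) + card (A \<inter> B)"
    using fin AB by (intro card_Un_Int) (auto intro: finite_subset)
  ultimately show ?thesis using cap unfolding A_def[symmetric] B_def[symmetric] by linarith
qed

text \<open>An even copy shares right labels with its predecessor and left labels with its
  successor, an odd copy the reverse, so the roles of \<open>X\<close> and \<open>Y\<close>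
  alternate with parity. The two extreme copies lack a neighbour in the open chain and are charged 2
  |V| extra each; halving the double count leaves the summand 2 |V|.\<close>

lemma card_labels_le:
  fixes \<alpha> :: "'a shape" and \<Phi> :: "nat \<Rightarrow> 'a \<Rightarrow> nat"
  assumes shape: "is_shape \<alpha>"
    and inj: "\<And>t. t < 2 * q \<Longrightarrow> inj_on (\<Phi> t) (verts \<alpha>)"
    and twice: "\<And>t e. t < 2 * q \<Longrightarrow> e \<in> edges \<alpha> \<Longrightarrow>
      \<exists>t'<2 * q. \<exists>e'\<in>edges \<alpha>. (t', e') \<noteq> (t, e) \<and> \<Phi> t' ` e' = \<Phi> t ` e"
    and left: "\<And>t u. t < q \<Longrightarrow> u \<in> left_verts \<alpha> \<Longrightarrow> \<Phi> (Suc (2 * t)) u = \<Phi> (2 * t) u"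
    and right: "\<And>t v. Suc t < q \<Longrightarrow> v \<in> right_verts \<alpha> \<Longrightarrow> \<Phi> (Suc (Suc (2 * t))) v = \<Phi> (Suc (2 * t)) v"
  shows "card (\<Union>t<2 * q. \<Phi> t ` verts \<alpha>)
    \<le> q * (card (verts \<alpha>) - min_separator_size \<alpha> + card (isolated_middle_verts \<alpha>)) + 2 * card (verts \<alpha>)"
proof -
  define d where "d = card (verts \<alpha>) - min_separator_size \<alpha> + card (isolated_middle_verts \<alpha>)"
  let ?f = "\<lambda>t. card (first_occ (verts \<alpha>) \<Phi> t) + card (last_occ (verts \<alpha>) \<Phi> (2 * q) t)"
  have fin: "finite (verts \<alpha>)" using shape by (simp add: is_shape_def)
  have "?f t \<le> d + (if t \<in> {0, 2 * q - 1} then 2 * card (verts \<alpha>) else 0)" if t: "t < 2 * q" for t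
  proof (cases "t \<in> {0, 2 * q - 1}")
    case True
    have "card (first_occ (verts \<alpha>) \<Phi> t) \<le> card (verts \<alpha>)"
      "card (last_occ (verts \<alpha>) \<Phi> (2 * q) t) \<le> card (verts \<alpha>)"
      using fin by (auto intro!: card_mono simp: first_occ_def last_occ_def)
    then show ?thesis using True by simp
  next
    case False
    then have t': "Suc t < 2 * q" "0 < t" using t by auto
    have "?f t \<le> d"
    proof (cases "even t")
      case True
      then obtain m where m: "t = 2 * m" by (auto elim: evenE)
      with t' obtain m' where m': "m = Suc m'" by (cases m) auto
      show ?thesis
        unfolding d_def
      proof (rule card_first_last_occ_le[OF shape inj twice t', where X = "right_verts \<alpha>" and Y = "left_verts \<alpha>"])
        show "\<Phi> t x = \<Phi> (t - 1) x" if "x \<in> right_verts \<alpha>" for x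
          using right[of m' x] that t' m m' by simp
        show "\<Phi> t y = \<Phi> (Suc t) y" if "y \<in> left_verts \<alpha>" for y
          using left[of m y] that t' m by simp
      qed simp_all
    next
      case False
      then obtain m where m: "t = Suc (2 * m)" by (auto elim: oddE)
      show ?thesis
        unfolding d_def
      proof (rule card_first_last_occ_le[OF shape inj twice t', where X = "left_verts \<alpha>" and Y = "right_verts \<alpha>"])
        show "\<Phi> t x = \<Phi> (t - 1) x" if "x \<in> left_verts \<alpha>" for x
          using left[of m x] that t' m by simp
        show "\<Phi> t y = \<Phi> (Suc t) y" if "y \<in> right_verts \<alpha>" for y
          using right[of m y] that t' m by simp
      qed simp_all
    qed
    then show ?thesis using False by simp
  qed
  then have "(\<Sum>t<2 * q. ?f t) \<le> (\<Sum>t<2 * q. d + (if t \<in> {0, 2 * q - 1} then 2 * card (verts \<alpha>) else 0))"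
    by (intro sum_mono) auto
  also have "\<dots> = 2 * q * d + (\<Sum>t\<in>{..<2 * q} \<inter> {0, 2 * q - 1}. 2 * card (verts \<alpha>))"
    by (subst sum.inter_restrict) (simp_all only: sum.distrib sum_constant card_lessThan finite_lessThan of_nat_id)
  also have "\<dots> \<le> 2 * q * d + (\<Sum>t\<in>{0, 2 * q - 1}. 2 * card (verts \<alpha>))"
    by (intro add_left_mono sum_mono2) auto
  also have "\<dots> \<le> 2 * q * d + 4 * card (verts \<alpha>)"
    by (cases "2 * q - 1 = 0") auto
  finally have "(\<Sum>t<2 * q. card (first_occ (verts \<alpha>) \<Phi> t)) + (\<Sum>t<2 * q. card (last_occ (verts \<alpha>) \<Phi> (2 * q) t))
      \<le> 2 * q * d + 4 * card (verts \<alpha>)"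
    by (simp add: sum.distrib)
  then show ?thesis
    using card_labels_le_first_occ[OF fin, of \<Phi> "2 * q"] card_labels_le_last_occ[OF fin, of \<Phi> "2 * q"]
    unfolding d_def[symmetric] by simp
qed

text \<open>A union bound over target sets: since k \<le> card N, every image with at most k points
  can be enlarged inside \<open>N\<close> to a set of exactly k points. The binomial coefficient
  supplies the factorial that \<open>count_bound\<close> exploits.\<close>

lemma card_functions_small_image_le:
  assumes "finite P" "finite N" "k \<le> card N"
  shows "card {g \<in> P \<rightarrow>\<^sub>E N. card (g ` P) \<le> k} \<le> (card N choose k) * k ^ card P"
proof -
  let ?F = "{A. A \<subseteq> N \<and> card A = k}"
  have "{g \<in> P \<rightarrow>\<^sub>E N. card (g ` P) \<le> k} \<subseteq> (\<Union>A\<in>?F. P \<rightarrow>\<^sub>E A)"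
  proof
    fix g assume g: "g \<in> {g \<in> P \<rightarrow>\<^sub>E N. card (g ` P) \<le> k}"
    have "g ` P \<subseteq> N" using g by auto
    moreover have "card (g ` P) \<le> k" using g by simp
    ultimately obtain A where A: "g ` P \<subseteq> A" "A \<subseteq> N" "card A = k"
      using exists_subset_between[of "g ` P" k N] assms(2,3) by metis
    have "g \<in> P \<rightarrow>\<^sub>E A" using g A(1) unfolding PiE_iff by blast
    then show "g \<in> (\<Union>A\<in>?F. P \<rightarrow>\<^sub>E A)" using A by blast
  qed
  moreover have finF: "finite ?F" using assms(2) by (simp add: finite_subset)
  moreover have "finite (P \<rightarrow>\<^sub>E A)" if "A \<in> ?F" for A
    using that assms(1,2) by (intro finite_PiE) (auto intro: finite_subset)
  ultimately have "card {g \<in> P \<rightarrow>\<^sub>E N. card (g ` P) \<le> k} \<le> card (\<Union>A\<in>?F. P \<rightarrow>\<^sub>E A)"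
    by (intro card_mono finite_UN_I)
  also have "\<dots> \<le> (\<Sum>A\<in>?F. card (P \<rightarrow>\<^sub>E A))" using finF by (rule card_UN_le)
  also have "\<dots> = (\<Sum>A\<in>?F. k ^ card P)" using assms by (intro sum.cong) (auto simp: card_PiE)
  also have "\<dots> = (card N choose k) * k ^ card P" using assms by (simp add: n_subsets)
  finally show ?thesis .
qed

section \<open>The upper bound\<close>

lemma op_norm_cong:
  assumes "\<And>i j. i \<in> I \<Longrightarrow> j \<in> J \<Longrightarrow> A i j = B i j"
  shows "op_norm I J A = op_norm I J B"
  unfolding op_norm_def using assms by (intro SUP_cong L2_set_cong sum.cong refl) simp

lemma tensor_std_basis:
  assumes "length is = length us"
  shows "tensor (map (\<lambda>u. std_basis (\<phi> u)) us) is = (if map \<phi> us = is then 1 else 0)"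
proof -
  have "tensor (map (\<lambda>u. std_basis (\<phi> u)) us) is = (\<Prod>k<length us. if is ! k = \<phi> (us ! k) then 1 else 0)"
    unfolding tensor_def by (intro prod.cong) (auto simp: std_basis_def)
  also have "\<dots> = (if \<forall>k<length us. is ! k = \<phi> (us ! k) then 1 else 0)"
    by (auto intro: prod.neutral prod_zero)
  also have "(\<forall>k<length us. is ! k = \<phi> (us ! k)) \<longleftrightarrow> map \<phi> us = is"
    using assms by (auto simp: list_eq_iff_nth_eq)
  finally show ?thesis .
qed

definition sign_weight :: "'a set set \<Rightarrow> (nat set \<Rightarrow> real) \<Rightarrow> ('a \<Rightarrow> nat) \<Rightarrow> real" where
  "sign_weight F \<epsilon> \<phi> = (\<Prod>e\<in>F. \<epsilon> (\<phi> ` e))"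

text \<open>Brings the matrix into the form to which the chain expansion applies. The index sets
  matter here: \<open>tensor\<close> reads only as many entries as there are factors, so the
  equality of lists presupposes the right length.\<close>

lemma graph_matrix_eq:
  assumes "is \<in> multi_index n (length us)" "js \<in> multi_index n (length vs)"
  shows "graph_matrix n \<alpha> us vs \<epsilon> is js
    = (\<Sum>\<phi>\<in>realizations n \<alpha>. sign_weight (edges \<alpha>) \<epsilon> \<phi> * (if map \<phi> us = is \<and> map \<phi> vs = js then 1 else 0))"
  using assms unfolding graph_matrix_def sign_weight_def
  by (intro sum.cong refl) (simp add: tensor_std_basis multi_index_def)

lemma finite_realizations: "is_shape \<alpha> \<Longrightarrow> finite (realizations n \<alpha>)"
  by (rule finite_subset[of _ "verts \<alpha> \<rightarrow>\<^sub>E {1..n}"]) (auto simp: realizations_def is_shape_def intro: finite_PiE)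

lemma finite_multi_index: "finite (multi_index n k)"
  using finite_lists_length_eq[of "{1..n}" k] by (simp add: multi_index_def conj_commute)

lemma realization_multi_index:
  assumes "is_shape \<alpha>" "set us \<subseteq> verts \<alpha>"
  shows "(\<lambda>\<phi>. map \<phi> us) ` realizations n \<alpha> \<subseteq> multi_index n (length us)"
  using assms by (fastforce simp: realizations_def multi_index_def)

lemma finite_edges: "is_shape \<alpha> \<Longrightarrow> finite (edges \<alpha>)"
  by (meson finite_imp_finite_nsets finite_subset is_shape_def)

lemma image_edge:
  assumes "e \<in> nsets X 2" "inj_on \<phi> X" "\<phi> ` X \<subseteq> {1..n}"
  shows "\<phi> ` e \<in> nsets {1..n} 2"
  using assms by (auto simp: nsets_def card_image inj_on_subset)

lemma realization_image_edge:
  assumes "is_shape \<alpha>" "\<phi> \<in> realizations n \<alpha>" "e \<in> edges \<alpha>"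
  shows "\<phi> ` e \<in> nsets {1..n} 2"
  using assms by (intro image_edge[of _ "verts \<alpha>"]) (auto simp: realizations_def is_shape_def)

lemma rademacher_edges_eq: "rademacher_edges n = signs (nsets {1..n} 2)"
  by (simp add: rademacher_edges_def signs_def)

lemma finite_nsets_2: "finite (nsets {1..n::nat} 2)"
  by (simp add: finite_imp_finite_nsets)

text \<open>Flattens a chain of q pairs into the sequence of 2q labellings to which the label count
  applies. Copies 2t and 2t + 1 agree on the left vertices, copies 2t + 1 and 2t + 2 on the right
  ones.\<close>

definition copy :: "('r \<times> 'r) list \<Rightarrow> nat \<Rightarrow> 'r" where
  "copy p t = (if even t then fst (p ! (t div 2)) else snd (p ! (t div 2)))"

lemma copy_simps [simp]: "copy p (2 * t) = fst (p ! t)" "copy p (Suc (2 * t)) = snd (p ! t)"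
  by (simp_all add: copy_def)

lemma copy_in:
  assumes "p \<in> gram_chains R l r q" "t < 2 * q"
  shows "copy p t \<in> R"
proof -
  have "p ! (t div 2) \<in> set p" using assms by (auto simp: gram_chains_def)
  moreover have "set p \<subseteq> R \<times> R" using assms by (auto simp: gram_chains_def)
  ultimately have "p ! (t div 2) \<in> R \<times> R" by blast
  then show ?thesis by (auto simp: copy_def mem_Times_iff)
qed

lemma copy_left:
  assumes "p \<in> gram_chains R l r q" "t < q"
  shows "l (copy p (Suc (2 * t))) = l (copy p (2 * t))"
proof -
  have "p ! t \<in> set p" using assms by (auto simp: gram_chains_def)
  moreover have "set p \<subseteq> {x. l (fst x) = l (snd x)}" using assms by (auto simp: gram_chains_def)
  ultimately have "l (fst (p ! t)) = l (snd (p ! t))" by blast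
  then show ?thesis by simp
qed

lemma copy_right:
  assumes "p \<in> gram_chains R l r q" "Suc t < q"
  shows "r (copy p (Suc (Suc (2 * t)))) = r (copy p (Suc (2 * t)))"
proof -
  have "linked r (p ! t) (p ! Suc t)"
    using assms by (simp add: gram_chains_def successively_conv_nth)
  moreover have "copy p (Suc (Suc (2 * t))) = fst (p ! Suc t)" using copy_simps(1)[of p "Suc t"] by simp
  ultimately show ?thesis by (simp add: linked_def)
qed

lemma chain_weight_eq_prod_copy: "chain_weight w p = (\<Prod>t<2 * length p. w (copy p t))"
proof (induction p rule: rev_induct)
  case (snoc x p)
  have "(\<Prod>t<2 * length (p @ [x]). w (copy (p @ [x]) t))
      = (\<Prod>t<2 * length p. w (copy (p @ [x]) t)) * (w (fst x) * w (snd x))"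
    by (simp add: copy_def mult.assoc)
  also have "(\<Prod>t<2 * length p. w (copy (p @ [x]) t)) = (\<Prod>t<2 * length p. w (copy p t))"
    by (intro prod.cong) (auto simp: copy_def nth_append)
  finally have "(\<Prod>t<2 * length (p @ [x]). w (copy (p @ [x]) t))
      = (\<Prod>t<2 * length p. w (copy p t)) * (w (fst x) * w (snd x))" .
  moreover have "chain_weight w (p @ [x]) = chain_weight w p * (w (fst x) * w (snd x))"
    by (simp add: chain_weight_def)
  ultimately show ?case using snoc by (simp only:)
qed (simp add: chain_weight_def)

text \<open>Weaker than even multiplicity of every edge label, but all that the label count uses.
  The expectation of a chain weight is accordingly bounded by an indicator and not computed.\<close>

definition edges_doubled :: "'a set set \<Rightarrow> (('a \<Rightarrow> nat) \<times> ('a \<Rightarrow> nat)) list \<Rightarrow> bool" where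
  "edges_doubled F p \<longleftrightarrow> (\<forall>t<2 * length p. \<forall>e\<in>F. \<exists>t'<2 * length p. \<exists>e'\<in>F.
     (t', e') \<noteq> (t, e) \<and> copy p t' ` e' = copy p t ` e)"

lemma expectation_chain_weight_le:
  assumes shape: "is_shape \<alpha>" and p: "p \<in> gram_chains (realizations n \<alpha>) l r q"
  shows "measure_pmf.expectation (rademacher_edges n) (\<lambda>\<epsilon>. chain_weight (sign_weight (edges \<alpha>) \<epsilon>) p)
    \<le> (if edges_doubled (edges \<alpha>) p then 1 else 0)"
proof -
  let ?I = "{..<2 * length p} \<times> edges \<alpha>"
  let ?g = "\<lambda>x. copy p (fst x) ` snd x"
  have len: "length p = q" using p by (simp add: gram_chains_def)
  have "chain_weight (sign_weight (edges \<alpha>) \<epsilon>) p = (\<Prod>x\<in>?I. \<epsilon> (?g x))" for \<epsilon>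
    unfolding chain_weight_eq_prod_copy sign_weight_def
    by (simp add: prod.cartesian_product case_prod_beta)
  then have "measure_pmf.expectation (rademacher_edges n) (\<lambda>\<epsilon>. chain_weight (sign_weight (edges \<alpha>) \<epsilon>) p)
      = measure_pmf.expectation (signs (nsets {1..n} 2)) (\<lambda>\<epsilon>. \<Prod>x\<in>?I. \<epsilon> (?g x))"
    by (simp add: rademacher_edges_eq)
  also have "\<dots> = (if \<forall>a. even (card {x\<in>?I. ?g x = a}) then 1 else 0)"
  proof (intro expectation_signs_prod finite_nsets_2)
    show "finite ?I" using shape by (simp add: finite_edges)
    show "?g ` ?I \<subseteq> nsets {1..n} 2"
    proof (rule image_subsetI)
      fix x assume "x \<in> ?I"
      then have "copy p (fst x) \<in> realizations n \<alpha>" "snd x \<in> edges \<alpha>"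
        using copy_in[OF p] len by auto
      then show "?g x \<in> nsets {1..n} 2" by (rule realization_image_edge[OF shape])
    qed
  qed
  also have "\<dots> \<le> (if edges_doubled (edges \<alpha>) p then 1 else 0)"
  proof -
    have "edges_doubled (edges \<alpha>) p" if even: "\<forall>a. even (card {x\<in>?I. ?g x = a})"
      unfolding edges_doubled_def
    proof (intro allI impI ballI)
      fix t e assume te: "t < 2 * length p" "e \<in> edges \<alpha>"
      let ?C = "{x\<in>?I. ?g x = ?g (t, e)}"
      have "(t, e) \<in> ?C" using te by simp
      moreover have "?C \<noteq> {(t, e)}"
      proof
        assume C: "?C = {(t, e)}"
        have "even (card ?C)" using even by (rule spec)
        then show False unfolding C by simp
      qed
      ultimately obtain x where "x \<in> ?C" "x \<noteq> (t, e)" by blast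
      then show "\<exists>t'<2 * length p. \<exists>e'\<in>edges \<alpha>. (t', e') \<noteq> (t, e) \<and> copy p t' ` e' = copy p t ` e"
        by (intro exI[of _ "fst x"] conjI bexI[of _ "snd x"]) auto
    qed
    then show ?thesis by auto
  qed
  finally show ?thesis .
qed

text \<open>Positions whose labels determine a whole chain of realizations.\<close>

definition free_positions :: "'a shape \<Rightarrow> nat \<Rightarrow> (nat \<times> 'a) set" where
  "free_positions \<alpha> q = {..<2 * q} \<times> middle_verts \<alpha> \<union> (\<lambda>t. 2 * t) ` {..<q} \<times> (left_verts \<alpha> - right_verts \<alpha>)
     \<union> (\<lambda>t. Suc (2 * t)) ` {..<q} \<times> (right_verts \<alpha> - left_verts \<alpha>) \<union> {0} \<times> right_verts \<alpha>"

lemma finite_free_positions: "is_shape \<alpha> \<Longrightarrow> finite (free_positions \<alpha> q)"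
  by (auto simp: free_positions_def is_shape_def middle_verts_def intro: finite_subset)

lemma card_free_positions_le:
  assumes "is_shape \<alpha>"
  shows "card (free_positions \<alpha> q) \<le> q * (2 * card (middle_verts \<alpha>) + card (left_verts \<alpha> - right_verts \<alpha>)
    + card (right_verts \<alpha> - left_verts \<alpha>)) + card (right_verts \<alpha>)"
proof -
  have "card (free_positions \<alpha> q) \<le> card ({..<2 * q} \<times> middle_verts \<alpha>)
      + card ((\<lambda>t. 2 * t) ` {..<q} \<times> (left_verts \<alpha> - right_verts \<alpha>))
      + card ((\<lambda>t. Suc (2 * t)) ` {..<q} \<times> (right_verts \<alpha> - left_verts \<alpha>)) + card ({0::nat} \<times> right_verts \<alpha>)"
    unfolding free_positions_def
    by (rule order_trans[OF card_Un_le add_right_mono])+ (rule order_refl)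
  also have "\<dots> = q * (2 * card (middle_verts \<alpha>) + card (left_verts \<alpha> - right_verts \<alpha>)
    + card (right_verts \<alpha> - left_verts \<alpha>)) + card (right_verts \<alpha>)"
    by (simp add: card_cartesian_product card_image inj_on_def algebra_simps)
  finally show ?thesis .
qed

text \<open>Restriction to the free positions is injective on chains, and doubled edges limit the
  number of labels to \<open>K\<close>. The chains thus embed into the functions with small image
  counted above.\<close>

lemma card_doubled_chains_le:
  assumes shape: "is_shape \<alpha>" and us: "set us = left_verts \<alpha>" and vs: "set vs = right_verts \<alpha>"
    and K: "q * (card (verts \<alpha>) - min_separator_size \<alpha> + card (isolated_middle_verts \<alpha>)) + 2 * card (verts \<alpha>) \<le> K"
    and Kn: "K \<le> n" and q: "q > 0"
  shows "card {p \<in> gram_chains (realizations n \<alpha>) (\<lambda>\<phi>. map \<phi> us) (\<lambda>\<phi>. map \<phi> vs) q. edges_doubled (edges \<alpha>) p}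
    \<le> (n choose K) * K ^ card (free_positions \<alpha> q)"
proof -
  let ?P = "free_positions \<alpha> q"
  let ?G = "gram_chains (realizations n \<alpha>) (\<lambda>\<phi>. map \<phi> us) (\<lambda>\<phi>. map \<phi> vs) q"
  let ?g = "\<lambda>p. restrict (\<lambda>x. copy p (fst x) (snd x)) ?P"
  have left: "copy p (Suc (2 * t)) u = copy p (2 * t) u" if "p \<in> ?G" "t < q" "u \<in> left_verts \<alpha>" for p t u
    using copy_left[OF that(1,2)] that(3) us by (simp add: map_eq_conv)
  have right: "copy p (Suc (Suc (2 * t))) v = copy p (Suc (2 * t)) v"
    if "p \<in> ?G" "Suc t < q" "v \<in> right_verts \<alpha>" for p t v
    using copy_right[OF that(1,2)] that(3) vs by (simp add: map_eq_conv)
  have P_sub: "?P \<subseteq> {..<2 * q} \<times> verts \<alpha>" if "q > 0"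
    using shape that by (auto simp: free_positions_def is_shape_def middle_verts_def)
  have real: "copy p t \<in> realizations n \<alpha>" if "p \<in> ?G" "t < 2 * q" for p t
    using copy_in that by blast
  \<comment> \<open>Middle labels are free in every copy. A left label is recorded at even copies
    and repeated in the following odd one; a right label is recorded at odd copies and repeated in
    the following even one, which leaves copy 0 to be recorded separately. A label on both sides is
    constant along the chain, so copy 0 determines it.\<close>
  have agree: "copy p t x = copy p' t x"
    if p: "p \<in> ?G" "p' \<in> ?G" and eq: "?g p = ?g p'" and t: "t < 2 * q" and x: "x \<in> verts \<alpha>" for p p' t x
  proof -
    have eqP: "copy p s y = copy p' s y" if "(s, y) \<in> ?P" for s y
      using fun_cong[OF eq, of "(s, y)"] that by simp
    consider (W) "x \<in> middle_verts \<alpha>" | (L) "x \<in> left_verts \<alpha> - right_verts \<alpha>"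
      | (R) "x \<in> right_verts \<alpha> - left_verts \<alpha>" | (B) "x \<in> left_verts \<alpha> \<inter> right_verts \<alpha>"
      using x by (auto simp: middle_verts_def)
    then show ?thesis
    proof cases
      case W
      then show ?thesis using t by (intro eqP) (simp add: free_positions_def)
    next
      case L
      have ev: "copy p (2 * s) x = copy p' (2 * s) x" if "s < q" for s
        using that L by (intro eqP) (auto simp: free_positions_def)
      show ?thesis
      proof (cases "even t")
        case True
        then obtain s where "t = 2 * s" by (auto elim: evenE)
        then show ?thesis using ev t by simp
      next
        case False
        then obtain s where s: "t = Suc (2 * s)" by (auto elim: oddE)
        then have "s < q" using t by simp
        then show ?thesis using left[OF p(1), of s x] left[OF p(2), of s x] ev[of s] L s by simp
      qed
    next
      case R
      have od: "copy p (Suc (2 * s)) x = copy p' (Suc (2 * s)) x" if "s < q" for s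
        using that R by (intro eqP) (auto simp: free_positions_def)
      show ?thesis
      proof (cases "even t")
        case True
        then obtain s where s: "t = 2 * s" by (auto elim: evenE)
        show ?thesis
        proof (cases s)
          case 0
          then show ?thesis using s R by (intro eqP) (auto simp: free_positions_def)
        next
          case (Suc s')
          then have ts: "t = Suc (Suc (2 * s'))" "Suc s' < q" using s t by auto
          then show ?thesis
            using right[OF p(1) ts(2), of x] right[OF p(2) ts(2), of x] od[of s'] R by (simp only: ts(1)) auto
        qed
      next
        case False
        then obtain s where "t = Suc (2 * s)" by (auto elim: oddE)
        then show ?thesis using od[of s] t by simp
      qed
    next
      case B
      have const: "copy p'' t x = copy p'' 0 x" if p'': "p'' \<in> ?G" for p''
        using t
      proof (induction t)
        case (Suc t)
        show ?case
        proof (cases "even t")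
          case True
          then obtain s where "t = 2 * s" by (auto elim: evenE)
          then show ?thesis using Suc left[OF p'', of s x] B by simp
        next
          case False
          then obtain s where s: "t = Suc (2 * s)" by (auto elim: oddE)
          then have "Suc s < q" using Suc.prems by simp
          then have "copy p'' (Suc t) x = copy p'' t x" using right[OF p'', of s x] B s by blast
          then show ?thesis using Suc by simp
        qed
      qed simp
      have "copy p 0 x = copy p' 0 x" using B by (intro eqP) (auto simp: free_positions_def)
      then show ?thesis using const p by simp
    qed
  qed
  have inj: "inj_on ?g ?G"
  proof (rule inj_onI)
    fix p p' assume p: "p \<in> ?G" "p' \<in> ?G" and eq: "?g p = ?g p'"
    have copies: "copy p t = copy p' t" if t: "t < 2 * q" for t
    proof (rule extensionalityI)
      show "copy p t \<in> extensional (verts \<alpha>)" "copy p' t \<in> extensional (verts \<alpha>)"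
        using real p t by (auto simp: realizations_def PiE_def)
    qed (rule agree[OF p eq t])
    show "p = p'"
    proof (rule nth_equalityI)
      show "length p = length p'" using p by (simp add: gram_chains_def)
      fix i assume "i < length p"
      then have i: "i < q" using p by (simp add: gram_chains_def)
      show "p ! i = p' ! i"
        using copies[of "2 * i"] copies[of "Suc (2 * i)"] i by (simp add: prod_eq_iff)
    qed
  qed
  have "?g ` {p \<in> ?G. edges_doubled (edges \<alpha>) p} \<subseteq> {g \<in> ?P \<rightarrow>\<^sub>E {1..n}. card (g ` ?P) \<le> K}"
  proof
    fix g assume "g \<in> ?g ` {p \<in> ?G. edges_doubled (edges \<alpha>) p}"
    then obtain p where p: "p \<in> ?G" "edges_doubled (edges \<alpha>) p" "g = ?g p" by auto
    have len: "length p = q" using p(1) by (simp add: gram_chains_def)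
    have P: "?P \<subseteq> {..<2 * q} \<times> verts \<alpha>" using P_sub q by simp
    have "g \<in> ?P \<rightarrow>\<^sub>E {1..n}"
      unfolding p(3)
    proof (rule PiE_I)
      fix x assume x: "x \<in> ?P"
      then have "copy p (fst x) \<in> realizations n \<alpha>" "snd x \<in> verts \<alpha>" using P real p(1) by auto
      then show "?g p x \<in> {1..n}" using x by (auto simp: realizations_def)
    qed simp
    moreover have "card (g ` ?P) \<le> K"
    proof -
      have "g ` ?P \<subseteq> (\<Union>t<2 * q. copy p t ` verts \<alpha>)"
        using P p(3) by force
      then have "card (g ` ?P) \<le> card (\<Union>t<2 * q. copy p t ` verts \<alpha>)"
        using shape by (intro card_mono) (auto simp: is_shape_def)
      also have "\<dots> \<le> K"
      proof (rule order_trans[OF card_labels_le[OF shape] K])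
        show "inj_on (copy p t) (verts \<alpha>)" if "t < 2 * q" for t
          using real[OF p(1) that] by (simp add: realizations_def)
      qed (use p(1,2) left right len in \<open>auto simp: edges_doubled_def\<close>)
      finally show ?thesis .
    qed
    ultimately show "g \<in> {g \<in> ?P \<rightarrow>\<^sub>E {1..n}. card (g ` ?P) \<le> K}" by simp
  qed
  moreover have "finite {g \<in> ?P \<rightarrow>\<^sub>E {1..n}. card (g ` ?P) \<le> K}"
    by (rule finite_subset[OF _ finite_PiE[of ?P "\<lambda>_. {1..n}"]]) (use finite_free_positions[OF shape, of q] in auto)
  ultimately have "card (?g ` {p \<in> ?G. edges_doubled (edges \<alpha>) p}) \<le> card {g \<in> ?P \<rightarrow>\<^sub>E {1..n}. card (g ` ?P) \<le> K}"
    by (rule card_mono[rotated])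
  also have "\<dots> \<le> (card {1..n} choose K) * K ^ card ?P"
    by (intro card_functions_small_image_le) (use finite_free_positions[OF shape, of q] Kn in auto)
  finally show ?thesis
    using inj by (subst (asm) card_image) (auto intro: inj_on_subset)
qed

section \<open>Numerical estimates and the choice of the moment\<close>

lemma power_le_exp_mult_fact: "real K ^ K \<le> exp (real K) * fact K"
proof -
  have "(\<Sum>i\<in>{K}. inverse (fact i) * real K ^ i) \<le> (\<Sum>i. inverse (fact i) * real K ^ i)"
    by (intro sum_le_suminf summable_exp) auto
  then have "real K ^ K / fact K \<le> exp (real K)"
    by (simp add: exp_def divide_inverse mult.commute)
  then show ?thesis by (simp add: field_simps)
qed

text \<open>Here \<open>D\<close> is twice \<open>norm_exponent\<close>, \<open>f\<close> is
  \<open>log_exponent\<close> and \<open>v\<close> the number of vertices. The labels beyond q D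
  give n^(2v+1), at most exp(q (2v+1)) since ln n \<le> q. Of the \<open>m\<close> free positions,
  \<open>K\<close> are absorbed by the factorial of the binomial coefficient up to exp K, and the
  remaining q f give at most K \<le> 2 (D + 2v + 1) ln n each. The resulting bound is a 2q-th power.
  The \<open>+ 1\<close> in \<open>K\<close> makes it positive, so that its powers grow with the
  exponent.\<close>

lemma count_bound:
  fixes f :: real and n q K m D v :: nat
  assumes f: "f \<ge> 0" and K: "K = q * D + 2 * v + 1" and m: "real m \<le> K + q * f"
    and q: "ln (real n) \<le> q" "q \<le> 2 * ln (real n)" "q > 0" and n: "n \<ge> 2"
  shows "real ((n choose K) * K ^ m) \<le> (real n powr (D / 2) * ln (real n) powr (f / 2) *
      (exp ((2 * v + 1 + (D + 2 * v + 1)) / 2) * (2 * (D + 2 * v + 1)) powr (f / 2))) ^ (2 * q)"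
proof -
  define C where "C = real (D + 2 * v + 1)"
  have n0: "real n > 0" using n by simp
  have K1: "real K \<ge> 1" by (simp add: K)
  have C1: "C \<ge> 1" by (simp add: C_def)
  have KC: "real K \<le> q * C"
  proof -
    have "1 * (2 * real v + 1) \<le> q * (2 * real v + 1)" using q by (intro mult_right_mono) auto
    then show ?thesis by (simp add: K C_def algebra_simps)
  qed
  have ln0: "ln (real n) > 0" using n by simp
  have "real (n choose K) * fact K \<le> real n ^ K"
    using binomial_fact_pow[of n K] by (metis of_nat_fact of_nat_le_iff of_nat_mult of_nat_power)
  then have choose: "real (n choose K) \<le> real n ^ K / fact K" by (simp add: field_simps)
  have "real K ^ m = real K powr m" using K1 by (simp add: powr_realpow)
  also have "\<dots> \<le> real K powr (K + q * f)" using m K1 by (intro powr_mono) auto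
  also have "\<dots> = real K ^ K * real K powr (q * f)" using K1 by (simp add: powr_add powr_realpow)
  finally have Km: "real K ^ m \<le> real K ^ K * real K powr (q * f)" .
  have "real ((n choose K) * K ^ m) \<le> (real n ^ K / fact K) * (real K ^ K * real K powr (q * f))"
    using choose Km by (simp only: of_nat_mult of_nat_power) (intro mult_mono; simp)
  also have "\<dots> \<le> (real n ^ K / fact K) * ((exp (real K) * fact K) * real K powr (q * f))"
    by (intro mult_left_mono mult_right_mono power_le_exp_mult_fact) auto
  also have "\<dots> = real n ^ K * exp (real K) * real K powr (q * f)" by simp
  also have "\<dots> \<le> (real n powr (D * q) * exp (q * (2 * v + 1))) * exp (q * C) * ((2 * C) powr (q * f) * ln (real n) powr (q * f))"
  proof (intro mult_mono)
    have "real n ^ K = real n powr (real D * real q + (2 * real v + 1))"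
    proof -
      have "real n ^ K = real n powr real K" using n0 by (simp add: powr_realpow)
      also have "real K = real D * real q + (2 * real v + 1)" by (simp add: K mult.commute)
      finally show ?thesis .
    qed
    then have "real n ^ K = real n powr (D * q) * real n powr (2 * v + 1)"
      by (simp add: powr_add)
    also have "real n powr (2 * v + 1) = exp (ln (real n) * (2 * v + 1))"
      using n0 by (simp add: powr_def mult.commute)
    also have "\<dots> \<le> exp (q * (2 * v + 1))"
    proof -
      have "ln (real n) * real (2 * v + 1) \<le> real q * real (2 * v + 1)" by (intro mult_right_mono q) simp
      then show ?thesis by (simp add: algebra_simps)
    qed
    finally show "real n ^ K \<le> real n powr (D * q) * exp (q * (2 * v + 1))" by (simp add: mult_left_mono)
    show "exp (real K) \<le> exp (q * C)" using KC by simp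
    have "q * C \<le> 2 * ln (real n) * C" using q C1 by (intro mult_right_mono) auto
    then have "real K \<le> (2 * C) * ln (real n)" using KC by (simp add: mult_ac)
    then have "real K powr (q * f) \<le> ((2 * C) * ln (real n)) powr (q * f)"
      using K1 f by (intro powr_mono2) auto
    then show "real K powr (q * f) \<le> (2 * C) powr (q * f) * ln (real n) powr (q * f)"
      using C1 ln0 by (simp add: powr_mult)
  qed auto
  also have "\<dots> = (real n powr (D / 2) * ln (real n) powr (f / 2) * (exp ((2 * v + 1 + C) / 2) * (2 * C) powr (f / 2))) ^ (2 * q)"
  proof -
    have pw: "(x powr (a / 2)) ^ (2 * q) = x powr (a * q)" if "x > 0" for x a :: real
      using that by (simp add: powr_powr flip: powr_realpow)
    have ex: "exp (a / 2) ^ (2 * q) = exp (q * a)" for a :: real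
      by (simp flip: exp_of_nat_mult)
    have e: "exp (q * (2 * v + 1 + C)) = exp (q * (2 * v + 1)) * exp (q * C)"
      by (simp add: algebra_simps flip: exp_add)
    have C2: "2 * C > 0" using C1 by simp
    show ?thesis
      unfolding power_mult_distrib pw[OF n0] pw[OF ln0] pw[OF C2] ex e by (simp add: mult_ac)
  qed
  finally show ?thesis by (simp add: C_def add_ac)
qed

text \<open>Supplies \<open>q\<close>: the trace bound asks for a power of two with positive
  exponent, and the least power of two that is at least x does not exceed 2 x. The exponent is
  positive because x > 1.\<close>

lemma ex_power2_near_ln:
  assumes "x > (1::real)"
  shows "\<exists>k. x \<le> 2 ^ Suc k \<and> 2 ^ Suc k \<le> 2 * x"
proof -
  define j where "j = (LEAST j. x \<le> 2 ^ j)"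
  have ex: "\<exists>j. x \<le> 2 ^ j" using real_arch_pow[of 2 x] by (auto intro: less_imp_le)
  have j: "x \<le> 2 ^ j" unfolding j_def using ex by (rule LeastI_ex)
  then have "j \<noteq> 0" using assms by (intro notI) simp
  then obtain k where k: "j = Suc k" by (cases j) auto
  have "\<not> x \<le> 2 ^ k" unfolding j_def[symmetric] using not_less_Least[of k "\<lambda>j. x \<le> 2 ^ j"] k j_def by simp
  then show ?thesis using j k by auto
qed

text \<open>The pointwise bound X \<le> B + B (X / B)^N stands in for Jensen's inequality at the
  price of a factor 2.\<close>

lemma expectation_le_of_moment:
  fixes X :: "('e \<Rightarrow> real) \<Rightarrow> real"
  assumes A: "finite A" and X: "\<And>\<epsilon>. X \<epsilon> \<ge> 0" and N: "N \<ge> 1" and B: "B > 0"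
    and mom: "measure_pmf.expectation (signs A) (\<lambda>\<epsilon>. X \<epsilon> ^ N) \<le> B ^ N"
  shows "measure_pmf.expectation (signs A) X \<le> 2 * B"
proof -
  have "X \<epsilon> \<le> B + B * (X \<epsilon> ^ N / B ^ N)" for \<epsilon>
  proof (cases "X \<epsilon> \<le> B")
    case True
    then show ?thesis using B X[of \<epsilon>] by (simp add: add_increasing2)
  next
    case False
    then have "X \<epsilon> / B \<le> (X \<epsilon> / B) ^ N" using B N by (intro self_le_power) auto
    then have "B * (X \<epsilon> / B) \<le> B * (X \<epsilon> / B) ^ N" using B by (intro mult_left_mono) auto
    then show ?thesis using B by (simp add: power_divide)
  qed
  then have "measure_pmf.expectation (signs A) X
      \<le> measure_pmf.expectation (signs A) (\<lambda>\<epsilon>. B + B * (X \<epsilon> ^ N / B ^ N))"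
    by (intro expectation_signs_mono A)
  also have "\<dots> = B + B * (measure_pmf.expectation (signs A) (\<lambda>\<epsilon>. X \<epsilon> ^ N) / B ^ N)"
    using A by (simp add: integrable_signs)
  also have "\<dots> \<le> B + B * (B ^ N / B ^ N)"
    using mom B by (intro add_left_mono mult_left_mono divide_right_mono) auto
  finally show ?thesis using B by simp
qed

lemma expectation_graph_matrix_norm_power_le:
  fixes \<alpha> :: "'a shape"
  assumes shape: "is_shape \<alpha>" and us: "set us = left_verts \<alpha>" and vs: "set vs = right_verts \<alpha>"
    and q: "q = 2 ^ Suc k"
    and K: "q * (card (verts \<alpha>) - min_separator_size \<alpha> + card (isolated_middle_verts \<alpha>)) + 2 * card (verts \<alpha>) \<le> K"
    and Kn: "K \<le> n"
  shows "measure_pmf.expectation (rademacher_edges n) (\<lambda>\<epsilon>. graph_matrix_norm n \<alpha> us vs \<epsilon> ^ (2 * q))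
    \<le> real ((n choose K) * K ^ card (free_positions \<alpha> q))"
proof -
  let ?R = "realizations n \<alpha>" and ?l = "\<lambda>\<phi>. map \<phi> us" and ?r = "\<lambda>\<phi>. map \<phi> vs"
  let ?G = "gram_chains ?R ?l ?r q"
  let ?S = "{p \<in> ?G. ?r (fst (hd p)) = ?r (snd (last p))}"
  let ?w = "\<lambda>\<epsilon>. chain_weight (sign_weight (edges \<alpha>) \<epsilon>)"
  let ?E = "measure_pmf.expectation (rademacher_edges n)"
  have sub: "set us \<subseteq> verts \<alpha>" "set vs \<subseteq> verts \<alpha>" using shape us vs by (auto simp: is_shape_def)
  have finG: "finite ?G" by (intro finite_gram_chains finite_realizations shape)
  have "?E (\<lambda>\<epsilon>. graph_matrix_norm n \<alpha> us vs \<epsilon> ^ (2 * q)) \<le> ?E (\<lambda>\<epsilon>. \<Sum>p\<in>?S. ?w \<epsilon> p)"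
    unfolding rademacher_edges_eq
  proof (intro expectation_signs_mono finite_nsets_2)
    fix \<epsilon>
    have "graph_matrix_norm n \<alpha> us vs \<epsilon> = op_norm (multi_index n (length us)) (multi_index n (length vs))
        (\<lambda>i j. \<Sum>\<phi>\<in>?R. sign_weight (edges \<alpha>) \<epsilon> \<phi> * (if ?l \<phi> = i \<and> ?r \<phi> = j then 1 else 0))"
      unfolding graph_matrix_norm_def by (intro op_norm_cong graph_matrix_eq)
    then show "graph_matrix_norm n \<alpha> us vs \<epsilon> ^ (2 * q) \<le> (\<Sum>p\<in>?S. ?w \<epsilon> p)"
      using op_norm_power_le_sum_chains[OF finite_realizations[OF shape] finite_multi_index
          realization_multi_index[OF shape sub(1)] finite_multi_index realization_multi_index[OF shape sub(2)],
          of n "sign_weight (edges \<alpha>) \<epsilon>" k]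
      by (simp only: q)
  qed
  also have "\<dots> = (\<Sum>p\<in>?S. ?E (\<lambda>\<epsilon>. ?w \<epsilon> p))"
    unfolding rademacher_edges_eq by (intro expectation_signs_sum finite_nsets_2)
  also have "\<dots> \<le> (\<Sum>p\<in>?S. if edges_doubled (edges \<alpha>) p then 1 else 0)"
    by (intro sum_mono expectation_chain_weight_le[OF shape]) auto
  \<comment> \<open>The closing condition of the trace is dropped here: the label count relies only
    on the links of the open chain.\<close>
  also have "\<dots> \<le> (\<Sum>p\<in>?G. if edges_doubled (edges \<alpha>) p then 1 else 0)"
    using finG by (intro sum_mono2) auto
  also have "\<dots> = real (card {p \<in> ?G. edges_doubled (edges \<alpha>) p})"
    using finG by (simp add: sum.If_cases Int_def)
  also have "\<dots> \<le> real ((n choose K) * K ^ card (free_positions \<alpha> q))"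
    unfolding of_nat_le_iff by (rule card_doubled_chains_le[OF shape us vs K Kn]) (simp add: q)
  finally show ?thesis .
qed

lemma min_separator_size_le_card_verts: "min_separator_size \<alpha> \<le> card (verts \<alpha>)"
  by (rule min_separator_size_le[OF verts_is_separator])

lemma card_verts_split:
  assumes "is_shape \<alpha>"
  shows "card (verts \<alpha>) = card (middle_verts \<alpha>) + card (left_verts \<alpha> - right_verts \<alpha>)
    + card (right_verts \<alpha> - left_verts \<alpha>) + card (left_verts \<alpha> \<inter> right_verts \<alpha>)"
proof -
  have fin: "finite (verts \<alpha>)" "finite (left_verts \<alpha>)" "finite (right_verts \<alpha>)" "finite (middle_verts \<alpha>)"
    using assms by (auto simp: is_shape_def middle_verts_def intro: finite_subset)
  have "verts \<alpha> = ((middle_verts \<alpha> \<union> (left_verts \<alpha> - right_verts \<alpha>)) \<union> (right_verts \<alpha> - left_verts \<alpha>))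
      \<union> (left_verts \<alpha> \<inter> right_verts \<alpha>)"
    using assms by (auto simp: is_shape_def middle_verts_def)
  also have "card \<dots> = card (middle_verts \<alpha>) + card (left_verts \<alpha> - right_verts \<alpha>)
    + card (right_verts \<alpha> - left_verts \<alpha>) + card (left_verts \<alpha> \<inter> right_verts \<alpha>)"
    using fin by (subst card_Un_disjoint; (auto simp: middle_verts_def)?)+
  finally show ?thesis .
qed

text \<open>Every separator contains the vertices common to both sides, and isolated middle vertices
  are middle vertices. The sign is what makes the factor K^(q f) in \<open>count_bound\<close>
  monotone in its base.\<close>

lemma log_exponent_nonneg:
  assumes "is_shape \<alpha>"
  shows "log_exponent \<alpha> \<ge> 0"
proof -
  obtain S where S: "is_separator \<alpha> S" "card S = min_separator_size \<alpha>" using ex_min_separator by blast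
  have fin: "finite (verts \<alpha>)" "S \<subseteq> verts \<alpha>" using assms S by (auto simp: is_shape_def is_separator_def)
  have "card (left_verts \<alpha> \<inter> right_verts \<alpha>) \<le> card S"
    using separator_contains_intersection[OF assms S(1)] fin by (intro card_mono) (auto intro: finite_subset)
  moreover have "card (isolated_middle_verts \<alpha>) \<le> card (middle_verts \<alpha>)"
    using fin(1) by (intro card_mono) (auto simp: isolated_middle_verts_def middle_verts_def)
  ultimately show ?thesis unfolding log_exponent_def S(2)[symmetric] by linarith
qed

theorem expectation_graph_matrix_norm_upper:
  fixes \<alpha> :: "'a shape"
  assumes shape: "is_shape \<alpha>"
  shows "\<exists>C n0. C > 0 \<and> (\<forall>us vs. set us = left_verts \<alpha> \<and> set vs = right_verts \<alpha> \<longrightarrow> (\<forall>n\<ge>n0.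
    measure_pmf.expectation (rademacher_edges n) (graph_matrix_norm n \<alpha> us vs)
      \<le> C * real n powr norm_exponent \<alpha> * ln (real n) powr (log_exponent \<alpha> / 2)))"
proof -
  define v where "v = card (verts \<alpha>)"
  define D where "D = v - min_separator_size \<alpha> + card (isolated_middle_verts \<alpha>)"
  define f where "f = log_exponent \<alpha>"
  define c where "c = exp ((2 * v + 1 + (D + 2 * v + 1)) / 2) * (2 * (D + 2 * v + 1)) powr (f / 2)"
  have c: "c > 0" by (simp add: c_def)
  have f: "f \<ge> 0" unfolding f_def by (rule log_exponent_nonneg[OF shape])
  have D: "real D = 2 * norm_exponent \<alpha>"
    using min_separator_size_le_card_verts[of \<alpha>] by (simp add: D_def v_def norm_exponent_def of_nat_diff)
  \<comment> \<open>Ensures K \<le> n for the \<open>q\<close> chosen below, since K \<le> q (D + 2v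
    + 1) and q \<le> 2 ln n.\<close>
  have "eventually (\<lambda>n. 2 * (D + 2 * v + 1) * ln (real n) \<le> real n) sequentially"
  proof -
    define e :: real where "e = 1 / (2 * (D + 2 * v + 1))"
    have e: "e > 0" by (simp add: e_def)
    have "eventually (\<lambda>n. ln (real n) / real n < e) sequentially"
      using lim_ln_over_n e by (rule order_tendstoD)
    then show ?thesis
      using eventually_gt_at_top[of 0]
      by eventually_elim (use e in \<open>simp add: e_def field_simps\<close>)
  qed
  then obtain n1 where n1: "\<And>n. n \<ge> n1 \<Longrightarrow> 2 * (D + 2 * v + 1) * ln (real n) \<le> real n"
    unfolding eventually_sequentially by blast
  have "measure_pmf.expectation (rademacher_edges n) (graph_matrix_norm n \<alpha> us vs)
      \<le> (2 * c) * real n powr norm_exponent \<alpha> * ln (real n) powr (log_exponent \<alpha> / 2)"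
    if us: "set us = left_verts \<alpha>" and vs: "set vs = right_verts \<alpha>" and n: "n \<ge> max n1 4" for us vs n
  proof -
    \<comment> \<open>From n \<ge> 4 and e \<le> 3 follows ln n > 1, as the choice of the power of
      two requires.\<close>
    have "exp (1::real) < real n" using exp_le n by linarith
    then have "ln (exp 1) < ln (real n)" by (intro ln_less_cancel_iff[THEN iffD2]) (use n in auto)
    then have "ln (real n) > 1" by simp
    then obtain k where k: "ln (real n) \<le> 2 ^ Suc k" "2 ^ Suc k \<le> 2 * ln (real n)"
      using ex_power2_near_ln by blast
    define q :: nat where "q = 2 ^ Suc k"
    have q: "ln (real n) \<le> q" "q \<le> 2 * ln (real n)" "q > 0" using k by (simp_all add: q_def)
    define K where "K = q * D + 2 * v + 1"
    have "1 * (2 * real v + 1) \<le> q * (2 * real v + 1)" using q by (intro mult_right_mono) auto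
    then have "real K \<le> real q * real (D + 2 * v + 1)" by (simp add: K_def algebra_simps)
    also have "\<dots> \<le> 2 * ln (real n) * real (D + 2 * v + 1)" using q by (intro mult_right_mono) auto
    also have "\<dots> \<le> real n" using n1[of n] n by (simp add: algebra_simps)
    finally have Kn: "K \<le> n" by simp
    let ?m = "card (free_positions \<alpha> q)"
    have m: "real ?m \<le> K + q * f"
    proof -
      let ?W = "card (middle_verts \<alpha>)" and ?L = "card (left_verts \<alpha> - right_verts \<alpha>)"
        and ?R = "card (right_verts \<alpha> - left_verts \<alpha>)" and ?B = "card (left_verts \<alpha> \<inter> right_verts \<alpha>)"
      have "card (right_verts \<alpha>) \<le> v" using shape by (auto simp: v_def is_shape_def intro!: card_mono)
      then have "real ?m \<le> real (q * (2 * ?W + ?L + ?R) + v)"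
        using card_free_positions_le[OF shape, of q] by linarith
      also have "\<dots> = q * (2 * real ?W + ?L + ?R) + v" by simp
      \<comment> \<open>The origin of \<open>log_exponent\<close>: a pair of copies has D + f free
        positions, and only f of them remain after the factorial has paid for D.\<close>
      also have "2 * real ?W + ?L + ?R = D + f"
        using card_verts_split[OF shape] min_separator_size_le_card_verts[of \<alpha>]
        by (simp add: D_def v_def f_def log_exponent_def of_nat_diff)
      finally show ?thesis by (simp add: K_def algebra_simps)
    qed
    define B where "B = real n powr (D / 2) * ln (real n) powr (f / 2) * c"
    have "measure_pmf.expectation (rademacher_edges n) (\<lambda>\<epsilon>. graph_matrix_norm n \<alpha> us vs \<epsilon> ^ (2 * q)) \<le> B ^ (2 * q)"
    proof (rule order_trans[OF expectation_graph_matrix_norm_power_le[OF shape us vs q_def _ Kn]])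
      show "q * (card (verts \<alpha>) - min_separator_size \<alpha> + card (isolated_middle_verts \<alpha>)) + 2 * card (verts \<alpha>) \<le> K"
        by (simp add: K_def D_def v_def)
      show "real ((n choose K) * K ^ ?m) \<le> B ^ (2 * q)"
        unfolding B_def c_def using count_bound[OF f K_def m q] n by simp
    qed
    moreover have "B > 0" using c n \<open>ln (real n) > 1\<close> by (simp add: B_def)
    ultimately have "measure_pmf.expectation (rademacher_edges n) (graph_matrix_norm n \<alpha> us vs) \<le> 2 * B"
      unfolding rademacher_edges_eq using q(3)
      by (intro expectation_le_of_moment[where N = "2 * q"] finite_nsets_2) (auto simp: graph_matrix_norm_def op_norm_nonneg)
    then show ?thesis by (simp add: B_def D f_def mult_ac)
  qed
  then show ?thesis using c by (intro exI[of _ "2 * c"] exI[of _ "max n1 4"]) auto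
qed

section \<open>The lower bound\<close>

text \<open>Squares of signs are 1 on the support, so every product of signs reduces to a
  square-free monomial, the form that the fourth moment inequality requires.\<close>

lemma sign_prod_eq_prod_odd:
  assumes A: "finite A" and I: "finite I" "g ` I \<subseteq> A" and \<epsilon>: "\<epsilon> \<in> set_pmf (signs A)"
  shows "(\<Prod>i\<in>I. \<epsilon> (g i)) = (\<Prod>e\<in>{e\<in>A. odd (card {i\<in>I. g i = e})}. \<epsilon> e)"
proof -
  have "(\<Prod>i\<in>I. \<epsilon> (g i)) = (\<Prod>e\<in>A. \<Prod>i\<in>{i\<in>I. g i = e}. \<epsilon> (g i))"
    using prod.group[OF I(1) A I(2), of "\<lambda>i. \<epsilon> (g i)"] by simp
  also have "\<dots> = (\<Prod>e\<in>A. if odd (card {i\<in>I. g i = e}) then \<epsilon> e else 1)"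
  proof (intro prod.cong refl)
    fix e assume "e \<in> A"
    then have "\<epsilon> e = -1 \<or> \<epsilon> e = 1" using signs_value[OF A \<epsilon>] by blast
    moreover have "(\<Prod>i\<in>{i\<in>I. g i = e}. \<epsilon> (g i)) = \<epsilon> e ^ card {i\<in>I. g i = e}" by simp
    ultimately show "(\<Prod>i\<in>{i\<in>I. g i = e}. \<epsilon> (g i)) = (if odd (card {i\<in>I. g i = e}) then \<epsilon> e else 1)"
      by (cases "even (card {i\<in>I. g i = e})"; elim disjE; simp)
  qed
  also have "\<dots> = (\<Prod>e\<in>{e\<in>A. odd (card {i\<in>I. g i = e})}. \<epsilon> e)"
    using A by (simp add: prod.inter_filter)
  finally show ?thesis .
qed

text \<open>Reducing each product to its odd part leaves at most \<open>card I\<close> signs, which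
  bounds the degree. Different \<open>j\<close> may reduce to the same monomial, which the fourth
  moment inequality allows.\<close>

lemma fourth_moment_sign_polynomial:
  assumes A: "finite A" and J: "finite J" and I: "finite I" and g: "\<And>j. j \<in> J \<Longrightarrow> g j ` I \<subseteq> A"
  shows "measure_pmf.expectation (signs A) (\<lambda>\<epsilon>. (\<Sum>j\<in>J. \<Prod>i\<in>I. \<epsilon> (g j i)) ^ 4)
    \<le> 9 ^ card I * (measure_pmf.expectation (signs A) (\<lambda>\<epsilon>. (\<Sum>j\<in>J. \<Prod>i\<in>I. \<epsilon> (g j i))\<^sup>2))\<^sup>2"
proof -
  define T where "T j = {e\<in>A. odd (card {i\<in>I. g j i = e})}" for j
  have eq: "(\<Sum>j\<in>J. \<Prod>i\<in>I. \<epsilon> (g j i)) = (\<Sum>j\<in>J. 1 * (\<Prod>e\<in>T j. \<epsilon> e))"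
    if "\<epsilon> \<in> set_pmf (signs A)" for \<epsilon>
    unfolding T_def by (intro sum.cong refl) (simp add: sign_prod_eq_prod_odd[OF A I g that])
  have T: "T j \<subseteq> A \<and> card (T j) \<le> card I" for j
  proof
    have "e \<in> g j ` I" if "e \<in> T j" for e
    proof -
      have "odd (card {i\<in>I. g j i = e})" using that by (simp add: T_def)
      then have "{i\<in>I. g j i = e} \<noteq> {}" by (metis card.empty even_zero)
      then show ?thesis by auto
    qed
    then have "card (T j) \<le> card (g j ` I)" using I by (intro card_mono) auto
    then show "card (T j) \<le> card I" using card_image_le[OF I, of "g j"] by linarith
  qed (simp add: T_def)
  have "measure_pmf.expectation (signs A) (\<lambda>\<epsilon>. (\<Sum>j\<in>J. \<Prod>i\<in>I. \<epsilon> (g j i)) ^ 4)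
      = measure_pmf.expectation (signs A) (\<lambda>\<epsilon>. (\<Sum>j\<in>J. 1 * (\<Prod>e\<in>T j. \<epsilon> e)) ^ 4)"
    by (rule expectation_signs_cong) (simp only: eq)
  also have "\<dots> \<le> 9 ^ card I * (measure_pmf.expectation (signs A) (\<lambda>\<epsilon>. (\<Sum>j\<in>J. 1 * (\<Prod>e\<in>T j. \<epsilon> e))\<^sup>2))\<^sup>2"
    by (rule bonami_fourth_moment[OF A J T])
  also have "measure_pmf.expectation (signs A) (\<lambda>\<epsilon>. (\<Sum>j\<in>J. 1 * (\<Prod>e\<in>T j. \<epsilon> e))\<^sup>2)
      = measure_pmf.expectation (signs A) (\<lambda>\<epsilon>. (\<Sum>j\<in>J. \<Prod>i\<in>I. \<epsilon> (g j i))\<^sup>2)"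
    by (rule expectation_signs_cong) (simp only: eq)
  finally show ?thesis .
qed

text \<open>Weighted AM-GM separates sqrt(N X Y) into \<open>N\<close> and X Y, so that only the
  first moment of \<open>N\<close> occurs. With r a lower bound for E sqrt|Z| and s an upper bound
  for E(X Y), the weights s / r and r / s give r \<le> ((s / r) E N + r) / 2, hence E N \<ge> r^2 /
  s.\<close>

lemma expectation_ge_of_bilinear_bound:
  fixes N X Y Z :: "('e \<Rightarrow> real) \<Rightarrow> real"
  assumes A: "finite A" and K: "K \<ge> 1"
    and mom: "measure_pmf.expectation (signs A) (\<lambda>\<epsilon>. Z \<epsilon> ^ 4) \<le> K * (measure_pmf.expectation (signs A) (\<lambda>\<epsilon>. (Z \<epsilon>)\<^sup>2))\<^sup>2"
    and nonneg: "\<And>\<epsilon>. N \<epsilon> \<ge> 0" "\<And>\<epsilon>. X \<epsilon> \<ge> 0" "\<And>\<epsilon>. Y \<epsilon> \<ge> 0"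
    and Z: "\<And>\<epsilon>. \<bar>Z \<epsilon>\<bar> \<le> N \<epsilon> * (X \<epsilon> * Y \<epsilon>)"
    and a: "measure_pmf.expectation (signs A) (\<lambda>\<epsilon>. (X \<epsilon>)\<^sup>2) \<le> a" "a > 0"
    and b: "measure_pmf.expectation (signs A) (\<lambda>\<epsilon>. (Y \<epsilon>)\<^sup>2) \<le> b" "b > 0"
    and m: "m \<le> measure_pmf.expectation (signs A) Z" "m > 0"
  shows "m / ((4 * K)\<^sup>2 * sqrt (a * b)) \<le> measure_pmf.expectation (signs A) N"
proof -
  let ?E = "measure_pmf.expectation (signs A)"
  define s where "s = sqrt (a * b)"
  define r where "r = sqrt m / (4 * K)"
  have s: "s > 0" using a b by (simp add: s_def)
  have r: "r > 0" using m K by (simp add: r_def)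
  have XY: "?E (\<lambda>\<epsilon>. X \<epsilon> * Y \<epsilon>) \<le> s"
    unfolding s_def
  proof (rule real_le_rsqrt)
    have "(?E (\<lambda>\<epsilon>. X \<epsilon> * Y \<epsilon>))\<^sup>2 \<le> ?E (\<lambda>\<epsilon>. (X \<epsilon>)\<^sup>2) * ?E (\<lambda>\<epsilon>. (Y \<epsilon>)\<^sup>2)"
      by (rule expectation_cauchy_schwarz_signs[OF A])
    also have "\<dots> \<le> a * b" using a b by (intro mult_mono) auto
    finally show "(?E (\<lambda>\<epsilon>. X \<epsilon> * Y \<epsilon>))\<^sup>2 \<le> a * b" .
  qed
  have amgm: "sqrt \<bar>Z \<epsilon>\<bar> \<le> ((s / r) * N \<epsilon> + (r / s) * (X \<epsilon> * Y \<epsilon>)) / 2" for \<epsilon>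
  proof -
    have "sqrt \<bar>Z \<epsilon>\<bar> \<le> sqrt (((s / r) * N \<epsilon>) * ((r / s) * (X \<epsilon> * Y \<epsilon>)))"
      using Z[of \<epsilon>] r s by simp
    also have "\<dots> \<le> ((s / r) * N \<epsilon> + (r / s) * (X \<epsilon> * Y \<epsilon>)) / 2"
      using r s nonneg by (intro arith_geo_mean_sqrt) auto
    finally show ?thesis .
  qed
  have "r \<le> sqrt (?E Z) / (4 * K)"
    unfolding r_def using m K by (intro divide_right_mono) auto
  also have "\<dots> \<le> ?E (\<lambda>\<epsilon>. sqrt \<bar>Z \<epsilon>\<bar>)"
    using m by (intro expectation_sqrt_ge_of_fourth_moment A K mom) simp
  also have "\<dots> \<le> ?E (\<lambda>\<epsilon>. ((s / r) * N \<epsilon> + (r / s) * (X \<epsilon> * Y \<epsilon>)) / 2)"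
    by (intro expectation_signs_mono A amgm)
  also have "\<dots> = ((s / r) * ?E N + (r / s) * ?E (\<lambda>\<epsilon>. X \<epsilon> * Y \<epsilon>)) / 2"
    using A by (simp add: integrable_signs)
  also have "\<dots> \<le> ((s / r) * ?E N + (r / s) * s) / 2"
    using XY r s by (intro divide_right_mono add_left_mono mult_left_mono) auto
  finally have "r \<le> (s / r) * ?E N" using s by simp
  then have "r\<^sup>2 / s \<le> ?E N" using r s by (simp add: field_simps power2_eq_square)
  moreover have "r\<^sup>2 / s = m / ((4 * K)\<^sup>2 * sqrt (a * b))"
    using m by (simp add: r_def s_def power_divide)
  ultimately show ?thesis by simp
qed

lemma bilinear_elementary_sum:
  fixes a :: "'p \<Rightarrow> real" and b :: "'r \<Rightarrow> real" and c :: "'s \<Rightarrow> real"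
  assumes fin: "finite P" "finite R" "finite Q" "finite I" "finite J"
    and lr: "l ` R \<subseteq> I" "r ` R \<subseteq> J"
  shows "(\<Sum>i\<in>I. \<Sum>j\<in>J. (\<Sum>\<psi>\<in>P. a \<psi> * (if p \<psi> = i then 1 else 0))
      * (\<Sum>\<phi>\<in>R. b \<phi> * (if l \<phi> = i \<and> r \<phi> = j then 1 else 0)) * (\<Sum>\<eta>\<in>Q. c \<eta> * (if q \<eta> = j then 1 else 0)))
    = (\<Sum>(\<psi>, \<phi>, \<eta>)\<in>{(\<psi>, \<phi>, \<eta>). \<psi> \<in> P \<and> \<phi> \<in> R \<and> \<eta> \<in> Q \<and> p \<psi> = l \<phi> \<and> q \<eta> = r \<phi>}. a \<psi> * b \<phi> * c \<eta>)"
proof -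
  define x where "x i = (\<Sum>\<psi>\<in>P. a \<psi> * (if p \<psi> = i then 1 else 0))" for i
  define y where "y j = (\<Sum>\<eta>\<in>Q. c \<eta> * (if q \<eta> = j then 1 else 0))" for j
  have "(\<Sum>i\<in>I. \<Sum>j\<in>J. x i * (\<Sum>\<phi>\<in>R. b \<phi> * (if l \<phi> = i \<and> r \<phi> = j then 1 else 0)) * y j)
      = (\<Sum>i\<in>I. \<Sum>j\<in>J. \<Sum>\<phi>\<in>R. if r \<phi> = j then (if l \<phi> = i then x i * b \<phi> * y j else 0) else 0)"
    unfolding sum_distrib_left sum_distrib_right by (intro sum.cong refl) auto
  also have "\<dots> = (\<Sum>i\<in>I. \<Sum>\<phi>\<in>R. \<Sum>j\<in>J. if r \<phi> = j then (if l \<phi> = i then x i * b \<phi> * y j else 0) else 0)"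
    by (intro sum.cong refl sum.swap)
  also have "\<dots> = (\<Sum>i\<in>I. \<Sum>\<phi>\<in>R. if l \<phi> = i then x i * b \<phi> * y (r \<phi>) else 0)"
    using fin lr by (intro sum.cong refl) (auto simp: sum.delta)
  also have "\<dots> = (\<Sum>\<phi>\<in>R. \<Sum>i\<in>I. if l \<phi> = i then x i * b \<phi> * y (r \<phi>) else 0)"
    by (rule sum.swap)
  also have "\<dots> = (\<Sum>\<phi>\<in>R. x (l \<phi>) * b \<phi> * y (r \<phi>))"
    using fin lr by (intro sum.cong refl) (auto simp: sum.delta)
  also have "\<dots> = (\<Sum>\<phi>\<in>R. \<Sum>\<psi>\<in>P. \<Sum>\<eta>\<in>Q. if p \<psi> = l \<phi> \<and> q \<eta> = r \<phi> then a \<psi> * b \<phi> * c \<eta> else 0)"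
  proof (intro sum.cong refl)
    fix \<phi>
    have "x (l \<phi>) * b \<phi> * y (r \<phi>) = (\<Sum>\<psi>\<in>P. \<Sum>\<eta>\<in>Q.
        b \<phi> * ((a \<psi> * (if p \<psi> = l \<phi> then 1 else 0)) * (c \<eta> * (if q \<eta> = r \<phi> then 1 else 0))))"
    proof -
      have "x (l \<phi>) * b \<phi> * y (r \<phi>) = b \<phi> * (x (l \<phi>) * y (r \<phi>))" by simp
      then show ?thesis by (simp only: x_def y_def sum_product) (simp only: sum_distrib_left)
    qed
    also have "\<dots> = (\<Sum>\<psi>\<in>P. \<Sum>\<eta>\<in>Q. if p \<psi> = l \<phi> \<and> q \<eta> = r \<phi> then a \<psi> * b \<phi> * c \<eta> else 0)"
      by (intro sum.cong refl) auto
    finally show "x (l \<phi>) * b \<phi> * y (r \<phi>)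
        = (\<Sum>\<psi>\<in>P. \<Sum>\<eta>\<in>Q. if p \<psi> = l \<phi> \<and> q \<eta> = r \<phi> then a \<psi> * b \<phi> * c \<eta> else 0)" .
  qed
  also have "\<dots> = (\<Sum>\<psi>\<in>P. \<Sum>\<phi>\<in>R. \<Sum>\<eta>\<in>Q. if p \<psi> = l \<phi> \<and> q \<eta> = r \<phi> then a \<psi> * b \<phi> * c \<eta> else 0)"
    by (rule sum.swap)
  also have "\<dots> = (\<Sum>(\<psi>, \<phi>, \<eta>)\<in>P \<times> R \<times> Q. if p \<psi> = l \<phi> \<and> q \<eta> = r \<phi> then a \<psi> * b \<phi> * c \<eta> else 0)"
    by (simp add: sum.cartesian_product)
  also have "\<dots> = (\<Sum>(\<psi>, \<phi>, \<eta>)\<in>{(\<psi>, \<phi>, \<eta>). \<psi> \<in> P \<and> \<phi> \<in> R \<and> \<eta> \<in> Q \<and> p \<psi> = l \<phi> \<and> q \<eta> = r \<phi>}. a \<psi> * b \<phi> * c \<eta>)"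
    by (rule sum.mono_neutral_cong_right) (use fin in \<open>auto split: if_splits\<close>)
  finally show ?thesis by (simp only: x_def y_def)
qed

section \<open>Test vectors attached to the two sides of a separator\<close>

definition extensions :: "nat \<Rightarrow> 'a set \<Rightarrow> ('a \<Rightarrow> nat) \<Rightarrow> 'a set \<Rightarrow> ('a \<Rightarrow> nat) set" where
  "extensions n S \<sigma> X = {\<psi> \<in> X \<rightarrow>\<^sub>E {1..n}. inj_on \<psi> X \<and> (\<forall>s\<in>S. \<psi> s = \<sigma> s)}"

text \<open>This is a column of another graph matrix: that of the partial shape on \<open>X\<close>
  with edges \<open>F\<close> and sides \<open>us\<close> and \<open>S\<close>, taken at the column
  that \<sigma> prescribes.\<close>

definition test_vector ::
  "nat \<Rightarrow> 'a set \<Rightarrow> ('a \<Rightarrow> nat) \<Rightarrow> 'a set \<Rightarrow> 'a set set \<Rightarrow> 'a list \<Rightarrow> (nat set \<Rightarrow> real) \<Rightarrow> nat list \<Rightarrow> real" where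
  "test_vector n S \<sigma> X F us \<epsilon> i =
    (\<Sum>\<psi>\<in>extensions n S \<sigma> X. sign_weight F \<epsilon> \<psi> * (if map \<psi> us = i then 1 else 0))"

lemma finite_extensions: "finite X \<Longrightarrow> finite (extensions n S \<sigma> X)"
  by (rule finite_subset[of _ "X \<rightarrow>\<^sub>E {1..n}"]) (auto simp: extensions_def intro: finite_PiE)

lemma card_extensions_le:
  assumes "finite X" "S \<subseteq> X"
  shows "card (extensions n S \<sigma> X) \<le> n ^ card (X - S)"
proof -
  have "inj_on (\<lambda>\<psi>. restrict \<psi> (X - S)) (extensions n S \<sigma> X)"
  proof (rule inj_onI)
    fix \<psi> \<psi>' assume \<psi>: "\<psi> \<in> extensions n S \<sigma> X" "\<psi>' \<in> extensions n S \<sigma> X"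
      and eq: "restrict \<psi> (X - S) = restrict \<psi>' (X - S)"
    show "\<psi> = \<psi>'"
    proof (rule extensionalityI[of _ X])
      show "\<psi> \<in> extensional X" "\<psi>' \<in> extensional X" using \<psi> by (auto simp: extensions_def PiE_def)
      fix x assume "x \<in> X"
      then show "\<psi> x = \<psi>' x" using \<psi> fun_cong[OF eq, of x] by (cases "x \<in> S") (auto simp: extensions_def)
    qed
  qed
  moreover have "(\<lambda>\<psi>. restrict \<psi> (X - S)) ` extensions n S \<sigma> X \<subseteq> (X - S) \<rightarrow>\<^sub>E {1..n}"
    by (auto simp: extensions_def)
  ultimately have "card (extensions n S \<sigma> X) \<le> card ((X - S) \<rightarrow>\<^sub>E {1..n})"
    using assms by (intro card_inj_on_le[of _ _ "(X - S) \<rightarrow>\<^sub>E {1..n}"] finite_PiE) auto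
  then show ?thesis using assms by (simp add: card_PiE)
qed

text \<open>Only pairs of extensions using the same set of edge labels contribute to the second moment, and the second
  extension then takes its values among the labels of the first.\<close>

lemma expectation_test_vector_norm_le:
  assumes X: "finite X" "S \<subseteq> X" and F: "F \<subseteq> nsets X 2" and us: "set us \<subseteq> X"
    and cover: "\<And>w. w \<in> X \<Longrightarrow> w \<notin> S \<Longrightarrow> w \<notin> set us \<Longrightarrow> \<exists>e\<in>F. w \<in> e"
  shows "measure_pmf.expectation (rademacher_edges n)
      (\<lambda>\<epsilon>. (L2_set (test_vector n S \<sigma> X F us \<epsilon>) (multi_index n (length us)))\<^sup>2)
    \<le> real (card X ^ card X) * real n ^ card (X - S)"
proof -
  let ?P = "extensions n S \<sigma> X" and ?I = "multi_index n (length us)"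
  let ?E = "measure_pmf.expectation (rademacher_edges n)"
  let ?c = "\<lambda>\<psi> \<psi>'. map \<psi> us = map \<psi>' us"
  have finP: "finite ?P" by (rule finite_extensions[OF X(1)])
  have finF: "finite F" using F X(1) by (meson finite_imp_finite_nsets finite_subset)
  have in_I: "map \<psi> us \<in> ?I" if "\<psi> \<in> ?P" for \<psi>
    using that us by (fastforce simp: extensions_def multi_index_def)
  have eq: "(L2_set (test_vector n S \<sigma> X F us \<epsilon>) ?I)\<^sup>2
      = (\<Sum>\<psi>\<in>?P. \<Sum>\<psi>'\<in>?P. if ?c \<psi> \<psi>' then sign_weight F \<epsilon> \<psi> * sign_weight F \<epsilon> \<psi>' else 0)" for \<epsilon>
  proof -
    have "(L2_set (test_vector n S \<sigma> X F us \<epsilon>) ?I)\<^sup>2 = (\<Sum>i\<in>?I. \<Sum>\<psi>\<in>?P. \<Sum>\<psi>'\<in>?P.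
        if map \<psi> us = i then (if ?c \<psi> \<psi>' then sign_weight F \<epsilon> \<psi> * sign_weight F \<epsilon> \<psi>' else 0) else 0)"
      unfolding L2_set_def test_vector_def
      by (subst real_sqrt_pow2, simp add: sum_nonneg, unfold power2_eq_square sum_product, intro sum.cong refl) auto
    also have "\<dots> = (\<Sum>\<psi>\<in>?P. \<Sum>i\<in>?I. \<Sum>\<psi>'\<in>?P.
        if map \<psi> us = i then (if ?c \<psi> \<psi>' then sign_weight F \<epsilon> \<psi> * sign_weight F \<epsilon> \<psi>' else 0) else 0)"
      by (rule sum.swap)
    also have "\<dots> = (\<Sum>\<psi>\<in>?P. \<Sum>\<psi>'\<in>?P. \<Sum>i\<in>?I.
        if map \<psi> us = i then (if ?c \<psi> \<psi>' then sign_weight F \<epsilon> \<psi> * sign_weight F \<epsilon> \<psi>' else 0) else 0)"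
      by (intro sum.cong refl sum.swap)
    also have "\<dots> = (\<Sum>\<psi>\<in>?P. \<Sum>\<psi>'\<in>?P. if ?c \<psi> \<psi>' then sign_weight F \<epsilon> \<psi> * sign_weight F \<epsilon> \<psi>' else 0)"
      using in_I by (intro sum.cong refl) (simp add: finite_multi_index sum.delta)
    finally show ?thesis .
  qed
  have pair: "?E (\<lambda>\<epsilon>. if ?c \<psi> \<psi>' then sign_weight F \<epsilon> \<psi> * sign_weight F \<epsilon> \<psi>' else 0)
      \<le> (if \<psi>' \<in> X \<rightarrow>\<^sub>E \<psi> ` X then 1 else 0)" if \<psi>: "\<psi> \<in> ?P" "\<psi>' \<in> ?P" for \<psi> \<psi>'
  proof (cases "?c \<psi> \<psi>'")
    case False
    show ?thesis unfolding if_not_P[OF False] by simp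
  next
    case True
    let ?J = "(UNIV :: bool set) \<times> F" and ?g = "\<lambda>x. (if fst x then \<psi> else \<psi>') ` snd x"
    have "(\<Prod>x\<in>?J. \<epsilon> (?g x)) = sign_weight F \<epsilon> \<psi> * sign_weight F \<epsilon> \<psi>'" for \<epsilon>
    proof -
      have "(\<Prod>x\<in>?J. \<epsilon> (?g x)) = (\<Prod>b\<in>(UNIV :: bool set). \<Prod>e\<in>F. \<epsilon> ((if b then \<psi> else \<psi>') ` e))"
        by (simp add: prod.cartesian_product case_prod_beta)
      then show ?thesis by (simp add: UNIV_bool sign_weight_def mult.commute)
    qed
    then have "?E (\<lambda>\<epsilon>. if ?c \<psi> \<psi>' then sign_weight F \<epsilon> \<psi> * sign_weight F \<epsilon> \<psi>' else 0)
        = measure_pmf.expectation (signs (nsets {1..n} 2)) (\<lambda>\<epsilon>. \<Prod>x\<in>?J. \<epsilon> (?g x))"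
      using True by (simp add: rademacher_edges_eq)
    also have "\<dots> = (if \<forall>a. even (card {x\<in>?J. ?g x = a}) then 1 else 0)"
    proof (intro expectation_signs_prod finite_nsets_2)
      show "finite ?J" using finF by simp
      show "?g ` ?J \<subseteq> nsets {1..n} 2"
      proof (rule image_subsetI)
        fix x assume "x \<in> ?J"
        then have "snd x \<in> nsets X 2" using F by auto
        then show "?g x \<in> nsets {1..n} 2"
          using \<psi> by (intro image_edge) (auto simp: extensions_def)
      qed
    qed
    also have "\<dots> \<le> (if \<psi>' \<in> X \<rightarrow>\<^sub>E \<psi> ` X then 1 else 0)"
    proof -
      have "\<psi>' \<in> X \<rightarrow>\<^sub>E \<psi> ` X" if even: "\<forall>a. even (card {x\<in>?J. ?g x = a})"
      proof (rule PiE_I)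
        fix w assume w: "w \<in> X"
        show "\<psi>' w \<in> \<psi> ` X"
        proof (cases "w \<in> S \<or> w \<in> set us")
          case True
          then have "\<psi>' w = \<psi> w" using \<psi> \<open>?c \<psi> \<psi>'\<close> by (auto simp: extensions_def)
          then show ?thesis using w by auto
        next
          case False
          then obtain e where e: "e \<in> F" "w \<in> e" using cover w by blast
          let ?C = "{x\<in>?J. ?g x = ?g (False, e)}"
          have "(False, e) \<in> ?C" using e by simp
          moreover have "?C \<noteq> {(False, e)}"
          proof
            assume C: "?C = {(False, e)}"
            have "even (card ?C)" using even by (rule spec)
            then show False unfolding C by simp
          qed
          ultimately obtain x where "x \<in> ?C" "x \<noteq> (False, e)" by blast
          then obtain b e' where x: "(b, e') \<in> ?C" "(b, e') \<noteq> (False, e)" by (cases x) auto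
          have sub: "e \<subseteq> X" "e' \<subseteq> X" using F e x by (auto simp: nsets_def)
          \<comment> \<open>Injectivity of \<psi>' excludes a second occurrence within the same
            labelling, so the matching edge belongs to \<psi>.\<close>
          have "b"
          proof (rule ccontr)
            assume "\<not> b"
            then have "\<psi>' ` e' = \<psi>' ` e" using x by simp
            then have "e' = e" using inj_on_image_eq_iff[of \<psi>' X e' e] sub \<psi> by (simp add: extensions_def)
            then show False using x \<open>\<not> b\<close> by simp
          qed
          then have "\<psi> ` e' = \<psi>' ` e" using x by simp
          then show ?thesis using e sub by blast
        qed
      qed (use \<psi> in \<open>auto simp: extensions_def PiE_def extensional_def\<close>)
      then show ?thesis by auto
    qed
    finally show ?thesis .
  qed
  have "?E (\<lambda>\<epsilon>. (L2_set (test_vector n S \<sigma> X F us \<epsilon>) ?I)\<^sup>2)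
      = (\<Sum>\<psi>\<in>?P. \<Sum>\<psi>'\<in>?P. ?E (\<lambda>\<epsilon>. if ?c \<psi> \<psi>' then sign_weight F \<epsilon> \<psi> * sign_weight F \<epsilon> \<psi>' else 0))"
    by (simp only: eq rademacher_edges_eq expectation_signs_sum[OF finite_nsets_2])
  also have "\<dots> \<le> (\<Sum>\<psi>\<in>?P. \<Sum>\<psi>'\<in>?P. if \<psi>' \<in> X \<rightarrow>\<^sub>E \<psi> ` X then 1 else 0)"
    by (intro sum_mono pair)
  also have "\<dots> \<le> (\<Sum>\<psi>\<in>?P. real (card X ^ card X))"
  proof (rule sum_mono)
    fix \<psi>
    have "(\<Sum>\<psi>'\<in>?P. if \<psi>' \<in> X \<rightarrow>\<^sub>E \<psi> ` X then 1 else 0) = real (card (?P \<inter> (X \<rightarrow>\<^sub>E \<psi> ` X)))"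
      using finP by (simp add: sum.If_cases Int_def)
    also have "\<dots> \<le> real (card (X \<rightarrow>\<^sub>E \<psi> ` X))"
      using X by (simp add: card_mono finite_PiE)
    also have "\<dots> \<le> real (card X ^ card X)"
      using X by (simp add: card_PiE card_image_le power_mono)
    finally show "(\<Sum>\<psi>'\<in>?P. if \<psi>' \<in> X \<rightarrow>\<^sub>E \<psi> ` X then 1 else 0) \<le> real (card X ^ card X)" .
  qed
  also have "\<dots> = real (card ?P) * real (card X ^ card X)" by simp
  also have "\<dots> \<le> real (n ^ card (X - S)) * real (card X ^ card X)"
    using card_extensions_le[OF X, of n \<sigma>] by (intro mult_right_mono) (simp_all only: of_nat_le_iff of_nat_0_le_iff)
  finally show ?thesis by (simp add: mult.commute)
qed

text \<open>\<open>Q\<close> collects the vertices joined to the right side by a path avoiding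
  \<open>S\<close>. An edge leaving \<open>Q\<close> ends in \<open>S\<close>, and no left vertex
  lies in \<open>Q\<close> because \<open>S\<close> separates. Isolated middle vertices form a class
  of their own, so that every vertex of \<open>L\<close> or \<open>R\<close> outside the two
  distinguished sets lies on an edge, as the second moment of a test vector demands.\<close>

lemma separator_split:
  assumes shape: "is_shape \<alpha>" and S: "is_separator \<alpha> S" "S \<inter> isolated_middle_verts \<alpha> = {}"
  obtains L R where "verts \<alpha> = S \<union> L \<union> R \<union> isolated_middle_verts \<alpha>"
    "S \<inter> L = {}" "S \<inter> R = {}" "L \<inter> R = {}" "(L \<union> R) \<inter> isolated_middle_verts \<alpha> = {}"
    "left_verts \<alpha> \<subseteq> S \<union> L" "right_verts \<alpha> \<subseteq> S \<union> R"
    "\<And>e. e \<in> edges \<alpha> \<Longrightarrow> e \<subseteq> S \<union> L \<or> e \<subseteq> S \<union> R"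
proof -
  let ?I = "isolated_middle_verts \<alpha>"
  define Q where "Q = {x. \<exists>p. is_path \<alpha> p \<and> hd p = x \<and> last p \<in> right_verts \<alpha> \<and> set p \<inter> S = {}}"
  define R where "R = Q - ?I"
  define L where "L = verts \<alpha> - S - Q - ?I"
  have Q_sub: "Q \<subseteq> verts \<alpha> - S"
  proof
    fix x assume "x \<in> Q"
    then obtain p where p: "is_path \<alpha> p" "hd p = x" "set p \<inter> S = {}" by (auto simp: Q_def)
    then have "x \<in> set p" by (auto simp: is_path_def)
    then show "x \<in> verts \<alpha> - S" using p by (auto simp: is_path_def)
  qed
  have right_Q: "v \<in> Q" if "v \<in> right_verts \<alpha>" "v \<notin> S" for v
    unfolding Q_def using that shape by (intro CollectI exI[of _ "[v]"]) (auto simp: is_path_def is_shape_def)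
  have left_Q: "u \<notin> Q" if "u \<in> left_verts \<alpha>" for u
    using that S(1) by (auto simp: Q_def is_separator_def)
  have step: "y \<in> Q" if e: "{y, x} \<in> edges \<alpha>" and x: "x \<in> Q" and y: "y \<notin> S" for x y
  proof -
    obtain p where p: "is_path \<alpha> p" "hd p = x" "last p \<in> right_verts \<alpha>" "set p \<inter> S = {}"
      using x by (auto simp: Q_def)
    have yv: "y \<in> verts \<alpha>" using e shape by (auto simp: is_shape_def nsets_def)
    show ?thesis
    \<comment> \<open>Paths have distinct vertices, so a path that already passes through
      \<open>y\<close> is cut there instead of prolonged.\<close>
    proof (cases "y \<in> set p")
      case True
      then obtain p1 p2 where s: "p = p1 @ y # p2" by (auto simp: in_set_conv_decomp)
      have "is_path \<alpha> (y # p2)" using p(1) unfolding s by (auto simp: is_path_def successively_append_iff)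
      then show ?thesis
        unfolding Q_def using p s by (intro CollectI exI[of _ "y # p2"]) auto
    next
      case False
      then have "is_path \<alpha> (y # p)" using p(1,2) e yv by (auto simp: is_path_def successively_Cons)
      then show ?thesis
        unfolding Q_def using p y by (intro CollectI exI[of _ "y # p"]) (auto simp: is_path_def)
    qed
  qed
  have I_mid: "?I \<subseteq> verts \<alpha> - (left_verts \<alpha> \<union> right_verts \<alpha>)"
    by (auto simp: isolated_middle_verts_def middle_verts_def)
  have sub: "left_verts \<alpha> \<subseteq> verts \<alpha>" "right_verts \<alpha> \<subseteq> verts \<alpha>" "S \<subseteq> verts \<alpha>"
    using shape S by (auto simp: is_shape_def is_separator_def)
  show thesis
  proof (rule that[of L R])
    show "verts \<alpha> = S \<union> L \<union> R \<union> ?I" using Q_sub I_mid sub by (auto simp: L_def R_def)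
    show "S \<inter> L = {}" "S \<inter> R = {}" "L \<inter> R = {}" "(L \<union> R) \<inter> ?I = {}"
      using Q_sub by (auto simp: L_def R_def)
    show "left_verts \<alpha> \<subseteq> S \<union> L" using left_Q sub I_mid by (auto simp: L_def)
    show "right_verts \<alpha> \<subseteq> S \<union> R" using right_Q I_mid by (auto simp: R_def)
    fix e assume e: "e \<in> edges \<alpha>"
    then obtain a b where ab: "e = {a, b}" "a \<in> verts \<alpha>" "b \<in> verts \<alpha>"
      using shape by (auto simp: is_shape_def elim!: nsets2_E)
    have nI: "a \<notin> ?I" "b \<notin> ?I" using e ab by (auto simp: isolated_middle_verts_def)
    have "a \<in> Q \<Longrightarrow> b \<in> S \<or> b \<in> Q" "b \<in> Q \<Longrightarrow> a \<in> S \<or> a \<in> Q"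
      using step[of a b] step[of b a] e ab by (auto simp: insert_commute)
    then show "e \<subseteq> S \<union> L \<or> e \<subseteq> S \<union> R" using ab nI by (auto simp: L_def R_def)
  qed
qed

lemma path_avoids_isolated:
  assumes p: "is_path \<alpha> p" "hd p \<in> left_verts \<alpha>"
  shows "set p \<inter> isolated_middle_verts \<alpha> = {}"
proof (rule ccontr)
  assume "set p \<inter> isolated_middle_verts \<alpha> \<noteq> {}"
  then obtain x where x: "x \<in> set p" "x \<in> isolated_middle_verts \<alpha>" by auto
  then obtain p1 p2 where s: "p = p1 @ x # p2" by (auto simp: in_set_conv_decomp)
  have "p1 \<noteq> []" using p(2) x s by (auto simp: isolated_middle_verts_def middle_verts_def)
  then have "{last p1, x} \<in> edges \<alpha>" using p(1) s by (auto simp: is_path_def successively_append_iff)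
  then show False using x by (auto simp: isolated_middle_verts_def)
qed

text \<open>No path starting on the left meets an isolated middle vertex, so deleting these vertices
  from a minimum separator leaves it a separator, of the same size by minimality.\<close>

lemma ex_min_separator_nonisolated:
  assumes "is_shape \<alpha>"
  shows "\<exists>S. is_separator \<alpha> S \<and> card S = min_separator_size \<alpha> \<and> S \<inter> isolated_middle_verts \<alpha> = {}"
proof -
  obtain S where S: "is_separator \<alpha> S" "card S = min_separator_size \<alpha>" using ex_min_separator by blast
  let ?S = "S - isolated_middle_verts \<alpha>"
  have sep: "is_separator \<alpha> ?S"
    using S(1) path_avoids_isolated unfolding is_separator_def by blast
  have "finite S" using S assms by (auto simp: is_separator_def is_shape_def intro: finite_subset)
  then have "card ?S \<le> card S" by (intro card_mono) auto
  then have "card ?S = min_separator_size \<alpha>" using min_separator_size_le[OF sep] S(2) by simp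
  then show ?thesis using sep by blast
qed

text \<open>Every vertex receives its own block of consecutive labels, of length n div (|V| + 1);
  vertices of \<open>S\<close> are pinned to the first label of their block. The blocks are
  disjoint, so every choice within them is injective. The \<open>+ 1\<close> avoids a division by
  zero for a shape without vertices.\<close>

lemma card_realizations_extending_ge:
  fixes \<alpha> :: "'a shape"
  assumes shape: "is_shape \<alpha>" and S: "S \<subseteq> verts \<alpha>" and n: "n \<ge> card (verts \<alpha>) + 1"
  shows "\<exists>\<sigma>. (n div (card (verts \<alpha>) + 1)) ^ (card (verts \<alpha>) - card S)
    \<le> card {\<phi> \<in> realizations n \<alpha>. \<forall>s\<in>S. \<phi> s = \<sigma> s}"
proof -
  define v where "v = card (verts \<alpha>)"
  define m where "m = n div (v + 1)"
  have fin: "finite (verts \<alpha>)" using shape by (simp add: is_shape_def)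
  obtain h where h: "bij_betw h (verts \<alpha>) {0..<v}"
    unfolding v_def using ex_bij_betw_finite_nat[OF fin] by blast
  have m: "m > 0" "v * m \<le> n"
  proof -
    show "m > 0" using n by (simp add: m_def v_def div_greater_zero_iff)
    have "v * m \<le> (v + 1) * m" by simp
    also have "\<dots> \<le> n" by (simp only: m_def times_div_less_eq_dividend)
    finally show "v * m \<le> n" .
  qed
  define \<sigma> where "\<sigma> x = h x * m + 1" for x
  define B where "B x = (if x \<in> S then {\<sigma> x} else {h x * m + 1..h x * m + m})" for x
  have B: "(y - 1) div m = h x \<and> y \<in> {1..n}" if "x \<in> verts \<alpha>" "y \<in> B x" for x y
  proof -
    have y: "h x * m + 1 \<le> y" "y \<le> h x * m + m" using that(2) m by (auto simp: B_def \<sigma>_def split: if_splits)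
    have "h x < v" using h that(1) by (auto simp: bij_betw_def)
    then have "(h x + 1) * m \<le> v * m" by (intro mult_le_mono1) simp
    then have "y \<le> n" using y m by simp
    moreover have "(y - 1) div m = h x"
    proof (rule div_nat_eqI)
      show "m * h x \<le> y - 1" "y - 1 < m * Suc (h x)" using y m(1) by (simp_all add: mult.commute)
    qed
    ultimately show ?thesis using y by simp
  qed
  have "Pi\<^sub>E (verts \<alpha>) B \<subseteq> {\<phi> \<in> realizations n \<alpha>. \<forall>s\<in>S. \<phi> s = \<sigma> s}"
  proof
    fix \<phi> assume \<phi>: "\<phi> \<in> Pi\<^sub>E (verts \<alpha>) B"
    then have mem: "\<phi> x \<in> B x" if "x \<in> verts \<alpha>" for x using that by auto
    have "inj_on \<phi> (verts \<alpha>)"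
    proof (rule inj_onI)
      fix x y assume xy: "x \<in> verts \<alpha>" "y \<in> verts \<alpha>" "\<phi> x = \<phi> y"
      then have "h x = h y" using B[OF xy(1) mem] B[OF xy(2) mem] by simp
      then show "x = y" using h xy by (auto simp: bij_betw_def inj_on_def)
    qed
    moreover have "\<phi> \<in> verts \<alpha> \<rightarrow>\<^sub>E {1..n}"
      using \<phi> B mem by (auto simp: PiE_iff)
    moreover have "\<phi> s = \<sigma> s" if "s \<in> S" for s using mem[of s] that S by (auto simp: B_def)
    ultimately show "\<phi> \<in> {\<phi> \<in> realizations n \<alpha>. \<forall>s\<in>S. \<phi> s = \<sigma> s}" by (simp add: realizations_def)
  qed
  then have "card (Pi\<^sub>E (verts \<alpha>) B) \<le> card {\<phi> \<in> realizations n \<alpha>. \<forall>s\<in>S. \<phi> s = \<sigma> s}"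
    using finite_realizations[OF shape] by (intro card_mono) auto
  moreover have "card (Pi\<^sub>E (verts \<alpha>) B) = m ^ (v - card S)"
  proof -
    have "card (Pi\<^sub>E (verts \<alpha>) B) = (\<Prod>x\<in>verts \<alpha>. if x \<in> S then 1 else m)"
      using fin by (simp add: card_PiE B_def if_distrib cong: if_cong)
    also have "\<dots> = m ^ card (verts \<alpha> - S)"
      using fin by (simp add: prod.If_cases Diff_eq)
    also have "card (verts \<alpha> - S) = v - card S"
      using fin S by (simp add: card_Diff_subset finite_subset v_def)
    finally show ?thesis .
  qed
  ultimately show ?thesis unfolding m_def v_def by auto
qed

lemma sign_weight_square:
  assumes "\<epsilon> \<in> set_pmf (rademacher_edges n)" "is_shape \<alpha>" "\<phi> \<in> realizations n \<alpha>"
  shows "sign_weight (edges \<alpha>) \<epsilon> \<phi> * sign_weight (edges \<alpha>) \<epsilon> \<phi> = 1"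
proof -
  have "\<epsilon> (\<phi> ` e) * \<epsilon> (\<phi> ` e) = 1" if "e \<in> edges \<alpha>" for e
    using signs_value[OF finite_nsets_2, of \<epsilon> n "\<phi> ` e"] assms(1) realization_image_edge[OF assms(2,3) that]
    by (auto simp: rademacher_edges_eq)
  then show ?thesis unfolding sign_weight_def by (simp flip: prod.distrib)
qed

lemma sign_weight_restrict:
  assumes "\<And>e. e \<in> F \<Longrightarrow> e \<subseteq> X"
  shows "sign_weight F \<epsilon> (restrict \<phi> X) = sign_weight F \<epsilon> \<phi>"
  unfolding sign_weight_def using assms by (intro prod.cong refl arg_cong[where f = \<epsilon>] image_cong) auto

lemma restrict_realization:
  assumes "\<phi> \<in> realizations n \<alpha>" "X \<subseteq> verts \<alpha>" "S \<subseteq> X" "\<And>s. s \<in> S \<Longrightarrow> \<phi> s = \<sigma> s"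
  shows "restrict \<phi> X \<in> extensions n S \<sigma> X"
proof -
  have "inj_on \<phi> X" using assms(1,2) by (auto simp: realizations_def intro: inj_on_subset)
  then have "inj_on (restrict \<phi> X) X" by (simp cong: inj_on_cong)
  then show ?thesis using assms by (auto simp: extensions_def realizations_def)
qed

text \<open>Pairing the graph matrix with the two test vectors: every term has nonnegative expectation, and the
  realizations extending the fixed labels of the separator each contribute one.\<close>

lemma expectation_graph_matrix_norm_ge:
  fixes \<alpha> :: "'a shape"
  assumes shape: "is_shape \<alpha>" and us: "set us = left_verts \<alpha>" and vs: "set vs = right_verts \<alpha>"
    and split: "verts \<alpha> = S \<union> L \<union> R \<union> isolated_middle_verts \<alpha>"
    "S \<inter> L = {}" "S \<inter> R = {}" "L \<inter> R = {}" "(L \<union> R) \<inter> isolated_middle_verts \<alpha> = {}"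
    "left_verts \<alpha> \<subseteq> S \<union> L" "right_verts \<alpha> \<subseteq> S \<union> R"
    "\<And>e. e \<in> edges \<alpha> \<Longrightarrow> e \<subseteq> S \<union> L \<or> e \<subseteq> S \<union> R"
    and n: "n \<ge> card (verts \<alpha>) + 1"
  shows "real (n div (card (verts \<alpha>) + 1)) ^ (card (verts \<alpha>) - card S) /
      ((4 * 9 ^ (2 * card (edges \<alpha>)))\<^sup>2 * sqrt ((real (card (S \<union> L) ^ card (S \<union> L)) * real n ^ card L)
        * (real (card (S \<union> R) ^ card (S \<union> R)) * real n ^ card R)))
    \<le> measure_pmf.expectation (rademacher_edges n) (graph_matrix_norm n \<alpha> us vs)"
proof -
  let ?X = "S \<union> L" and ?Y = "S \<union> R" and ?A = "nsets {1..n} 2" and ?Rz = "realizations n \<alpha>"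
  let ?I = "multi_index n (length us)" and ?J = "multi_index n (length vs)"
  let ?E = "measure_pmf.expectation (rademacher_edges n)"
  \<comment> \<open>An edge inside \<open>S\<close> belongs to both sides. Giving it to
    \<open>E1\<close> alone makes \<open>E1\<close> and \<open>E2\<close> a partition of the edges,
    so the two partial weights multiply to the weight of the whole shape.\<close>
  define E1 where "E1 = {e \<in> edges \<alpha>. e \<subseteq> ?X}"
  define E2 where "E2 = edges \<alpha> - E1"
  have fin: "finite (verts \<alpha>)" using shape by (simp add: is_shape_def)
  have XV: "?X \<subseteq> verts \<alpha>" "?Y \<subseteq> verts \<alpha>" "S \<subseteq> verts \<alpha>" using split(1) by auto
  have finX: "finite ?X" "finite ?Y" using XV fin by (auto intro: finite_subset)
  have finE: "finite (edges \<alpha>)" "finite E1" "finite E2"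
    using finite_edges[OF shape] by (simp_all add: E1_def E2_def)
  have edge2: "e \<in> nsets (verts \<alpha>) 2" if "e \<in> edges \<alpha>" for e using shape that by (auto simp: is_shape_def)
  have E12: "E1 \<subseteq> nsets ?X 2" "E2 \<subseteq> nsets ?Y 2"
    using edge2 split(8) by (fastforce simp: E1_def E2_def nsets_def)+
  have E12': "e \<subseteq> ?X" if "e \<in> E1" for e using that by (simp add: E1_def)
  have E2': "e \<subseteq> ?Y" if "e \<in> E2" for e using that split(8) by (auto simp: E1_def E2_def)
  have nonisolated: "\<exists>e\<in>edges \<alpha>. w \<in> e"
    if "w \<in> verts \<alpha>" "w \<notin> left_verts \<alpha>" "w \<notin> right_verts \<alpha>" "w \<notin> isolated_middle_verts \<alpha>" for w
    using that by (auto simp: isolated_middle_verts_def middle_verts_def)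
  have coverX: "\<exists>e\<in>E1. w \<in> e" if w: "w \<in> ?X" "w \<notin> S" "w \<notin> set us" for w
  proof -
    have "w \<in> L" "w \<notin> ?Y" using w split by auto
    then have "w \<notin> right_verts \<alpha>" "w \<notin> isolated_middle_verts \<alpha>" "w \<in> verts \<alpha>" using split by auto
    then obtain e where e: "e \<in> edges \<alpha>" "w \<in> e" using nonisolated w us by blast
    then have "e \<subseteq> ?X" using split(8)[OF e(1)] \<open>w \<notin> ?Y\<close> by blast
    then show ?thesis using e by (auto simp: E1_def)
  qed
  have coverY: "\<exists>e\<in>E2. w \<in> e" if w: "w \<in> ?Y" "w \<notin> S" "w \<notin> set vs" for w
  proof -
    have "w \<in> R" "w \<notin> ?X" using w split by auto
    then have "w \<notin> left_verts \<alpha>" "w \<notin> isolated_middle_verts \<alpha>" "w \<in> verts \<alpha>" using split by auto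
    then obtain e where e: "e \<in> edges \<alpha>" "w \<in> e" using nonisolated w vs by blast
    then show ?thesis using \<open>w \<notin> ?X\<close> by (auto simp: E1_def E2_def)
  qed
  obtain \<sigma> where \<sigma>: "(n div (card (verts \<alpha>) + 1)) ^ (card (verts \<alpha>) - card S)
      \<le> card {\<phi> \<in> ?Rz. \<forall>s\<in>S. \<phi> s = \<sigma> s}"
    using card_realizations_extending_ge[OF shape XV(3) n] by blast
  define \<Phi> where "\<Phi> = {\<phi> \<in> ?Rz. \<forall>s\<in>S. \<phi> s = \<sigma> s}"
  let ?P = "extensions n S \<sigma> ?X" and ?Q = "extensions n S \<sigma> ?Y"
  define x where "x \<epsilon> = test_vector n S \<sigma> ?X E1 us \<epsilon>" for \<epsilon>
  define y where "y \<epsilon> = test_vector n S \<sigma> ?Y E2 vs \<epsilon>" for \<epsilon>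
  define Z where "Z \<epsilon> = (\<Sum>i\<in>?I. \<Sum>j\<in>?J. x \<epsilon> i * graph_matrix n \<alpha> us vs \<epsilon> i j * y \<epsilon> j)" for \<epsilon>
  define T where "T = {(\<psi>, \<phi>, \<eta>). \<psi> \<in> ?P \<and> \<phi> \<in> ?Rz \<and> \<eta> \<in> ?Q \<and> map \<psi> us = map \<phi> us \<and> map \<eta> vs = map \<phi> vs}"
  \<comment> \<open>\<open>K\<close> indexes the sign factors of one term of \<open>Z\<close>. The
    tags keep the three labellings apart, and the partition gives 2 |E| factors in every term,
    whence the exponent of 9.\<close>
  define K where "K = E1 <+> (edges \<alpha> <+> E2)"
  define g where "g \<tau> k = (case k of Inl e \<Rightarrow> fst \<tau> ` e | Inr (Inl e) \<Rightarrow> fst (snd \<tau>) ` e | Inr (Inr e) \<Rightarrow> snd (snd \<tau>) ` e)"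
    for \<tau> :: "('a \<Rightarrow> nat) \<times> ('a \<Rightarrow> nat) \<times> ('a \<Rightarrow> nat)" and k :: "'a set + 'a set + 'a set"
  have finK: "finite K" using finE by (simp add: K_def)
  have cardK: "card K = 2 * card (edges \<alpha>)"
  proof -
    have "E1 \<subseteq> edges \<alpha>" by (simp add: E1_def)
    then have "card E2 = card (edges \<alpha>) - card E1" "card E1 \<le> card (edges \<alpha>)"
      using finE by (simp_all add: E2_def card_Diff_subset card_mono)
    then show ?thesis using finE by (simp add: K_def card_Plus)
  qed
  have finT: "finite T"
  proof (rule finite_subset)
    show "T \<subseteq> ?P \<times> ?Rz \<times> ?Q" by (auto simp: T_def)
    show "finite (?P \<times> ?Rz \<times> ?Q)" using finX finite_realizations[OF shape] by (simp add: finite_extensions)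
  qed
  have prodK: "(\<Prod>k\<in>K. \<epsilon> (g \<tau> k))
      = sign_weight E1 \<epsilon> (fst \<tau>) * sign_weight (edges \<alpha>) \<epsilon> (fst (snd \<tau>)) * sign_weight E2 \<epsilon> (snd (snd \<tau>))" for \<epsilon> \<tau>
    using finE by (simp add: K_def prod.Plus g_def sign_weight_def mult.assoc)
  have gK: "g \<tau> ` K \<subseteq> ?A" if "\<tau> \<in> T" for \<tau>
  proof (rule image_subsetI)
    fix k assume k: "k \<in> K"
    have "\<psi> ` e \<in> ?A" if "\<psi> \<in> extensions n S \<sigma> X'" "e \<in> nsets X' 2" for \<psi> e X'
      using that by (intro image_edge) (auto simp: extensions_def)
    then show "g \<tau> k \<in> ?A"
      using k that E12 realization_image_edge[OF shape] by (auto simp: K_def g_def T_def)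
  qed
  have Z: "Z \<epsilon> = (\<Sum>\<tau>\<in>T. \<Prod>k\<in>K. \<epsilon> (g \<tau> k))" for \<epsilon>
  proof -
    have "Z \<epsilon> = (\<Sum>i\<in>?I. \<Sum>j\<in>?J. (\<Sum>\<psi>\<in>?P. sign_weight E1 \<epsilon> \<psi> * (if map \<psi> us = i then 1 else 0))
        * (\<Sum>\<phi>\<in>?Rz. sign_weight (edges \<alpha>) \<epsilon> \<phi> * (if map \<phi> us = i \<and> map \<phi> vs = j then 1 else 0))
        * (\<Sum>\<eta>\<in>?Q. sign_weight E2 \<epsilon> \<eta> * (if map \<eta> vs = j then 1 else 0)))"
      unfolding Z_def x_def y_def test_vector_def by (intro sum.cong refl) (simp only: graph_matrix_eq)
    also have "\<dots> = (\<Sum>(\<psi>, \<phi>, \<eta>)\<in>T. sign_weight E1 \<epsilon> \<psi> * sign_weight (edges \<alpha>) \<epsilon> \<phi> * sign_weight E2 \<epsilon> \<eta>)"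
      unfolding T_def using us vs shape finX
      by (intro bilinear_elementary_sum finite_extensions finite_realizations finite_multi_index realization_multi_index)
        (auto simp: is_shape_def)
    finally show ?thesis by (simp add: prodK case_prod_beta)
  qed
  have EZ: "real (n div (card (verts \<alpha>) + 1)) ^ (card (verts \<alpha>) - card S) \<le> measure_pmf.expectation (signs ?A) Z"
  proof -
    \<comment> \<open>The diagonal triples: both partial labellings are restrictions of \<phi>, and
      the product of the three weights is the square of the weight of \<phi>, which is 1.\<close>
    define t where "t \<phi> = (restrict \<phi> ?X, \<phi>, restrict \<phi> ?Y)" for \<phi> :: "'a \<Rightarrow> nat"
    have t: "t \<phi> \<in> T" if "\<phi> \<in> \<Phi>" for \<phi>
    proof -
      have "restrict \<phi> ?X \<in> ?P" "restrict \<phi> ?Y \<in> ?Q"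
        using that XV by (auto simp: \<Phi>_def intro!: restrict_realization)
      moreover have "map (restrict \<phi> ?X) us = map \<phi> us" "map (restrict \<phi> ?Y) vs = map \<phi> vs"
        using us vs split by auto
      ultimately show ?thesis using that by (simp add: t_def T_def \<Phi>_def)
    qed
    have one: "measure_pmf.expectation (signs ?A) (\<lambda>\<epsilon>. \<Prod>k\<in>K. \<epsilon> (g (t \<phi>) k)) = 1" if \<phi>: "\<phi> \<in> \<Phi>" for \<phi>
    proof -
      have "(\<Prod>k\<in>K. \<epsilon> (g (t \<phi>) k)) = 1" if \<epsilon>: "\<epsilon> \<in> set_pmf (signs ?A)" for \<epsilon>
      proof -
        have "(\<Prod>k\<in>K. \<epsilon> (g (t \<phi>) k)) = sign_weight (edges \<alpha>) \<epsilon> \<phi> * (sign_weight E2 \<epsilon> \<phi> * sign_weight E1 \<epsilon> \<phi>)"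
          using E12' E2' by (simp add: prodK t_def sign_weight_restrict)
        also have "sign_weight E2 \<epsilon> \<phi> * sign_weight E1 \<epsilon> \<phi> = sign_weight (edges \<alpha>) \<epsilon> \<phi>"
          unfolding sign_weight_def E2_def using finE by (intro prod.subset_diff[symmetric]) (auto simp: E1_def)
        also have "sign_weight (edges \<alpha>) \<epsilon> \<phi> * sign_weight (edges \<alpha>) \<epsilon> \<phi> = 1"
          using \<epsilon> \<phi> by (intro sign_weight_square[of _ n] shape) (auto simp: rademacher_edges_eq \<Phi>_def)
        finally show ?thesis .
      qed
      then have "measure_pmf.expectation (signs ?A) (\<lambda>\<epsilon>. \<Prod>k\<in>K. \<epsilon> (g (t \<phi>) k))
          = measure_pmf.expectation (signs ?A) (\<lambda>_. 1)"
        by (rule expectation_signs_cong)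
      then show ?thesis by simp
    qed
    have inj: "inj_on t \<Phi>" by (auto simp: inj_on_def t_def)
    have "real (n div (card (verts \<alpha>) + 1)) ^ (card (verts \<alpha>) - card S) \<le> real (card \<Phi>)"
      using \<sigma> unfolding \<Phi>_def by (simp only: of_nat_le_iff flip: of_nat_power)
    also have "\<dots> = (\<Sum>\<phi>\<in>\<Phi>. 1)" by simp
    also have "\<dots> = (\<Sum>\<phi>\<in>\<Phi>. measure_pmf.expectation (signs ?A) (\<lambda>\<epsilon>. \<Prod>k\<in>K. \<epsilon> (g (t \<phi>) k)))"
      by (intro sum.cong refl one[symmetric])
    also have "\<dots> = (\<Sum>\<tau>\<in>t ` \<Phi>. measure_pmf.expectation (signs ?A) (\<lambda>\<epsilon>. \<Prod>k\<in>K. \<epsilon> (g \<tau> k)))"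
      by (simp add: sum.reindex[OF inj])
    also have "\<dots> \<le> (\<Sum>\<tau>\<in>T. measure_pmf.expectation (signs ?A) (\<lambda>\<epsilon>. \<Prod>k\<in>K. \<epsilon> (g \<tau> k)))"
    proof (rule sum_mono2[OF finT])
      show "t ` \<Phi> \<subseteq> T" using t by auto
      \<comment> \<open>An off-diagonal triple has expectation 0 or 1, so discarding it can only
        lower the sum.\<close>
      fix \<tau> assume "\<tau> \<in> T - t ` \<Phi>"
      then show "0 \<le> measure_pmf.expectation (signs ?A) (\<lambda>\<epsilon>. \<Prod>k\<in>K. \<epsilon> (g \<tau> k))"
        using gK by (subst expectation_signs_prod[OF finite_nsets_2 finK]) auto
    qed
    also have "\<dots> = measure_pmf.expectation (signs ?A) Z"
      unfolding Z by (rule expectation_signs_sum[OF finite_nsets_2, symmetric])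
    finally show ?thesis .
  qed
  have n0: "n > 0" using n by simp
  \<comment> \<open>An empty side is covered by \<open>0 ^ 0 = 1\<close>.\<close>
  have pw: "real (k ^ k) * real n ^ j > 0" for k j :: nat
    using n0 by (cases "k = 0") auto
  have "real (n div (card (verts \<alpha>) + 1)) ^ (card (verts \<alpha>) - card S) /
      ((4 * 9 ^ card K)\<^sup>2 * sqrt ((real (card ?X ^ card ?X) * real n ^ card L) * (real (card ?Y ^ card ?Y) * real n ^ card R)))
    \<le> measure_pmf.expectation (signs ?A) (graph_matrix_norm n \<alpha> us vs)"
  proof (rule expectation_ge_of_bilinear_bound[where X = "\<lambda>\<epsilon>. L2_set (x \<epsilon>) ?I" and Y = "\<lambda>\<epsilon>. L2_set (y \<epsilon>) ?J" and Z = Z])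
    show "measure_pmf.expectation (signs ?A) (\<lambda>\<epsilon>. Z \<epsilon> ^ 4)
        \<le> 9 ^ card K * (measure_pmf.expectation (signs ?A) (\<lambda>\<epsilon>. (Z \<epsilon>)\<^sup>2))\<^sup>2"
      unfolding Z by (rule fourth_moment_sign_polynomial[OF finite_nsets_2 finT finK gK])
    show "\<bar>Z \<epsilon>\<bar> \<le> graph_matrix_norm n \<alpha> us vs \<epsilon> * (L2_set (x \<epsilon>) ?I * L2_set (y \<epsilon>) ?J)" for \<epsilon>
      unfolding Z_def graph_matrix_norm_def by (rule bilinear_le_op_norm[OF finite_multi_index])
    have XYS: "?X - S = L" "?Y - S = R" using split by auto
    have "?E (\<lambda>\<epsilon>. (L2_set (x \<epsilon>) ?I)\<^sup>2) \<le> real (card ?X ^ card ?X) * real n ^ card (?X - S)"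
      unfolding x_def by (rule expectation_test_vector_norm_le[OF finX(1) _ E12(1)]) (use us split(6) coverX in auto)
    then show "measure_pmf.expectation (signs ?A) (\<lambda>\<epsilon>. (L2_set (x \<epsilon>) ?I)\<^sup>2) \<le> real (card ?X ^ card ?X) * real n ^ card L"
      unfolding rademacher_edges_eq XYS .
    have "?E (\<lambda>\<epsilon>. (L2_set (y \<epsilon>) ?J)\<^sup>2) \<le> real (card ?Y ^ card ?Y) * real n ^ card (?Y - S)"
      unfolding y_def by (rule expectation_test_vector_norm_le[OF finX(2) _ E12(2)]) (use vs split(7) coverY in auto)
    then show "measure_pmf.expectation (signs ?A) (\<lambda>\<epsilon>. (L2_set (y \<epsilon>) ?J)\<^sup>2) \<le> real (card ?Y ^ card ?Y) * real n ^ card R"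
      unfolding rademacher_edges_eq XYS .
    show "real (n div (card (verts \<alpha>) + 1)) ^ (card (verts \<alpha>) - card S) > 0"
      using n by (simp add: div_greater_zero_iff)
  qed (use EZ pw in \<open>auto simp: finite_imp_finite_nsets graph_matrix_norm_def op_norm_nonneg\<close>)
  then show ?thesis by (simp only: cardK rademacher_edges_eq)
qed

theorem expectation_graph_matrix_norm_lower:
  fixes \<alpha> :: "'a shape"
  assumes shape: "is_shape \<alpha>"
  shows "\<exists>c n0. c > 0 \<and> (\<forall>us vs. set us = left_verts \<alpha> \<and> set vs = right_verts \<alpha> \<longrightarrow> (\<forall>n\<ge>n0.
    c * real n powr norm_exponent \<alpha> \<le> measure_pmf.expectation (rademacher_edges n) (graph_matrix_norm n \<alpha> us vs)))"
proof -
  obtain S where S: "is_separator \<alpha> S" "card S = min_separator_size \<alpha>" "S \<inter> isolated_middle_verts \<alpha> = {}"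
    using ex_min_separator_nonisolated[OF shape] by blast
  obtain L R where split: "verts \<alpha> = S \<union> L \<union> R \<union> isolated_middle_verts \<alpha>"
    "S \<inter> L = {}" "S \<inter> R = {}" "L \<inter> R = {}" "(L \<union> R) \<inter> isolated_middle_verts \<alpha> = {}"
    "left_verts \<alpha> \<subseteq> S \<union> L" "right_verts \<alpha> \<subseteq> S \<union> R"
    "\<And>e. e \<in> edges \<alpha> \<Longrightarrow> e \<subseteq> S \<union> L \<or> e \<subseteq> S \<union> R"
    using separator_split[OF shape S(1,3)] by metis
  define v where "v = card (verts \<alpha>)"
  define d where "d = v - card S"
  define w where "w = real (card (S \<union> L) ^ card (S \<union> L)) * real (card (S \<union> R) ^ card (S \<union> R))"
  define K :: real where "K = (4 * 9 ^ (2 * card (edges \<alpha>)))\<^sup>2"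
  \<comment> \<open>The three factors come from the block length with its rounding, from the fourth
    moment constant, and from the second moments of the two test vectors.\<close>
  define c where "c = 1 / (real (2 * (v + 1)) ^ d * K * sqrt w)"
  have fin: "finite (verts \<alpha>)" using shape by (simp add: is_shape_def)
  then have fins: "finite S" "finite L" "finite R" "finite (isolated_middle_verts \<alpha>)"
    using split(1) by (metis finite_Un)+
  have "v = card S + card L + card R + card (isolated_middle_verts \<alpha>)"
  proof -
    have "(S \<union> L) \<inter> R = {}" "(S \<union> L \<union> R) \<inter> isolated_middle_verts \<alpha> = {}" using split(2-5) S(3) by auto
    then show ?thesis unfolding v_def split(1) using fins split(2) by (simp only: card_Un_disjoint finite_Un)
  qed
  then have d: "d = card L + card R + card (isolated_middle_verts \<alpha>)" "v = card S + d" by (simp_all add: d_def)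
  have "k ^ k > 0" for k :: nat by (cases "k = 0") auto
  then have w: "w > 0" unfolding w_def by (metis mult_pos_pos of_nat_0_less_iff)
  have K: "K > 0" by (simp add: K_def)
  have c: "c > 0" using w K by (simp add: c_def)
  have "c * real n powr norm_exponent \<alpha> \<le> measure_pmf.expectation (rademacher_edges n) (graph_matrix_norm n \<alpha> us vs)"
    if us: "set us = left_verts \<alpha>" and vs: "set vs = right_verts \<alpha>" and n: "n \<ge> 2 * (v + 1)" for us vs n
  proof -
    have n0: "real n > 0" using n by simp
    \<comment> \<open>Rounding down loses at most half, because the quotient is at least 1.\<close>
    have "real n / real (2 * (v + 1)) \<le> real (n div (v + 1))"
    proof -
      have "n < (n div (v + 1) + 1) * (v + 1)" by (metis Suc_eq_plus1 dividend_less_div_times mult.commute zero_less_Suc add.commute distrib_right mult_1 nat_mult_1)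
      moreover have "1 \<le> n div (v + 1)" using n by (simp add: div_greater_zero_iff Suc_le_eq)
      then have "(n div (v + 1) + 1) * (v + 1) \<le> (2 * (n div (v + 1))) * (v + 1)" by (intro mult_le_mono1) simp
      then have "(n div (v + 1) + 1) * (v + 1) \<le> n div (v + 1) * (2 * (v + 1))" by (simp only: mult_ac)
      ultimately have "n \<le> n div (v + 1) * (2 * (v + 1))" by linarith
      then have "real n \<le> real (n div (v + 1)) * real (2 * (v + 1))" by (metis of_nat_le_iff of_nat_mult)
      then show ?thesis by (simp add: field_simps)
    qed
    then have "(real n / real (2 * (v + 1))) ^ d \<le> real (n div (v + 1)) ^ d" by (intro power_mono) auto
    then have m: "real n ^ d / real (2 * (v + 1)) ^ d \<le> real (n div (v + 1)) ^ d" by (simp only: power_divide)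
    \<comment> \<open>The pairing is of order n^d with d = |L| + |R| + |W_iso|, and the test vectors
      cost the square root of n^(|L| + |R|). The isolated vertices thus keep their full
      power.\<close>
    have "norm_exponent \<alpha> = real d - real (card L + card R) / 2"
      using d S(2) by (simp add: norm_exponent_def v_def[symmetric] field_simps)
    then have "real n powr norm_exponent \<alpha> = real n ^ d / real n powr (real (card L + card R) / 2)"
      using n0 by (simp add: powr_diff powr_realpow)
    also have "real n powr (real (card L + card R) / 2) = sqrt (real n ^ card L * real n ^ card R)"
      using n0 by (simp only: powr_half_sqrt_powr powr_realpow power_add of_nat_0_le_iff less_imp_le)
    finally have "c * real n powr norm_exponent \<alpha>
        = (real n ^ d / real (2 * (v + 1)) ^ d) / (K * (sqrt w * sqrt (real n ^ card L * real n ^ card R)))"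
      by (simp add: c_def)
    also have "\<dots> \<le> real (n div (v + 1)) ^ d / (K * (sqrt w * sqrt (real n ^ card L * real n ^ card R)))"
      using m K w by (intro divide_right_mono) auto
    also have "sqrt w * sqrt (real n ^ card L * real n ^ card R)
        = sqrt ((real (card (S \<union> L) ^ card (S \<union> L)) * real n ^ card L) * (real (card (S \<union> R) ^ card (S \<union> R)) * real n ^ card R))"
      unfolding w_def real_sqrt_mult by (simp add: mult_ac)
    also have "real (n div (v + 1)) ^ d / (K * \<dots>)
        \<le> measure_pmf.expectation (rademacher_edges n) (graph_matrix_norm n \<alpha> us vs)"
      unfolding K_def d_def v_def
      by (rule expectation_graph_matrix_norm_ge[OF shape us vs split]) (use n in \<open>simp_all add: v_def\<close>)
    finally show ?thesis .
  qed
  then show ?thesis using c by (intro exI[of _ c] exI[of _ "2 * (v + 1)"]) auto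
qed

theorem theorem4p8:
  fixes \<alpha> :: "'a shape"
  assumes "is_shape \<alpha>"
  shows "\<exists>(c::real) (C::real) (n0::nat). c > 0 \<and> C > 0 \<and> n0 \<ge> 2 \<and>
    (\<forall>us vs. is_ordering us (left_verts \<alpha>) \<and> is_ordering vs (right_verts \<alpha>) \<longrightarrow>
      (\<forall>n\<ge>n0.
        c * real n powr norm_exponent \<alpha>
          \<le> measure_pmf.expectation (rademacher_edges n) (graph_matrix_norm n \<alpha> us vs) \<and>
        measure_pmf.expectation (rademacher_edges n) (graph_matrix_norm n \<alpha> us vs)
          \<le> C * real n powr norm_exponent \<alpha> * ln (real n) powr (log_exponent \<alpha> / 2)))"
proof -
  obtain C n1 where up: "C > 0" "\<And>us vs n. set us = left_verts \<alpha> \<Longrightarrow> set vs = right_verts \<alpha> \<Longrightarrow> n \<ge> n1 \<Longrightarrow>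
      measure_pmf.expectation (rademacher_edges n) (graph_matrix_norm n \<alpha> us vs)
        \<le> C * real n powr norm_exponent \<alpha> * ln (real n) powr (log_exponent \<alpha> / 2)"
    using expectation_graph_matrix_norm_upper[OF assms] by metis
  obtain c n2 where low: "c > 0" "\<And>us vs n. set us = left_verts \<alpha> \<Longrightarrow> set vs = right_verts \<alpha> \<Longrightarrow> n \<ge> n2 \<Longrightarrow>
      c * real n powr norm_exponent \<alpha>
        \<le> measure_pmf.expectation (rademacher_edges n) (graph_matrix_norm n \<alpha> us vs)"
    using expectation_graph_matrix_norm_lower[OF assms] by metis
  show ?thesis
    using up low by (intro exI[of _ c] exI[of _ C] exI[of _ "max 2 (max n1 n2)"]) (auto simp: is_ordering_def)
qed

end
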